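(* Let $\beta,\epsilon\in(0,1)$ be fixed. Then for all sufficiently large $T$, \[ \max_{T^{\beta}\le t\le T}\ -\mathrm{Re}\,\frac{\zeta'}{\zeta}(1+{\rm i}t)\ \ge\ \log\log T+\log\log\log T+C_1-\epsilon, \] where \[ C_1=\log(1-\beta)-\log\log 4-\gamma-\sum_{k=2}^{\infty}\sum_{p}\frac{\log p}{p^k}-1 . \] In particular, for all sufficiently large $T$, \[ \max_{T^{\beta}\le t\le T}\left|\frac{\zeta'}{\zeta}(1+{\rm i}t)\right|\ \ge\ \log\log T+\log\log\log T+C_1-\epsilon. \]
   Context: $\zeta$ is the Riemann zeta function, $\gamma$ is the Euler–Mascheroni constant, and $p$ runs over primes. *)

theory Defs
  imports "HOL-Complex_Analysis.Complex_Analysis"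
begin

text \<open>
  The Riemann zeta function is the analytic continuation of its Dirichlet series to the plane
  punctured at \<open>1\<close>. The value at the pole is fixed to be \<open>0\<close> to make it unique as a total
  function. Existence and uniqueness are proved below.
\<close>

definition zeta_continuation :: "(complex \<Rightarrow> complex) \<Rightarrow> bool" where
  "zeta_continuation f \<longleftrightarrow>
     f holomorphic_on (- {1}) \<and>
     (\<forall>s. Re s > 1 \<longrightarrow> (\<lambda>n. 1 / of_nat (Suc n) powr s) sums f s) \<and>
     f 1 = 0"

definition zeta :: "complex \<Rightarrow> complex" where
  "zeta = (THE f. zeta_continuation f)"

text \<open>
  Existence: from the binomial expansion of \<open>(1 + 1/N) powr (1 - s)\<close>, telescoping gives for
  \<open>g s = (s - 1) * zeta s\<close> an identity
  \<open>g s = 1 + H s - (\<Sum>i=1..k. (1 - s gchoose i) / (i + 1) * g (s + i))\<close> with \<open>H\<close> holomorphic for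
  \<open>Re s > - k\<close>, which extends \<open>g\<close> from one half-plane to the next.
\<close>

lemma powr_binomial_remainder:
  fixes A :: real and K :: nat
  obtains C where "C \<ge> 0"
    "\<And>a x. norm (a::complex) \<le> A \<Longrightarrow> 0 \<le> x \<Longrightarrow> x \<le> 1 \<Longrightarrow>
       norm ((1 + of_real x) powr a - (\<Sum>j\<le>K. (a gchoose j) * of_real x ^ j)) \<le> C * x ^ Suc K"
proof
  let ?C = "(A + real K) ^ Suc K * 2 powr A / fact K"
  show "max 0 ?C \<ge> 0" by simp
  fix a :: complex and x :: real
  assume a: "norm a \<le> A" and x: "0 \<le> x" "x \<le> 1"
  have A: "A \<ge> 0" using a norm_ge_zero[of a] by linarith
  define f where "f = (\<lambda>i z. (\<Prod>j<i. a - of_nat j) * (1 + z) powr (a - of_nat i))"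
  define S where "S = (of_real ` {0..1} :: complex set)"
  have "norm (f 0 (of_real x) - (\<Sum>i\<le>K. f i 0 * (of_real x - 0) ^ i / fact i))
          \<le> ((A + real K) ^ Suc K * 2 powr A) * norm (of_real x - 0 :: complex) ^ Suc K / fact K"
  proof (rule complex_Taylor[of S])
    show "convex S" unfolding S_def
      by (intro convex_linear_image bounded_linear.linear bounded_linear_of_real) auto
    show "0 \<in> S" unfolding S_def by (auto intro!: image_eqI[of _ _ 0])
    show "complex_of_real x \<in> S" using x unfolding S_def by auto
  next
    fix i z assume z: "z \<in> S"
    then obtain u where u: "z = of_real u" "0 \<le> u" "u \<le> 1" unfolding S_def by auto
    have "1 + z \<notin> \<real>\<^sub>\<le>\<^sub>0" using u by (auto simp: complex_nonpos_Reals_iff)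
    then show "(f i has_field_derivative f (Suc i) z) (at z within S)"
      unfolding f_def
      by (auto intro!: derivative_eq_intros simp: algebra_simps)
  next
    fix z assume z: "z \<in> S"
    then obtain u where u: "z = of_real u" "0 \<le> u" "u \<le> 1" unfolding S_def by auto
    have "norm (\<Prod>j<Suc K. a - of_nat j) \<le> (\<Prod>j<Suc K. A + real K)"
      unfolding prod_norm[symmetric]
    proof (intro prod_mono conjI)
      fix j assume "j \<in> {..<Suc K}"
      then show "norm (a - of_nat j) \<le> A + real K"
        using norm_triangle_ineq4[of a "of_nat j"] a by auto
    qed auto
    moreover have "norm ((1 + z) powr (a - of_nat (Suc K))) \<le> 2 powr A"
    proof -
      have "1 + z = of_real (1 + u)" using u by simp
      then have "norm ((1 + z) powr (a - of_nat (Suc K))) = (1 + u) powr (Re a - real (Suc K))"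
        using u by (subst norm_powr_real_powr) auto
      also have "\<dots> \<le> (1 + u) powr A"
        using u a abs_Re_le_cmod[of a] by (intro powr_mono) auto
      also have "\<dots> \<le> 2 powr A" using u A by (intro powr_mono2) auto
      finally show ?thesis .
    qed
    ultimately show "norm (f (Suc K) z) \<le> (A + real K) ^ Suc K * 2 powr A"
      unfolding f_def norm_mult using A by (intro mult_mono) auto
  qed
  also have "(\<Sum>i\<le>K. f i 0 * (of_real x - 0) ^ i / fact i) = (\<Sum>j\<le>K. (a gchoose j) * of_real x ^ j)"
    by (intro sum.cong) (auto simp: f_def gbinomial_prod_rev atLeast0LessThan)
  also have "(A + real K) ^ Suc K * 2 powr A * norm (of_real x - 0 :: complex) ^ Suc K / fact K
      \<le> max 0 ?C * x ^ Suc K"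
  proof -
    have "?C * x ^ Suc K \<le> max 0 ?C * x ^ Suc K"
      using x by (intro mult_right_mono) auto
    then show ?thesis using x by (simp add: mult_ac)
  qed
  finally show "norm ((1 + of_real x) powr a - (\<Sum>j\<le>K. (a gchoose j) * of_real x ^ j)) \<le> max 0 ?C * x ^ Suc K"
    by (simp add: f_def)
qed

lemma summable_Suc_powr: "r < -1 \<Longrightarrow> summable (\<lambda>n. real (Suc n) powr r)"
  using summable_real_powr_iff[of r] by (subst summable_Suc_iff) simp

lemma open_Re_gt: "open {s. Re s > c}"
  by (rule open_halfspace_Re_gt)

lemma norm_Suc_powr: "norm (of_nat (Suc n) powr (s::complex)) = real (Suc n) powr Re s"
  by (subst norm_powr_real_powr) (auto simp: Reals_of_nat[of "Suc n", unfolded of_nat_Suc] simp del: of_nat_Suc)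

lemma series_holomorphic:
  assumes "open S" "\<And>n. h n holomorphic_on S"
    and "\<And>x. x \<in> S \<Longrightarrow> \<exists>d M. 0 < d \<and> summable M \<and> (\<forall>n. \<forall>y\<in>ball x d \<inter> S. norm (h n y :: complex) \<le> M n)"
  obtains g where "g holomorphic_on S" "\<And>x. x \<in> S \<Longrightarrow> (\<lambda>n. h n x) sums g x"
proof -
  have "\<exists>g g'. \<forall>x \<in> S. ((\<lambda>n. h n x) sums g x) \<and> ((\<lambda>n. deriv (h n) x) sums g' x) \<and> (g has_field_derivative g' x) (at x)"
  proof (rule series_and_derivative_comparison_local[OF assms(1)])
    show "(h n has_field_derivative deriv (h n) x) (at x)" if "x \<in> S" for n x
      using assms(1,2) that holomorphic_derivI by blast
    show "\<exists>d M. 0 < d \<and> summable M \<and> (\<forall>\<^sub>F n in sequentially. \<forall>y\<in>ball x d \<inter> S. norm (h n y) \<le> M n)" if "x \<in> S" for x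
      using assms(3)[OF that] by (auto intro!: always_eventually)
  qed
  then obtain g g' where "\<forall>x \<in> S. ((\<lambda>n. h n x) sums g x) \<and> (g has_field_derivative g' x) (at x)"
    by blast
  with that[of g] assms(1) show ?thesis by (auto simp: holomorphic_on_open)
qed

lemma dirichlet_series_holomorphic:
  obtains D where "D holomorphic_on {s. Re s > 1}"
    "\<And>s. Re s > 1 \<Longrightarrow> (\<lambda>n. 1 / of_nat (Suc n) powr s) sums D s"
proof -
  have "\<exists>d M. 0 < d \<and> summable M \<and> (\<forall>n. \<forall>y\<in>ball x d \<inter> {s. Re s > 1}. norm (1 / of_nat (Suc n) powr y) \<le> M n)"
    if x: "x \<in> {s. Re s > 1}" for x
  proof -
    define d where "d = (Re x - 1) / 2"
    have "norm (1 / of_nat (Suc n) powr y) \<le> real (Suc n) powr (- (Re x - d))" if "y \<in> ball x d" for n y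
    proof -
      have "Re y \<ge> Re x - d" using that abs_Re_le_cmod[of "x - y"] by (auto simp: dist_norm)
      then have "real (Suc n) powr (- Re y) \<le> real (Suc n) powr (- (Re x - d))"
        by (intro powr_mono) auto
      then show ?thesis by (simp add: norm_divide norm_Suc_powr powr_minus_divide del: of_nat_Suc)
    qed
    moreover have "summable (\<lambda>n. real (Suc n) powr (- (Re x - d)))"
      using x by (intro summable_Suc_powr) (auto simp: d_def field_simps)
    moreover have "d > 0" using x by (auto simp: d_def)
    ultimately show ?thesis by blast
  qed
  then obtain D where "D holomorphic_on {s. Re s > 1}"
    "\<And>s. s \<in> {s. Re s > 1} \<Longrightarrow> (\<lambda>n. 1 / of_nat (Suc n) powr s) sums D s"
    by (rule series_holomorphic[OF open_Re_gt, rotated])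
       (auto intro!: holomorphic_intros simp: complex_nonpos_Reals_iff simp del: of_nat_Suc)
  then show ?thesis using that by auto
qed

lemma binomial_series_holomorphic:
  fixes K :: nat
  defines "h \<equiv> \<lambda>n s. of_nat (Suc n) powr (1 - s) *
             ((1 + of_real (1 / real (Suc n))) powr (1 - s) -
               (\<Sum>j\<le>Suc K. ((1 - s) gchoose j) * of_real (1 / real (Suc n)) ^ j))"
  obtains H :: "complex \<Rightarrow> complex" where "H holomorphic_on {s. Re s > - real K}"
    "\<And>s. Re s > - real K \<Longrightarrow> (\<lambda>n. h n s) sums H s"
proof -
  let ?S = "{s. Re s > - real K}"
  have "\<exists>d M. 0 < d \<and> summable M \<and> (\<forall>n. \<forall>y\<in>ball x d \<inter> ?S. norm (h n y) \<le> M n)"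
    if x: "x \<in> ?S" for x
  proof -
    define d where "d = (Re x + real K) / 2"
    obtain C where C: "C \<ge> 0" and bound: "\<And>a x'. norm (a::complex) \<le> norm (1 - x) + d \<Longrightarrow> 0 \<le> x' \<Longrightarrow> x' \<le> 1 \<Longrightarrow>
       norm ((1 + of_real x') powr a - (\<Sum>j\<le>Suc K. (a gchoose j) * of_real x' ^ j)) \<le> C * x' ^ Suc (Suc K)"
      using powr_binomial_remainder[of "norm (1 - x) + d" "Suc K"] by blast
    have "norm (h n y) \<le> C * real (Suc n) powr (- (Re x - d) - real K - 1)" if y: "y \<in> ball x d" for n y
    proof -
      let ?N = "real (Suc n)"
      have Re: "Re y \<ge> Re x - d" using y abs_Re_le_cmod[of "x - y"] by (auto simp: dist_norm)
      have "norm (1 - y) \<le> norm (1 - x) + d"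
        using norm_triangle_ineq[of "1 - x" "x - y"] y by (auto simp: dist_norm)
      then have "norm (h n y) \<le> ?N powr (1 - Re y) * (C * (1 / ?N) ^ Suc (Suc K))"
        unfolding h_def norm_mult norm_Suc_powr
        by (intro mult_mono bound) auto
      also have "(1 / ?N) ^ Suc (Suc K) = ?N powr (- real (Suc (Suc K)))"
        by (simp only: powr_minus_divide power_one_over powr_realpow of_nat_0_less_iff zero_less_Suc)
      also have "?N powr (1 - Re y) * (C * ?N powr (- real (Suc (Suc K)))) = C * ?N powr (- Re y - real K - 1)"
      proof -
        have "- Re y - real K - 1 = (1 - Re y) + (- real (Suc (Suc K)))" by simp
        then show ?thesis by (simp only: powr_add mult_ac)
      qed
      also have "\<dots> \<le> C * ?N powr (- (Re x - d) - real K - 1)"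
        using C Re by (intro mult_left_mono powr_mono) auto
      finally show ?thesis .
    qed
    moreover have "summable (\<lambda>n. C * real (Suc n) powr (- (Re x - d) - real K - 1))"
      using x by (intro summable_mult summable_Suc_powr) (auto simp: d_def field_simps)
    moreover have "d > 0" using x by (auto simp: d_def)
    ultimately show ?thesis by blast
  qed
  moreover have "h n holomorphic_on ?S" for n
  proof -
    have "1 + complex_of_real (1 / real (Suc n)) \<noteq> 0"
      by (metis add_pos_pos less_numeral_extra(1,3) of_nat_0_less_iff of_real_1 of_real_add
           of_real_eq_0_iff zero_less_Suc zero_less_divide_1_iff)
    then show ?thesis
      unfolding h_def gbinomial_prod_rev
      by (auto intro!: holomorphic_intros simp: complex_nonpos_Reals_iff simp del: of_nat_Suc)
  qed
  ultimately obtain H where "H holomorphic_on ?S" "\<And>s. s \<in> ?S \<Longrightarrow> (\<lambda>n. h n s) sums H s"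
    using series_holomorphic[OF open_Re_gt, of h "- real K"] by blast
  then show ?thesis using that by auto
qed

lemma zeta_shift_identity:
  fixes D :: "complex \<Rightarrow> complex" and K :: nat
  assumes D: "\<And>s. Re s > 1 \<Longrightarrow> (\<lambda>n. 1 / of_nat (Suc n) powr s) sums D s"
  assumes s: "Re s > 1"
  assumes H: "(\<lambda>n. of_nat (Suc n) powr (1 - s) *
             ((1 + of_real (1 / real (Suc n))) powr (1 - s) -
               (\<Sum>j\<le>Suc K. ((1 - s) gchoose j) * of_real (1 / real (Suc n)) ^ j))) sums Hs"
  shows "(s - 1) * D s = 1 + Hs - (\<Sum>i=1..K. ((1 - s) gchoose i) / of_nat (Suc i) * ((s + of_nat i - 1) * D (s + of_nat i)))"
proof -
  define P where "P = (\<lambda>n. of_nat (Suc n) powr (1 - s) :: complex)"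
  have "P \<longlonglongrightarrow> 0"
  proof (rule tendsto_norm_zero_cancel)
    have "(\<lambda>n. real (Suc n) powr (1 - Re s)) \<longlonglongrightarrow> 0"
      using s by (intro tendsto_neg_powr filterlim_compose[OF filterlim_real_sequentially filterlim_Suc]) auto
    then show "(\<lambda>n. norm (P n)) \<longlonglongrightarrow> 0" by (simp add: P_def norm_Suc_powr del: of_nat_Suc)
  qed
  from telescope_sums[OF this] have tel: "(\<lambda>n. P (Suc n) - P n) sums (-1)"
    by (simp add: P_def)
  have "(\<lambda>n. \<Sum>i\<le>K. ((1 - s) gchoose Suc i) * (1 / of_nat (Suc n) powr (s + of_nat i)))
          sums (\<Sum>i\<le>K. ((1 - s) gchoose Suc i) * D (s + of_nat i))"
    using s by (intro sums_sum sums_mult D) auto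
  from sums_diff[OF tel this] have
    "(\<lambda>n. P (Suc n) - P n - (\<Sum>i\<le>K. ((1 - s) gchoose Suc i) * (1 / of_nat (Suc n) powr (s + of_nat i))))
       sums (-1 - (\<Sum>i\<le>K. ((1 - s) gchoose Suc i) * D (s + of_nat i)))" .
  moreover have "P (Suc n) - P n - (\<Sum>i\<le>K. ((1 - s) gchoose Suc i) * (1 / of_nat (Suc n) powr (s + of_nat i)))
     = of_nat (Suc n) powr (1 - s) *
             ((1 + of_real (1 / real (Suc n))) powr (1 - s) -
               (\<Sum>j\<le>Suc K. ((1 - s) gchoose j) * of_real (1 / real (Suc n)) ^ j))" for n
  proof -
    let ?N = "of_nat (Suc n) :: complex"
    have N0: "?N \<noteq> 0" by (simp del: of_nat_Suc)
    have 1: "P n * (1 + of_real (1 / real (Suc n))) powr (1 - s) = P (Suc n)"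
    proof -
      have "?N * (1 + of_real (1 / real (Suc n))) = of_nat (Suc (Suc n))"
        using N0 by (simp add: field_simps)
      moreover have "(of_real (real (Suc n)) * of_real (1 + 1 / real (Suc n))) powr (1 - s)
          = of_real (real (Suc n)) powr (1 - s) * of_real (1 + 1 / real (Suc n)) powr (1 - s)"
        by (rule powr_times_real) auto
      ultimately show ?thesis by (simp add: P_def del: of_nat_Suc)
    qed
    have 2: "P n * of_real (1 / real (Suc n)) ^ Suc i = 1 / ?N powr (s + of_nat i)" for i
    proof -
      have "P n = ?N powr (of_nat (Suc i) - (s + of_nat i))" by (simp add: P_def)
      also have "\<dots> = ?N ^ Suc i / ?N powr (s + of_nat i)"
        using N0 by (subst powr_diff) (simp only: powr_nat' if_False simp_thms not_False_eq_True; simp add: powr_nat')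
      finally show ?thesis using N0 by (simp add: power_one_over field_simps del: of_nat_Suc power_Suc)
    qed
    have "(\<Sum>j\<le>Suc K. P n * (((1 - s) gchoose j) * of_real (1 / real (Suc n)) ^ j)) =
        P n + (\<Sum>i\<le>K. ((1 - s) gchoose Suc i) * (P n * of_real (1 / real (Suc n)) ^ Suc i))"
      by (subst sum.atMost_Suc_shift) (simp add: mult_ac)
    then have "P n * ((1 + of_real (1 / real (Suc n))) powr (1 - s) -
               (\<Sum>j\<le>Suc K. ((1 - s) gchoose j) * of_real (1 / real (Suc n)) ^ j)) =
       P (Suc n) - (P n + (\<Sum>i\<le>K. ((1 - s) gchoose Suc i) * (1 / of_nat (Suc n) powr (s + of_nat i))))"
      by (simp only: right_diff_distrib sum_distrib_left 1 2)
    then show ?thesis by (simp only: P_def diff_diff_eq)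
  qed
  ultimately have "Hs = -1 - (\<Sum>i\<le>K. ((1 - s) gchoose Suc i) * D (s + of_nat i))"
    using H sums_unique2 by (simp del: of_nat_Suc)
  also have "(\<Sum>i\<le>K. ((1 - s) gchoose Suc i) * D (s + of_nat i)) =
     - (\<Sum>i\<le>K. ((1 - s) gchoose i) / of_nat (Suc i) * ((s + of_nat i - 1) * D (s + of_nat i)))"
    unfolding sum_negf[symmetric]
  proof (intro sum.cong refl)
    fix i
    have "((1 - s) gchoose Suc i) = ((1 - s) gchoose i) / of_nat (Suc i) * (1 - s - of_nat i)"
      by (simp add: gbinomial_prod_rev field_simps)
    moreover have "1 - s - of_nat i = - (s + of_nat i - 1)" by simp
    ultimately show "((1 - s) gchoose Suc i) * D (s + of_nat i) =
      - (((1 - s) gchoose i) / of_nat (Suc i) * ((s + of_nat i - 1) * D (s + of_nat i)))"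
      by (simp only: mult.assoc mult_minus_left mult_minus_right)
  qed
  also have "(\<Sum>i\<le>K. ((1 - s) gchoose i) / of_nat (Suc i) * ((s + of_nat i - 1) * D (s + of_nat i))) =
     (s - 1) * D s + (\<Sum>i=1..K. ((1 - s) gchoose i) / of_nat (Suc i) * ((s + of_nat i - 1) * D (s + of_nat i)))"
    by (simp add: atMost_atLeast0 sum.atLeast_Suc_atMost)
  finally show ?thesis by (simp add: algebra_simps del: of_nat_Suc)
qed

lemma zeta_continuation_half_plane:
  fixes D :: "complex \<Rightarrow> complex"
  assumes hol: "D holomorphic_on {s. Re s > 1}"
  assumes D: "\<And>s. Re s > 1 \<Longrightarrow> (\<lambda>n. 1 / of_nat (Suc n) powr s) sums D s"
  shows "\<exists>G. G holomorphic_on {s. Re s > 1 - real k} \<and> (\<forall>s. Re s > 1 \<longrightarrow> G s = (s - 1) * D s)"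
proof (induction k)
  case 0
  show ?case using hol by (intro exI[of _ "\<lambda>s. (s - 1) * D s"]) (auto intro!: holomorphic_intros)
next
  case (Suc k)
  then obtain G where G: "G holomorphic_on {s. Re s > 1 - real k}" "\<And>s. Re s > 1 \<Longrightarrow> G s = (s - 1) * D s"
    by blast
  obtain H where H: "H holomorphic_on {s. Re s > - real k}"
    "\<And>s. Re s > - real k \<Longrightarrow> (\<lambda>n. of_nat (Suc n) powr (1 - s) *
             ((1 + of_real (1 / real (Suc n))) powr (1 - s) -
               (\<Sum>j\<le>Suc k. ((1 - s) gchoose j) * of_real (1 / real (Suc n)) ^ j))) sums H s"
    using binomial_series_holomorphic[of k] by blast
  define F where "F = (\<lambda>s. 1 + H s - (\<Sum>i=1..k. ((1 - s) gchoose i) / of_nat (Suc i) * G (s + of_nat i)))"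
  have "(\<lambda>s. G (s + of_nat i)) holomorphic_on {s. Re s > - real k}" if "i \<in> {1..k}" for i
    using that by (intro holomorphic_on_compose_gen[OF _ G(1), unfolded o_def] holomorphic_intros) auto
  then have "F holomorphic_on {s. Re s > - real k}"
    unfolding F_def gbinomial_prod_rev
    by (intro holomorphic_intros H(1)) (auto simp del: of_nat_Suc)
  moreover have "F s = (s - 1) * D s" if s: "Re s > 1" for s
  proof -
    have "(s - 1) * D s = 1 + H s - (\<Sum>i=1..k. ((1 - s) gchoose i) / of_nat (Suc i) * ((s + of_nat i - 1) * D (s + of_nat i)))"
      using s by (intro zeta_shift_identity D H(2)) auto
    also have "\<dots> = F s" unfolding F_def using s by (simp add: G(2) del: of_nat_Suc)
    finally show ?thesis by simp
  qed
  ultimately show ?case by (intro exI[of _ F]) auto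
qed

lemma zeta_continuation_exists: "\<exists>f. zeta_continuation f"
proof -
  obtain D where D: "D holomorphic_on {s. Re s > 1}"
    "\<And>s. Re s > 1 \<Longrightarrow> (\<lambda>n. 1 / of_nat (Suc n) powr s) sums D s"
    using dirichlet_series_holomorphic by blast
  obtain G where G: "\<And>k::nat. G k holomorphic_on {s. Re s > 1 - real k}"
    "\<And>k s. Re s > 1 \<Longrightarrow> G k s = (s - 1) * D s"
    using zeta_continuation_half_plane[OF D] by metis
  have G_eq: "G k s = G l s" if "Re s > 1 - real k" "k \<le> l" for k l s
  proof (rule analytic_continuation_open[of "{s. Re s > 1}" "{s. Re s > 1 - real k}" "G k" "G l"])
    show "{s. Re s > 1} \<noteq> {}" by (auto intro: exI[of _ 2])
    show "connected {s. Re s > 1 - real k}"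
      by (intro convex_connected convex_halfspace_Re_gt)
    show "G l holomorphic_on {s. Re s > 1 - real k}"
      using that by (intro holomorphic_on_subset[OF G(1)]) auto
  qed (use G that in \<open>auto intro: open_Re_gt\<close>)
  define g where "g = (\<lambda>s. G (nat \<lceil>1 - Re s\<rceil> + 1) s)"
  have g_eq: "g s = G k s" if "Re s > 1 - real k" for k s
  proof -
    have "Re s > 1 - real (nat \<lceil>1 - Re s\<rceil> + 1)" by linarith
    then show ?thesis using that G_eq unfolding g_def by (metis nle_le)
  qed
  have "g holomorphic_on UNIV"
  proof -
    have "g field_differentiable at s" for s
    proof -
      obtain k :: nat where k: "1 - Re s < real k" using reals_Archimedean2 by blast
      have "g holomorphic_on {s. Re s > 1 - real k}"
        using G(1)[of k] by (rule holomorphic_transform) (auto simp: g_eq)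
      then show ?thesis
        using k by (intro holomorphic_on_imp_differentiable_at[OF _ open_Re_gt]) auto
    qed
    then show ?thesis by (simp add: holomorphic_on_def)
  qed
  define f where "f = (\<lambda>s. if s = 1 then 0 else g s / (s - 1))"
  have "(\<lambda>s. g s / (s - 1)) holomorphic_on (- {1})"
    using \<open>g holomorphic_on UNIV\<close> by (intro holomorphic_intros) (auto intro: holomorphic_on_subset)
  then have "f holomorphic_on (- {1})"
    by (rule holomorphic_transform) (auto simp: f_def)
  moreover have "f s = D s" if "Re s > 1" for s
  proof -
    have "g s = (s - 1) * D s" using that g_eq[of 0 s] by (simp add: G(2))
    then show ?thesis using that by (auto simp: f_def)
  qed
  moreover have "f 1 = 0" by (simp add: f_def)
  ultimately show ?thesis using D(2) unfolding zeta_continuation_def by metis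
qed

lemma zeta_continuation_unique:
  assumes "zeta_continuation f" "zeta_continuation g"
  shows "f = g"
proof
  fix s
  show "f s = g s"
  proof (cases "s = 1")
    case False
    show ?thesis
    proof (rule analytic_continuation_open[of "{s. Re s > 1}" "- {1}" f g])
      show "{s. Re s > 1} \<noteq> {}" by (auto intro: exI[of _ 2])
      show "connected (- {1 :: complex})" by (intro connected_punctured_universe) auto
      show "f z = g z" if "z \<in> {s. Re s > 1}" for z
        using assms that sums_unique2 unfolding zeta_continuation_def by blast
    qed (use assms False in \<open>auto simp: zeta_continuation_def intro: open_Re_gt\<close>)
  qed (use assms in \<open>auto simp: zeta_continuation_def\<close>)
qed

lemma zeta_continuation_zeta: "zeta_continuation zeta"
  unfolding zeta_def using zeta_continuation_exists zeta_continuation_unique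
  by (metis the_equality)

lemma zeta_holomorphic: "zeta holomorphic_on (- {1})"
  and zeta_sums: "Re s > 1 \<Longrightarrow> (\<lambda>n. 1 / of_nat (Suc n) powr s) sums zeta s"
  using zeta_continuation_zeta unfolding zeta_continuation_def by auto

definition C1 :: "real \<Rightarrow> real" where
  "C1 \<beta> = ln (1 - \<beta>) - ln (ln 4) - euler_mascheroni
            - (\<Sum>\<^sub>\<infinity>k\<in>{2::nat..}. \<Sum>\<^sub>\<infinity>p\<in>{p::nat. prime p}. ln (real p) / real p ^ k) - 1"

end

theory Submission
  imports Defs "HOL-Number_Theory.Number_Theory" "HOL-Real_Asymp.Real_Asymp"
begin

text \<open>
  Resonance method. With \<open>r p = 1 - p/N\<close> the resonator
  \<open>K t = \<Prod>p\<le>N. \<bar>1 - r p * p powr (\<i> t)\<bar> powr - 2\<close> is a cosine series with nonnegative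
  coefficients, and so is \<open>K t * (cos (t ln n) - (1 - n/N))\<close> for prime powers \<open>n \<le> N\<close>. Integrating
  against the triangle \<open>1 - \<bar>t\<bar>/T\<close>, whose Fourier transform is nonnegative, shows that the
  \<open>K\<close>-weighted mean of \<open>- Re (\<zeta>'/\<zeta>) (1 + \<delta> + \<i> t)\<close> over \<open>[-T, T]\<close> is at least
  \<open>\<Sum>n\<le>N. \<Lambda> n * n powr (- 1 - \<delta>) * (1 - n/N)\<close>. The range \<open>\<bar>t\<bar> \<le> T powr \<beta>\<close> is negligible
  because \<open>K 0 / mean K \<le> \<Prod>p\<le>N. (2 * N - p) / p\<close>, which is \<open>4 powr (N / ln N)\<close> up to lower order
  terms in the exponent. This fixes \<open>N\<close> as a constant times \<open>ln T * ln (ln T)\<close>.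

  The passage from abscissa \<open>1 + \<delta>\<close> to \<open>1\<close> is a maximum principle on a rectangle and needs no
  zero-free region. The sum over proper prime powers in \<open>C1\<close> is slack (about 0.75) that the
  resonator does not lose, and it is large enough for Chebyshev's bound \<open>\<psi> x \<le> 1.11 x + O(1)\<close> to
  replace the prime number theorem.
\<close>

section \<open>The logarithmic derivative of zeta on the line of real part 1\<close>

text \<open>The triangle weight makes every off-diagonal term of the weighted mean nonnegative, so
  these terms are discarded whatever their size. The resonator can therefore be a full infinite
  cosine series, with no truncation tied to \<open>T\<close>. Balance behind the weights: a factor
  of the resonator has maximum \<open>1/(1-r)^2\<close> and constant coefficient
  \<open>1/(1-r^2)\<close>, with ratio \<open>(1+r)/(1-r) = (2*N-p)/p\<close>, and the integral of
  \<open>ln ((2-x)/x)\<close> over [0,1] is \<open>ln 4\<close>. The product of these ratios has to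
  stay below \<open>T powr (1-\<beta>)\<close>, so with the prime number theorem \<open>N\<close>
  would be about \<open>(1-\<beta>) * ln T * ln (ln T) / ln 4\<close>; then \<open>ln N\<close>
  supplies \<open>ln (ln T) + ln (ln (ln T)) + ln (1-\<beta>) - ln (ln 4)\<close>. The remaining
  \<open>- euler_mascheroni - 1\<close> would be the limit of the sum of
  \<open>mangoldt n / n\<close> minus \<open>psi N / N\<close>, after removal of
  \<open>ln N\<close>. The elementary bounds give \<open>-1 - 1.11\<close> instead, and a shorter
  \<open>N\<close> loses a further \<open>ln 1.12\<close>; the prime power sum pays for
  both.\<close>

lemma minus_deriv_zeta_sums:
  assumes "Re s > 1"
  shows "(\<lambda>n. of_real (ln (real n)) / of_nat n powr s) sums (- deriv zeta s)"
proof -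
  let ?S = "{s :: complex. Re s > 1}"
  let ?h = "\<lambda>n s. 1 / of_nat (Suc n) powr s :: complex"
  have "\<exists>d M. 0 < d \<and> summable M \<and>
          (\<forall>\<^sub>F n in sequentially. \<forall>y\<in>ball x d \<inter> ?S. norm (?h n y) \<le> M n)" if x: "x \<in> ?S" for x
  proof -
    define d where "d = (Re x - 1) / 2"
    have "norm (?h n y) \<le> real (Suc n) powr (- (Re x - d))" if "y \<in> ball x d" for n y
    proof -
      have "Re y \<ge> Re x - d" using that abs_Re_le_cmod[of "x - y"] by (auto simp: dist_norm)
      then have "real (Suc n) powr (- Re y) \<le> real (Suc n) powr (- (Re x - d))"
        by (intro powr_mono) auto
      then show ?thesis by (simp add: norm_divide norm_Suc_powr powr_minus_divide del: of_nat_Suc)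
    qed
    moreover have "summable (\<lambda>n. real (Suc n) powr (- (Re x - d)))"
      using x by (intro summable_Suc_powr) (auto simp: d_def field_simps)
    moreover have "d > 0" using x by (auto simp: d_def)
    ultimately show ?thesis by (intro exI[of _ d] exI) (auto intro!: always_eventually)
  qed
  moreover have "(?h n has_field_derivative - (of_real (ln (real (Suc n))) / of_nat (Suc n) powr x)) (at x)"
    for n x
    using Ln_of_nat[of "Suc n"]
    by (auto intro!: derivative_eq_intros simp: field_simps simp del: of_nat_Suc)
  ultimately obtain g g' where g: "\<forall>x \<in> ?S. (\<lambda>n. ?h n x) sums g x \<and>
      (\<lambda>n. - (of_real (ln (real (Suc n))) / of_nat (Suc n) powr x)) sums g' x \<and> (g has_field_derivative g' x) (at x)"
    using series_and_derivative_comparison_local[OF open_Re_gt, of 1 ?h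
       "\<lambda>n x. - (of_real (ln (real (Suc n))) / of_nat (Suc n) powr x)"] by blast
  have "g x = zeta x" if "x \<in> ?S" for x
    using g zeta_sums[of x] that sums_unique2 by blast
  have "(g has_field_derivative g' s) (at s)" using g assms by blast
  then have "(zeta has_field_derivative g' s) (at s)"
    by (rule has_field_derivative_transform_within_open[OF _ open_Re_gt[of 1]])
      (use assms \<open>\<And>x. x \<in> ?S \<Longrightarrow> g x = zeta x\<close> in auto)
  then have "g' s = deriv zeta s" by (simp add: DERIV_imp_deriv)
  moreover have "(\<lambda>n. - (of_real (ln (real (Suc n))) / of_nat (Suc n) powr s)) sums g' s"
    using g assms by blast
  ultimately have "(\<lambda>n. - (of_real (ln (real (Suc n))) / of_nat (Suc n) powr s)) sums deriv zeta s" by simp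
  from sums_minus[OF this]
  have "(\<lambda>n. of_real (ln (real (Suc n))) / of_nat (Suc n) powr s) sums (- deriv zeta s)"
    by (simp del: of_nat_Suc)
  \<comment> \<open>Re-indexing from \<open>Suc n\<close> to \<open>n\<close> adds the term at 0,
    which vanishes because \<open>ln 0 = 0\<close>.\<close>
  then show ?thesis
    by (subst (asm) sums_Suc_iff[of "\<lambda>n. of_real (ln (real n)) / of_nat n powr s"]) simp
qed

lemma norm_of_nat_powr: "norm (of_nat n powr s :: complex) = real n powr Re s"
proof (cases n)
  case (Suc m)
  then show ?thesis by (simp only: norm_Suc_powr)
qed simp

lemma summable_ln_div_powr:
  assumes "x > 1" shows "summable (\<lambda>n. ln (real n) / real n powr x)"
proof -
  have "(\<lambda>n. Re (of_real (ln (real n)) / of_nat n powr of_real x)) sums Re (- deriv zeta (of_real x))"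
    by (intro sums_Re minus_deriv_zeta_sums) (use assms in auto)
  moreover have "of_nat n powr of_real x = complex_of_real (real n powr x)" for n
    by (metis of_nat_0_le_iff of_real_of_nat_eq powr_of_real)
  ultimately show ?thesis by (simp add: sums_iff)
qed

lemma summable_mangoldt_div_powr:
  assumes "x > 1" shows "summable (\<lambda>n. mangoldt n / real n powr x)"
proof (rule summable_comparison_test[OF _ summable_ln_div_powr[OF assms]], intro exI allI impI)
  fix n :: nat
  show "norm (mangoldt n / real n powr x) \<le> ln (real n) / real n powr x"
    using mangoldt_le[of n] mangoldt_nonneg[of n]
    by (cases "n = 0") (auto intro!: divide_right_mono)
qed

text \<open>Summing \<open>mangoldt d\<close> over the divisors of \<open>n\<close> gives
  \<open>ln n\<close>, so regrouping the absolutely convergent double series by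
  \<open>n = d * m\<close> yields the series of \<open>- deriv zeta s\<close>. It is stated as a
  product, not a quotient, because the nonvanishing of zeta in this half-plane is itself deduced
  from it.\<close>

lemma mangoldt_dirichlet_convolution:
  assumes s: "Re s > 1"
  shows "- deriv zeta s = zeta s * (\<Sum>n. mangoldt n / of_nat n powr s)"
proof -
  define a where "a = (\<lambda>n. mangoldt n / of_nat n powr s :: complex)"
  define b where "b = (\<lambda>n. 1 / of_nat n powr s :: complex)"
  have na: "summable (\<lambda>n. norm (a n))"
    using summable_mangoldt_div_powr[OF s] by (simp add: a_def norm_divide norm_of_nat_powr)
  have nb: "summable (\<lambda>n. norm (b n))"
    using s summable_real_powr_iff[of "- Re s"]
    by (simp add: b_def norm_divide norm_of_nat_powr powr_minus_divide)
  have "b sums zeta s"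
    using zeta_sums[OF s] unfolding b_def
    by (subst (asm) sums_Suc_iff[of "\<lambda>n. 1 / of_nat n powr s"]) simp
  then have b: "(b has_sum zeta s) UNIV" by (rule norm_summable_imp_has_sum[OF nb])
  have a: "(a has_sum suminf a) UNIV"
    by (rule norm_summable_imp_has_sum[OF na summable_sums[OF summable_norm_cancel[OF na]]])
  let ?f = "\<lambda>(d,m). a d * b m"
  have "(\<lambda>p. norm (?f p)) summable_on UNIV \<times> UNIV"
  proof (rule summable_on_SigmaI)
    fix d :: nat
    show "((\<lambda>m. norm (?f (d, m))) has_sum (norm (a d) * (\<Sum>m. norm (b m)))) UNIV"
      using nb by (auto simp: norm_mult intro!: has_sum_cmult_right norm_summable_imp_has_sum summable_sums)
    show "(\<lambda>d. norm (a d) * (\<Sum>m. norm (b m))) summable_on UNIV"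
      using na by (intro summable_on_cmult_left norm_summable_imp_summable_on) simp
  qed auto
  then have "?f summable_on UNIV \<times> UNIV" by (rule abs_summable_summable)
  then obtain S where S: "(?f has_sum S) (UNIV \<times> UNIV)" by (auto simp: summable_on_def)
  have "((\<lambda>d. a d * zeta s) has_sum S) UNIV"
    by (rule has_sum_SigmaD[OF S]) (auto intro!: has_sum_cmult_right b)
  moreover have "((\<lambda>d. a d * zeta s) has_sum (suminf a * zeta s)) UNIV"
    by (intro has_sum_cmult_left a)
  ultimately have S_eq: "S = suminf a * zeta s" by (rule has_sum_unique)
  have "(?f has_sum S) ({0<..} \<times> {0<..})"
    using S by (subst has_sum_cong_neutral[where T = "UNIV \<times> UNIV" and g = ?f]) (auto simp: a_def b_def)
  also have "(?f has_sum S) ({0<..} \<times> {0<..}) \<longleftrightarrow>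
      ((\<lambda>(n,d). mangoldt d / of_nat n powr s) has_sum S) (SIGMA n:{0<..}. {d. d dvd n})"
  proof (rule has_sum_reindex_bij_witness[of _ "\<lambda>(n,d). (d, n div d)" "\<lambda>(d,m). (d * m, d)"])
    fix p :: "nat \<times> nat" assume "p \<in> {0<..} \<times> {0<..}"
    then obtain d m where p: "p = (d, m)" "d > 0" "m > 0" by auto
    have "of_nat (d * m) powr s = (of_nat d powr s * of_nat m powr s :: complex)"
      using powr_times_real[of "of_nat d" "of_nat m" s] by simp
    then show "(\<lambda>(n,d). mangoldt d / of_nat n powr s) ((\<lambda>(d,m). (d * m, d)) p) = ?f p"
      using p by (simp add: a_def b_def)
  qed (auto elim!: dvdE)
  finally have T: "((\<lambda>(n,d). mangoldt d / of_nat n powr s) has_sum S) (SIGMA n:{0<..}. {d. d dvd n})" .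
  have "((\<lambda>n. of_real (ln (real n)) / of_nat n powr s) has_sum S) {0<..}"
  proof (rule has_sum_SigmaD[OF T])
    fix n :: nat assume "n \<in> {0<..}"
    then have "of_real (ln (real n)) / of_nat n powr s = (\<Sum>d | d dvd n. mangoldt d / of_nat n powr s)"
      by (simp add: mangoldt_sum[symmetric] sum_divide_distrib)
    then show "((\<lambda>d. case (n, d) of (n, d) \<Rightarrow> mangoldt d / of_nat n powr s) has_sum
            of_real (ln (real n)) / of_nat n powr s) {d. d dvd n}"
      using \<open>n \<in> {0<..}\<close> by (auto intro!: has_sum_finiteI)
  qed
  then have "((\<lambda>n. of_real (ln (real n)) / of_nat n powr s) has_sum S) UNIV"
    by (subst has_sum_cong_neutral[where T = "{0<..}"]) auto
  then have "(\<lambda>n. of_real (ln (real n)) / of_nat n powr s) sums S" by (rule has_sum_imp_sums)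
  then have "- deriv zeta s = S" using minus_deriv_zeta_sums[OF s] sums_unique2 by blast
  with S_eq show ?thesis by (simp add: a_def mult.commute)
qed

text \<open>Integral test in telescoped form: each term \<open>n powr (- 1 - x)\<close> dominates
  \<open>(n powr (- x) - (n + 1) powr (- x)) / x\<close>. This makes the pole at 1 visible; it shows
  that zeta is not constant and that its residue does not vanish.\<close>

lemma Re_zeta_ge:
  assumes "x > 0"
  shows "Re (zeta (1 + of_real x)) \<ge> 1 / x"
proof (rule sums_le)
  have "(\<lambda>n. Re (1 / of_nat (Suc n) powr (1 + of_real x))) sums Re (zeta (1 + of_real x))"
    using assms by (intro sums_Re zeta_sums) auto
  moreover have "of_nat (Suc n) powr (1 + of_real x) = complex_of_real (real (Suc n) powr (1 + x))" for n
    using powr_of_real[of "real (Suc n)" "1 + x"] by simp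
  ultimately show "(\<lambda>n. real (Suc n) powr (- 1 - x)) sums Re (zeta (1 + of_real x))"
    by (simp add: powr_minus_divide[symmetric] del: of_nat_Suc)
next
  have "(\<lambda>n. real (Suc n) powr (- x)) \<longlonglongrightarrow> 0"
    using assms by (intro tendsto_neg_powr filterlim_compose[OF filterlim_real_sequentially filterlim_Suc]) auto
  from telescope_sums'[OF this]
  have "(\<lambda>n. real (Suc n) powr (- x) - real (Suc (Suc n)) powr (- x)) sums 1" by simp
  from sums_divide[OF this, of x]
  show "(\<lambda>n. (real (Suc n) powr (- x) - real (Suc (Suc n)) powr (- x)) / x) sums (1 / x)" .
next
  fix n
  define a where "a = real (Suc n)"
  have a: "a > 0" by (simp add: a_def)
  have "a + 1 = a * (1 + 1 / a)" using a by (simp add: field_simps)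
  then have "(a + 1) powr (- x) = a powr (- x) * (1 + 1 / a) powr (- x)"
    using a by (simp add: powr_mult)
  moreover have "(1 + 1 / a) powr (- x) \<ge> 1 - x * (1 / a)"
  proof -
    have "1 - x * (1 / a) \<le> 1 - x * ln (1 + 1 / a)"
      using assms a by (intro diff_left_mono mult_left_mono ln_add_one_self_le_self) auto
    also have "\<dots> \<le> exp (- x * ln (1 + 1 / a))"
      using exp_ge_add_one_self[of "- x * ln (1 + 1 / a)"] by simp
    also have "\<dots> = (1 + 1 / a) powr (- x)"
      using add_pos_pos[of 1 "1 / a"] a by (simp add: powr_def)
    finally show ?thesis .
  qed
  ultimately have "(a + 1) powr (- x) \<ge> a powr (- x) * (1 - x * (1 / a))"
    by (simp add: mult_left_mono)
  moreover have "a powr (- 1 - x) = a powr (- x) / a" using a by (simp add: powr_diff powr_minus field_simps)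
  ultimately have "a powr (- x) - (a + 1) powr (- x) \<le> x * a powr (- 1 - x)"
    by (simp add: algebra_simps)
  then show "(real (Suc n) powr (- x) - real (Suc (Suc n)) powr (- x)) / x \<le> real (Suc n) powr (- 1 - x)"
    using assms by (simp add: a_def field_simps)
qed

section \<open>Orders of zeros, nonvanishing, and bounds for the logarithmic derivative\<close>

lemma holomorphic_on_open_isCont:
  "f holomorphic_on S \<Longrightarrow> open S \<Longrightarrow> s \<in> S \<Longrightarrow> isCont f s"
  by (simp add: field_differentiable_imp_continuous_at holomorphic_on_imp_differentiable_at)

text \<open>The number \<open>m\<close> is the order of vanishing at \<open>s\<close>: with
  \<open>f w = (w - s) ^ m * g w\<close> and \<open>g s \<noteq> 0\<close>, the logarithmic
  derivative has residue \<open>m\<close>. Only the approach from the right is recorded, since that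
  is where the Dirichlet series gives information.\<close>

lemma log_deriv_order:
  assumes holf: "f holomorphic_on S" and S: "open S" "connected S" "s \<in> S" "\<not> f constant_on S"
  obtains m :: nat where
    "((\<lambda>x. of_real x * (deriv f (s + of_real x) / f (s + of_real x))) \<longlongrightarrow> of_nat m) (at_right 0)"
    "f s = 0 \<Longrightarrow> m > 0"
proof (cases "f s = 0")
  case False
  have "isCont f s" "isCont (deriv f) s"
    using holomorphic_on_open_isCont holf holomorphic_deriv[OF holf] S by blast+
  then have "((\<lambda>z. deriv f z / f z) \<longlongrightarrow> deriv f s / f s) (at s)"
    using False by (auto simp: isCont_def intro!: tendsto_intros)
  moreover have "filterlim (\<lambda>x. s + of_real x) (at s) (at_right 0)"
    by (auto simp: filterlim_at eventually_at_filter intro!: tendsto_eq_intros)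
  ultimately have "((\<lambda>x. deriv f (s + of_real x) / f (s + of_real x)) \<longlongrightarrow> deriv f s / f s) (at_right 0)"
    by (rule filterlim_compose)
  then have "((\<lambda>x. of_real x * (deriv f (s + of_real x) / f (s + of_real x))) \<longlongrightarrow> of_real 0 * (deriv f s / f s)) (at_right 0)"
    by (intro tendsto_mult tendsto_of_real tendsto_ident_at)
  then show ?thesis using that[of 0] False by simp
next
  case True
  obtain g r n where *: "0 < n" "0 < r" "ball s r \<subseteq> S" "g holomorphic_on ball s r"
    "\<And>w. w \<in> ball s r \<Longrightarrow> f w = (w - s) ^ n * g w" "\<And>w. w \<in> ball s r \<Longrightarrow> g w \<noteq> 0"
    by (rule holomorphic_factor_zero_nonconstant[OF holf S(1,2,3) True S(4)]) (rule that)
  have "(z - s) * (deriv f z / f z) = of_nat n + (z - s) * (deriv g z / g z)"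
    if z: "z \<in> ball s r" "z \<noteq> s" for z
  proof -
    have "(g has_field_derivative deriv g z) (at z)"
      using *(4) z holomorphic_derivI by blast
    then have "((\<lambda>w. (w - s) ^ n * g w) has_field_derivative
        (of_nat n * (z - s) ^ (n - 1) * g z + (z - s) ^ n * deriv g z)) (at z)"
      by (auto intro!: derivative_eq_intros simp: algebra_simps)
    then have "(f has_field_derivative (of_nat n * (z - s) ^ (n - 1) * g z + (z - s) ^ n * deriv g z)) (at z)"
      by (rule has_field_derivative_transform_within_open[of _ _ _ "ball s r"]) (use z *(5) in auto)
    then have "deriv f z = of_nat n * (z - s) ^ (n - 1) * g z + (z - s) ^ n * deriv g z"
      by (rule DERIV_imp_deriv)
    moreover have "(z - s) ^ n = (z - s) * (z - s) ^ (n - 1)"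
      using *(1) by (metis power_eq_if neq0_conv)
    moreover have "w * ((N * P * G + (w * P) * G') / ((w * P) * G)) = N + w * (G' / G)"
      if "w \<noteq> 0" "P \<noteq> 0" "G \<noteq> 0" for w N P G G' :: complex
      using that by (simp add: field_simps)
    ultimately show ?thesis using z *(5)[OF z(1)] *(6)[OF z(1)] by simp
  qed
  moreover have "((\<lambda>z. of_nat n + (z - s) * (deriv g z / g z)) \<longlongrightarrow> of_nat n + (s - s) * (deriv g s / g s)) (at s)"
  proof -
    have "isCont g s" "isCont (deriv g) s"
      using *(2) holomorphic_on_open_isCont[OF *(4)] holomorphic_on_open_isCont[OF holomorphic_deriv[OF *(4)]]
      by auto
    then show ?thesis
      using *(2) *(6)[of s] by (intro tendsto_intros) (auto simp: isCont_def)
  qed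
  ultimately have "((\<lambda>z. (z - s) * (deriv f z / f z)) \<longlongrightarrow> of_nat n) (at s)"
    by (subst tendsto_cong[of _ "\<lambda>z. of_nat n + (z - s) * (deriv g z / g z)"])
       (use *(2) in \<open>auto simp: eventually_at dist_commute intro!: exI[of _ r]\<close>)
  moreover have "filterlim (\<lambda>x. s + of_real x) (at s) (at_right 0)"
    by (auto simp: filterlim_at eventually_at_filter intro!: tendsto_eq_intros)
  ultimately have "((\<lambda>x. (s + of_real x - s) * (deriv f (s + of_real x) / f (s + of_real x))) \<longlongrightarrow> of_nat n) (at_right 0)"
    by (rule filterlim_compose)
  then show ?thesis using that[of n] *(1) by simp
qed

lemma zeta_not_constant: "\<not> zeta constant_on - {1}"
proof
  assume "zeta constant_on - {1}"
  then obtain c where c: "\<And>s. s \<noteq> 1 \<Longrightarrow> zeta s = c" by (auto simp: constant_on_def)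
  define x where "x = 1 / (\<bar>Re c\<bar> + 1)"
  have "x > 0" by (simp add: x_def add_nonneg_pos)
  moreover from this have "zeta (1 + of_real x) = c" by (intro c) auto
  ultimately have "Re c \<ge> 1 / x" using Re_zeta_ge[of x] by simp
  then show False by (simp add: x_def)
qed

lemma zeta_log_deriv_order:
  assumes "s \<noteq> 1"
  obtains m :: nat where
    "((\<lambda>x. of_real x * (deriv zeta (s + of_real x) / zeta (s + of_real x))) \<longlongrightarrow> of_nat m) (at_right 0)"
    "zeta s = 0 \<Longrightarrow> m > 0"
proof (rule log_deriv_order[OF zeta_holomorphic])
  show "connected (- {1 :: complex})" by (intro connected_punctured_universe) auto
qed (use assms zeta_not_constant in auto)

lemma mangoldt_dirichlet_summable:
  "Re s > 1 \<Longrightarrow> summable (\<lambda>n. norm (mangoldt n / of_nat n powr s :: complex))"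
  using summable_mangoldt_div_powr[of "Re s"] by (simp add: norm_divide norm_of_nat_powr)

text \<open>No Euler product is involved. A zero of order \<open>m > 0\<close> would make
  \<open>x * (deriv zeta / zeta)\<close> tend to \<open>m\<close>, whereas the convolution identity
  bounds the quotient by a constant \<open>M\<close> to the right of \<open>s\<close>, so that the
  limit is 0.\<close>

lemma zeta_nonzero_Re_gt_1:
  assumes s: "Re s > 1" shows "zeta s \<noteq> 0"
proof
  assume zero: "zeta s = 0"
  have "s \<noteq> 1" using s by auto
  then obtain m :: nat where m: "m > 0"
    "((\<lambda>x. of_real x * (deriv zeta (s + of_real x) / zeta (s + of_real x))) \<longlongrightarrow> of_nat m) (at_right 0)"
    using zeta_log_deriv_order[of s] zero by blast
  define M where "M = (\<Sum>n. mangoldt n / real n powr Re s)"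
  have M: "M \<ge> 0" unfolding M_def
    by (intro suminf_nonneg summable_mangoldt_div_powr s) (simp add: mangoldt_nonneg)
  have "((\<lambda>x. of_real x * (deriv zeta (s + of_real x) / zeta (s + of_real x))) \<longlongrightarrow> 0) (at_right 0)"
  proof (rule Lim_null_comparison)
    show "((\<lambda>x :: real. x * M) \<longlongrightarrow> 0) (at_right 0)" by (auto intro!: tendsto_eq_intros)
    show "\<forall>\<^sub>F x in at_right 0. norm (of_real x * (deriv zeta (s + of_real x) / zeta (s + of_real x))) \<le> x * M"
      unfolding eventually_at_right_field
    proof (intro exI[of _ 1] conjI allI impI)
      fix x :: real assume x: "0 < x" "x < 1"
      define z where "z = s + of_real x"
      have z: "Re z > Re s" using x by (simp add: z_def)
      have "norm (\<Sum>n. mangoldt n / of_nat n powr z :: complex) \<le> (\<Sum>n. norm (mangoldt n / of_nat n powr z :: complex))"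
        using z s by (intro summable_norm mangoldt_dirichlet_summable) auto
      also have "\<dots> \<le> M" unfolding M_def
      proof (rule suminf_le)
        show "norm (mangoldt n / of_nat n powr z :: complex) \<le> mangoldt n / real n powr Re s" for n
          using z by (cases "n = 0")
            (auto simp: norm_divide norm_of_nat_powr mangoldt_nonneg intro!: divide_left_mono powr_mono)
      qed (use z s mangoldt_dirichlet_summable summable_mangoldt_div_powr in auto)
      finally have "norm (\<Sum>n. mangoldt n / of_nat n powr z :: complex) \<le> M" .
      moreover have "zeta z \<noteq> 0 \<Longrightarrow> deriv zeta z / zeta z = - (\<Sum>n. mangoldt n / of_nat n powr z)"
        using mangoldt_dirichlet_convolution[of z] z s by (simp add: field_simps) (metis minus_minus)
      \<comment> \<open>Should \<open>zeta z\<close> vanish, the quotient is 0 by the convention for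
        division, so no separate exclusion of zeros near \<open>s\<close> is required.\<close>
      ultimately have "norm (deriv zeta z / zeta z) \<le> M"
        using M by (cases "zeta z = 0") simp_all
      then show "norm (of_real x * (deriv zeta (s + of_real x) / zeta (s + of_real x))) \<le> x * M"
        using x unfolding norm_mult z_def[symmetric] by (simp add: mult_left_mono)
    qed simp
  qed
  with m(2) have "of_nat m = (0 :: complex)"
    by (rule tendsto_unique[rotated]) simp
  with m(1) show False by simp
qed

lemma neg_log_deriv_zeta_sums:
  assumes "Re s > 1"
  shows "(\<lambda>n. mangoldt n / of_nat n powr s) sums (- (deriv zeta s / zeta s))"
proof -
  have "- (deriv zeta s / zeta s) = (\<Sum>n. mangoldt n / of_nat n powr s)"
    using mangoldt_dirichlet_convolution[OF assms] zeta_nonzero_Re_gt_1[OF assms]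
    by (simp add: field_simps)
  then show ?thesis
    using mangoldt_dirichlet_summable[OF assms] by (simp add: summable_norm_cancel summable_sums)
qed

lemma Re_neg_log_deriv_zeta_sums:
  assumes "Re s > 1"
  shows "(\<lambda>n. mangoldt n / real n powr Re s * cos (Im s * ln (real n))) sums (- Re (deriv zeta s / zeta s))"
proof -
  have "Re (mangoldt n / of_nat n powr s) = mangoldt n / real n powr Re s * cos (Im s * ln (real n))" for n
  proof (cases "n = 0")
    case False
    then have "of_nat n powr s = exp (s * of_real (ln (real n)))"
      using Ln_of_nat[of n] by (simp add: powr_def)
    moreover have "real n powr Re s = exp (Re s * ln (real n))" using False by (simp add: powr_def)
    moreover have "mangoldt n / exp z = of_real (mangoldt n) * exp (- z)" for z :: complex
      by (simp add: exp_minus field_simps)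
    moreover have "mangoldt n / exp z = mangoldt n * exp (- z)" for z :: real
      by (simp add: exp_minus field_simps)
    ultimately show ?thesis by (simp add: Re_exp del: of_real_mangoldt)
  qed simp
  moreover have "(\<lambda>n. Re (mangoldt n / of_nat n powr s)) sums Re (- (deriv zeta s / zeta s))"
    by (intro sums_Re neg_log_deriv_zeta_sums assms)
  ultimately show ?thesis by simp
qed

text \<open>The function \<open>G s = (s - 1) * zeta s\<close> extends holomorphically past 1, and
  the lower bound for zeta keeps \<open>Re G \<ge> 1\<close> on the real ray from 1. Hence
  \<open>deriv G / G\<close> is bounded on [1,2], and it differs from
  \<open>deriv zeta / zeta\<close> only by the polar part \<open>1 / (s - 1)\<close>.\<close>

lemma log_deriv_zeta_pole:
  obtains K where "((\<lambda>x. of_real x * (deriv zeta (1 + of_real x) / zeta (1 + of_real x))) \<longlongrightarrow> -1) (at_right 0)"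
    "K > 0" "\<And>x. 0 < x \<Longrightarrow> x \<le> 1 \<Longrightarrow> norm (deriv zeta (1 + of_real x) / zeta (1 + of_real x)) \<le> K / x"
proof -
  have "zeta holomorphic_on {s. Re s > 1}"
    by (rule holomorphic_on_subset[OF zeta_holomorphic]) auto
  from zeta_continuation_half_plane[OF this zeta_sums, of 1]
  obtain G where holG: "G holomorphic_on {s. Re s > 0}" and G: "\<And>s. Re s > 1 \<Longrightarrow> G s = (s - 1) * zeta s"
    by auto
  have open0: "open {s :: complex. Re s > 0}" by (rule open_Re_gt)
  have ReG: "Re (G (1 + of_real x)) \<ge> 1" if "x > 0" for x
  proof -
    have "Re (G (1 + of_real x)) = x * Re (zeta (1 + of_real x))" using that by (simp add: G)
    also have "\<dots> \<ge> x * (1 / x)" using that Re_zeta_ge[of x] by (intro mult_left_mono) auto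
    finally show ?thesis using that by simp
  qed
  have contG: "isCont G s" "isCont (deriv G) s" if "Re s > 0" for s
    using that holomorphic_on_open_isCont[OF holG open0]
      holomorphic_on_open_isCont[OF holomorphic_deriv[OF holG open0] open0] by auto
  have lim1: "filterlim (\<lambda>x. 1 + of_real x) (nhds (1::complex)) (at_right 0)"
    by (auto intro!: tendsto_eq_intros)
  have "((\<lambda>x. Re (G (1 + of_real x))) \<longlongrightarrow> Re (G 1)) (at_right 0)"
    by (intro tendsto_Re isCont_tendsto_compose[OF contG(1)] lim1) auto
  then have "Re (G 1) \<ge> 1"
    by (rule tendsto_lowerbound) (auto simp: eventually_at_right_field ReG intro!: exI[of _ 1])
  then have G_nz: "G (1 + of_real x) \<noteq> 0" if "x \<ge> 0" for x
    using that ReG[of x] by (cases "x = 0") auto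
  define Q where "Q = (\<lambda>x. deriv G (1 + of_real x) / G (1 + of_real x))"
  have eq: "deriv zeta (1 + of_real x) / zeta (1 + of_real x) = Q x - 1 / of_real x" if x: "x > 0" for x
  proof -
    define s where "s = 1 + complex_of_real x"
    have s: "Re s > 1" "s \<noteq> 1" "s - 1 = of_real x" using x by (auto simp: s_def)
    have "(zeta has_field_derivative deriv zeta s) (at s)"
      using s by (intro holomorphic_derivI[OF zeta_holomorphic]) auto
    then have "((\<lambda>s. (s - 1) * zeta s) has_field_derivative (zeta s + (s - 1) * deriv zeta s)) (at s)"
      by (auto intro!: derivative_eq_intros)
    then have "(G has_field_derivative (zeta s + (s - 1) * deriv zeta s)) (at s)"
      by (rule has_field_derivative_transform_within_open[OF _ open_Re_gt[of 1]]) (use s in \<open>auto simp: G\<close>)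
    then have "deriv G s = zeta s + (s - 1) * deriv zeta s" by (rule DERIV_imp_deriv)
    then have "deriv G s / G s = 1 / (s - 1) + deriv zeta s / zeta s"
      using s zeta_nonzero_Re_gt_1[of s] by (simp add: G field_simps)
    then show ?thesis using s by (simp add: Q_def s_def)
  qed
  have Qlim: "(Q \<longlongrightarrow> Q 0) (at_right 0)"
    unfolding Q_def using G_nz[of 0]
    by (auto intro!: tendsto_divide isCont_tendsto_compose[OF contG(1)] isCont_tendsto_compose[OF contG(2)] lim1)
  have "((\<lambda>x. of_real x * Q x - 1) \<longlongrightarrow> of_real 0 * Q 0 - 1) (at_right 0)"
    by (intro tendsto_diff tendsto_mult tendsto_of_real tendsto_ident_at Qlim tendsto_const)
  then have "((\<lambda>x. of_real x * Q x - 1) \<longlongrightarrow> -1) (at_right 0)" by simp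
  moreover have "\<forall>\<^sub>F x in at_right 0. of_real x * Q x - 1 = of_real x * (deriv zeta (1 + of_real x) / zeta (1 + of_real x))"
    unfolding eventually_at_right_field
  proof (intro exI[of _ 1] conjI allI impI)
    fix x :: real assume "0 < x"
    then show "of_real x * Q x - 1 = of_real x * (deriv zeta (1 + of_real x) / zeta (1 + of_real x))"
      unfolding eq[OF \<open>0 < x\<close>] by (simp add: right_diff_distrib)
  qed simp
  ultimately have lim: "((\<lambda>x. of_real x * (deriv zeta (1 + of_real x) / zeta (1 + of_real x))) \<longlongrightarrow> -1) (at_right 0)"
    by (rule Lim_transform_eventually)
  have "continuous_on {0..1} Q"
    unfolding Q_def
    by (intro continuous_at_imp_continuous_on ballI continuous_divide isCont_o2[OF _ contG(1)] isCont_o2[OF _ contG(2)] G_nz)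
       (auto intro!: continuous_intros)
  then have "compact (Q ` {0..1})" by (intro compact_continuous_image) auto
  then obtain K where "\<forall>x\<in>{0..1}. norm (Q x) \<le> K"
    by (auto dest!: compact_imp_bounded simp: bounded_iff)
  then have K: "norm (Q x) \<le> K" if "0 \<le> x" "x \<le> 1" for x using that by simp
  have "K \<ge> 0" using K[of 0] norm_ge_zero[of "Q 0"] by linarith
  show ?thesis
  proof (rule that[OF lim, of "K + 1"])
    fix x :: real assume x: "0 < x" "x \<le> 1"
    have "norm (Q x - 1 / of_real x) \<le> norm (Q x) + norm (1 / complex_of_real x)" by (rule norm_triangle_ineq4)
    also have "\<dots> \<le> K / x + 1 / x"
    proof (rule add_mono)
      have "K * x \<le> K" using x \<open>K \<ge> 0\<close> by (simp add: mult_left_le)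
      then have "K \<le> K / x" using x by (simp add: field_simps)
      then show "norm (Q x) \<le> K / x" using K[of x] x by linarith
    qed (use x in \<open>simp add: norm_divide\<close>)
    finally show "norm (deriv zeta (1 + of_real x) / zeta (1 + of_real x)) \<le> (K + 1) / x"
      using x by (simp add: eq add_divide_distrib)
  qed (use \<open>K \<ge> 0\<close> in simp)
qed

text \<open>The coefficients \<open>mangoldt n\<close> are nonnegative, so the sum of the absolute
  values of the terms is the value of the series at the real point \<open>Re s\<close>.\<close>

lemma norm_log_deriv_zeta_le:
  assumes "Re s > 1"
  shows "norm (deriv zeta s / zeta s) \<le> norm (deriv zeta (of_real (Re s)) / zeta (of_real (Re s)))"
proof -
  have "norm (- (deriv zeta s / zeta s)) \<le> (\<Sum>n. norm (mangoldt n / of_nat n powr s :: complex))"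
    unfolding sums_unique[OF neg_log_deriv_zeta_sums[OF assms]]
    by (intro summable_norm mangoldt_dirichlet_summable assms)
  also have "\<dots> = - Re (deriv zeta (of_real (Re s)) / zeta (of_real (Re s)))"
    using Re_neg_log_deriv_zeta_sums[of "of_real (Re s)"] assms
    by (simp add: sums_iff norm_divide norm_of_nat_powr)
  also have "\<dots> \<le> norm (deriv zeta (of_real (Re s)) / zeta (of_real (Re s)))"
    using abs_Re_le_cmod[of "deriv zeta (of_real (Re s)) / zeta (of_real (Re s))"] by linarith
  finally show ?thesis by simp
qed

lemma log_deriv_zeta_bound:
  "\<exists>K>0. \<forall>x t. 0 < x \<longrightarrow> x \<le> 1 \<longrightarrow>
      norm (deriv zeta (1 + of_real x + \<i> * of_real t) / zeta (1 + of_real x + \<i> * of_real t)) \<le> K / x"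
proof -
  obtain K where K: "K > 0" "\<And>x. 0 < x \<Longrightarrow> x \<le> 1 \<Longrightarrow> norm (deriv zeta (1 + of_real x) / zeta (1 + of_real x)) \<le> K / x"
    using log_deriv_zeta_pole by blast
  have "norm (deriv zeta (1 + of_real x + \<i> * of_real t) / zeta (1 + of_real x + \<i> * of_real t)) \<le> K / x"
    if "0 < x" "x \<le> 1" for x t :: real
    using norm_log_deriv_zeta_le[of "1 + of_real x + \<i> * of_real t"] K(2)[OF that] that by simp
  with K(1) show ?thesis by blast
qed

lemma three_four_one:
  fixes \<theta> :: real
  shows "3 + 4 * cos \<theta> + cos (2 * \<theta>) \<ge> 0"
proof -
  have "3 + 4 * cos \<theta> + cos (2 * \<theta>) = 2 * (1 + cos \<theta>)\<^sup>2"
    unfolding cos_double_cos by (simp add: power2_eq_square algebra_simps)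
  then show ?thesis by simp
qed

text \<open>The 3-4-1 argument in residue form: the limits of \<open>x * (deriv zeta / zeta)\<close>
  at 1, \<open>1 + \<i> * t\<close> and \<open>1 + 2 * \<i> * t\<close> are -1, \<open>m1\<close>
  and \<open>m2\<close>, and the trigonometric inequality forces
  \<open>-3 + 4 * m1 + m2 \<le> 0\<close>, which excludes \<open>m1 \<ge> 1\<close>.\<close>

lemma zeta_nonzero_Re_1:
  assumes t: "t \<noteq> 0" shows "zeta (1 + \<i> * of_real t) \<noteq> 0"
proof
  assume zero: "zeta (1 + \<i> * of_real t) = 0"
  define Z where "Z = (\<lambda>s. deriv zeta s / zeta s)"
  obtain m1 :: nat where m1: "m1 > 0" "((\<lambda>x. of_real x * Z (1 + \<i> * of_real t + of_real x)) \<longlongrightarrow> of_nat m1) (at_right 0)"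
    using zeta_log_deriv_order[of "1 + \<i> * of_real t"] zero t unfolding Z_def by auto
  obtain m2 :: nat where m2: "((\<lambda>x. of_real x * Z (1 + \<i> * of_real (2 * t) + of_real x)) \<longlongrightarrow> of_nat m2) (at_right 0)"
    using zeta_log_deriv_order[of "1 + \<i> * of_real (2 * t)"] t unfolding Z_def by auto
  have m0: "((\<lambda>x. of_real x * Z (1 + of_real x)) \<longlongrightarrow> -1) (at_right 0)"
    using log_deriv_zeta_pole unfolding Z_def by blast
  let ?F = "\<lambda>x. 3 * Re (of_real x * Z (1 + of_real x)) + 4 * Re (of_real x * Z (1 + \<i> * of_real t + of_real x))
                + Re (of_real x * Z (1 + \<i> * of_real (2 * t) + of_real x))"
  have "(?F \<longlongrightarrow> 3 * Re (-1) + 4 * Re (of_nat m1) + Re (of_nat m2)) (at_right 0)"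
    by (intro tendsto_intros m0 m1(2) m2)
  moreover have "?F x \<le> 0" if x: "x > 0" for x
  proof -
    let ?a = "\<lambda>n. mangoldt n / real n powr (1 + x)"
    have 0: "(\<lambda>n. ?a n) sums (- Re (Z (1 + of_real x)))"
      using Re_neg_log_deriv_zeta_sums[of "1 + of_real x"] x by (simp add: Z_def)
    have 1: "(\<lambda>n. ?a n * cos (t * ln (real n))) sums (- Re (Z (1 + \<i> * of_real t + of_real x)))"
      using Re_neg_log_deriv_zeta_sums[of "1 + \<i> * of_real t + of_real x"] x by (simp add: Z_def)
    have 2: "(\<lambda>n. ?a n * cos (2 * t * ln (real n))) sums (- Re (Z (1 + \<i> * of_real (2 * t) + of_real x)))"
      using Re_neg_log_deriv_zeta_sums[of "1 + \<i> * of_real (2 * t) + of_real x"] x by (simp add: Z_def)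
    have "0 \<le> 3 * (- Re (Z (1 + of_real x))) + 4 * (- Re (Z (1 + \<i> * of_real t + of_real x)))
                + - Re (Z (1 + \<i> * of_real (2 * t) + of_real x))"
    proof (rule sums_le[OF _ sums_zero sums_add[OF sums_add[OF sums_mult[OF 0] sums_mult[OF 1]] 2]])
      fix n
      have "0 \<le> ?a n * (3 + 4 * cos (t * ln (real n)) + cos (2 * (t * ln (real n))))"
        by (intro mult_nonneg_nonneg three_four_one divide_nonneg_nonneg mangoldt_nonneg) auto
      then show "0 \<le> 3 * ?a n + 4 * (?a n * cos (t * ln (real n))) + ?a n * cos (2 * t * ln (real n))"
        by (simp add: algebra_simps)
    qed
    then have "0 \<le> x * (3 * (- Re (Z (1 + of_real x))) + 4 * (- Re (Z (1 + \<i> * of_real t + of_real x)))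
                + - Re (Z (1 + \<i> * of_real (2 * t) + of_real x)))"
      using x by simp
    then show ?thesis by (simp add: algebra_simps)
  qed
  then have "\<forall>\<^sub>F x in at_right 0. ?F x \<le> 0"
    by (auto simp: eventually_at_right_field intro!: exI[of _ 1])
  ultimately have "3 * Re (-1) + 4 * Re (of_nat m1) + Re (of_nat m2) \<le> 0"
    by (intro tendsto_upperbound) auto
  with m1(1) show False by simp
qed

lemma zeta_nonzero:
  assumes "Re s \<ge> 1" "s \<noteq> 1" shows "zeta s \<noteq> 0"
proof (cases "Re s = 1")
  case True
  then have s: "s = 1 + \<i> * of_real (Im s)" by (simp add: complex_eq_iff)
  have "Im s \<noteq> 0"
  proof
    assume "Im s = 0"
    with s have "s = 1" by simp
    with assms(2) show False ..
  qed
  with zeta_nonzero_Re_1 s show ?thesis by metis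
qed (use assms zeta_nonzero_Re_gt_1 in auto)

section \<open>Transfer of an upper bound from the line to abscissa
  \<open>1 + \<delta>\<close>\<close>

lemma isCont_log_deriv_zeta:
  assumes "Re s \<ge> 1" "s \<noteq> 1"
  shows "isCont (\<lambda>s. deriv zeta s / zeta s) s"
  using assms holomorphic_on_open_isCont[OF zeta_holomorphic] zeta_nonzero[OF assms]
    holomorphic_on_open_isCont[OF holomorphic_deriv[OF zeta_holomorphic]]
  by (intro continuous_divide) auto

text \<open>
  The growth \<open>K/x\<close> at distance \<open>x\<close> from the line is exactly the value of the positive harmonic function
  \<open>K * Re (1/(s - w))\<close> on the horizontal line through \<open>w\<close>. Placing such poles at the two left corners of
  the rectangle controls its horizontal sides, at a cost \<open>O(\<delta>)\<close> away from them.
\<close>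

lemma Re_log_deriv_zeta_from_boundary:
  obtains K where "K > 0"
    "\<And>M Y T \<delta> t. 0 < Y \<Longrightarrow> 0 \<le> M \<Longrightarrow>
      (\<And>u. u \<in> {Y..T} \<Longrightarrow> - Re (deriv zeta (1 + \<i> * of_real u) / zeta (1 + \<i> * of_real u)) \<le> M) \<Longrightarrow>
      0 < \<delta> \<Longrightarrow> \<delta> < 1 \<Longrightarrow> t \<in> {Y + 1..T - 1} \<Longrightarrow>
      - Re (deriv zeta (1 + of_real \<delta> + \<i> * of_real t) / zeta (1 + of_real \<delta> + \<i> * of_real t)) \<le> M + K * \<delta>"
proof -
  define Z where "Z = (\<lambda>s. deriv zeta s / zeta s)"
  have "\<exists>K>0. \<forall>x t. 0 < x \<longrightarrow> x \<le> 1 \<longrightarrow> norm (Z (1 + of_real x + \<i> * of_real t)) \<le> K / x"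
    unfolding Z_def by (rule log_deriv_zeta_bound)
  then obtain K where K: "K > 0"
    "\<And>x t. 0 < x \<Longrightarrow> x \<le> 1 \<Longrightarrow> norm (Z (1 + of_real x + \<i> * of_real t)) \<le> K / x"
    by blast
  have main: "- Re (Z (1 + of_real \<delta> + \<i> * of_real t)) \<le> M + 3 * K * \<delta> + \<epsilon>"
    if Y: "0 < Y" and M: "0 \<le> M" and bound: "\<And>u. u \<in> {Y..T} \<Longrightarrow> - Re (Z (1 + \<i> * of_real u)) \<le> M"
      and \<delta>: "0 < \<delta>" "\<delta> < 1" and t: "t \<in> {Y + 1..T - 1}" and \<epsilon>: "\<epsilon> > 0" for M Y T \<delta> t \<epsilon>
  proof -
    have contZ: "isCont Z s" if "Re s \<ge> 1" "Im s \<ge> Y" for s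
      using isCont_log_deriv_zeta[of s] that Y unfolding Z_def by fastforce
    define B where "B = cbox (Complex 1 Y) (Complex 2 T)"
    have "uniformly_continuous_on B Z"
      unfolding B_def
      by (intro compact_uniformly_continuous compact_cbox continuous_at_imp_continuous_on ballI contZ)
         (auto simp: in_cbox_complex_iff)
    then obtain d where d: "d > 0" "\<And>s s'. s \<in> B \<Longrightarrow> s' \<in> B \<Longrightarrow> dist s' s < d \<Longrightarrow> dist (Z s') (Z s) < \<epsilon>"
      using \<epsilon> unfolding uniformly_continuous_on_def by blast
    \<comment> \<open>The rectangle must stay off the line itself, where the corner poles lie and
      the bound \<open>K / x\<close> degenerates. Uniform continuity on \<open>B\<close> moves the
      hypothesis from abscissa 1 to \<open>1 + \<kappa>\<close> at a cost of
      \<open>\<epsilon>\<close>; \<open>\<kappa> \<le> \<delta>\<close> keeps the target point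
      inside.\<close>
    define \<kappa> where "\<kappa> = min (d / 2) \<delta>"
    have \<kappa>: "0 < \<kappa>" "\<kappa> \<le> \<delta>" "\<kappa> < d" using d(1) \<delta> by (auto simp: \<kappa>_def)
    have left: "- Re (Z (1 + of_real \<kappa> + \<i> * of_real u)) \<le> M + \<epsilon>" if u: "u \<in> {Y..T}" for u
    proof -
      have "dist (Z (1 + of_real \<kappa> + \<i> * of_real u)) (Z (1 + \<i> * of_real u)) < \<epsilon>"
        using u \<kappa> \<delta> by (intro d(2)) (auto simp: B_def in_cbox_complex_iff dist_norm)
      then have "\<bar>Re (Z (1 + of_real \<kappa> + \<i> * of_real u) - Z (1 + \<i> * of_real u))\<bar> < \<epsilon>"
        using abs_Re_le_cmod by (metis dist_norm le_less_trans)
      with bound[OF u] show ?thesis by simp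
    qed
    define S where "S = cbox (Complex (1 + \<kappa>) Y) (Complex 2 T)"
    define s0 s1 where "s0 = Complex 1 Y" and "s1 = Complex 1 T"
    \<comment> \<open>The two polar terms dominate on the horizontal sides; the linear term
      \<open>K * (s - 1)\<close> does the same on the right side \<open>Re s = 2\<close>, where the
      logarithmic derivative is at most \<open>K\<close>.\<close>
    define F where "F = (\<lambda>s. - Z s - of_real K / (s - s0) - of_real K / (s - s1) - of_real K * (s - 1))"
    define h where "h = (\<lambda>s w. K * (Re s - 1) / (cmod (s - w))\<^sup>2)"
    have ReF: "Re (F s) = - Re (Z s) - h s s0 - h s s1 - K * (Re s - 1)" for s
      by (simp add: F_def h_def s0_def s1_def Re_divide cmod_power2)
    have hpos: "h s w \<ge> 0" if "Re s \<ge> 1" for s w using K(1) that by (simp add: h_def)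
    let ?s = "1 + of_real \<delta> + \<i> * of_real t"
    have Fs: "Re (F ?s) \<le> M + \<epsilon>"
    proof (rule maximum_real_frontier[of F S])
      have holZ: "Z holomorphic_on {s. Re s > 1}"
        unfolding Z_def using zeta_nonzero_Re_gt_1
        by (intro holomorphic_intros holomorphic_on_subset[OF zeta_holomorphic]
              holomorphic_on_subset[OF holomorphic_deriv[OF zeta_holomorphic]]) auto
      have "F holomorphic_on {s. Re s > 1}"
        unfolding F_def by (intro holomorphic_intros holZ) (auto simp: s0_def s1_def)
      moreover have "S \<subseteq> {s. Re s > 1}" using \<kappa> by (auto simp: S_def in_cbox_complex_iff)
      ultimately have F: "F holomorphic_on S" by (rule holomorphic_on_subset)
      then show "F holomorphic_on interior S" by (rule holomorphic_on_subset) (rule interior_subset)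
      have "closure S = S" by (simp add: S_def)
      with F show "continuous_on (closure S) F" by (simp add: holomorphic_on_imp_continuous_on)
      show "bounded S" by (simp add: S_def)
      show "?s \<in> S" using t \<delta> \<kappa> by (auto simp: S_def in_cbox_complex_iff)
      fix z assume "z \<in> frontier S"
      then have z: "z \<in> S" "z \<notin> box (Complex (1 + \<kappa>) Y) (Complex 2 T)"
        by (auto simp: S_def frontier_cbox)
      define x u where "x = Re z - 1" and "u = Im z"
      have z_eq: "z = 1 + of_real x + \<i> * of_real u" by (simp add: complex_eq_iff x_def u_def)
      have xu: "\<kappa> \<le> x" "x \<le> 1" "u \<in> {Y..T}" using z(1) by (auto simp: S_def in_cbox_complex_iff x_def u_def)
      have Zz: "- Re (Z z) \<le> K / x"
        using K(2)[of x u] xu \<kappa> abs_Re_le_cmod[of "Z z"] unfolding z_eq by linarith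
      have pos: "h z s0 \<ge> 0" "h z s1 \<ge> 0" "K * (Re z - 1) \<ge> 0"
        using xu \<kappa> K(1) by (auto simp: x_def intro!: hpos)
      consider "x = \<kappa>" | "x = 1" | "u = Y" | "u = T"
        using z(2) xu by (force simp: in_box_complex_iff x_def u_def)
      then show "Re (F z) \<le> M + \<epsilon>"
      proof cases
        case 1
        then show ?thesis using left[OF xu(3)] pos unfolding ReF z_eq by simp
      next
        case 2
        then have "- Re (Z z) \<le> K * (Re z - 1)" using Zz by (simp add: x_def)
        then show ?thesis using pos M \<epsilon> unfolding ReF by linarith
      next
        case 3
        then have "z - s0 = of_real x" by (simp add: z_eq s0_def complex_eq_iff)
        then have "h z s0 = K / x"
          using xu \<kappa> by (simp add: h_def x_def[symmetric] power2_eq_square)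
        then show ?thesis using Zz pos M \<epsilon> unfolding ReF by linarith
      next
        case 4
        then have "z - s1 = of_real x" by (simp add: z_eq s1_def complex_eq_iff)
        then have "h z s1 = K / x"
          using xu \<kappa> by (simp add: h_def x_def[symmetric] power2_eq_square)
        then show ?thesis using Zz pos M \<epsilon> unfolding ReF by linarith
      qed
    qed
    \<comment> \<open>The point \<open>t\<close> has distance at least 1 from the heights of both
      corners, so each polar term costs at most \<open>K * \<delta>\<close>. With the linear term
      this makes the factor 3.\<close>
    have h_le: "h ?s w \<le> K * \<delta>" if "Re w = 1" "\<bar>Im w - t\<bar> \<ge> 1" for w
    proof -
      have "1 \<le> (cmod (?s - w))\<^sup>2"
      proof -
        have "1 \<le> \<bar>Im (?s - w)\<bar>" using that by simp
        also have "\<dots> \<le> cmod (?s - w)" by (rule abs_Im_le_cmod)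
        finally show ?thesis by simp
      qed
      moreover have "K * \<delta> \<ge> 0" using K(1) \<delta> by simp
      ultimately have "K * \<delta> / (cmod (?s - w))\<^sup>2 \<le> K * \<delta> / 1"
        by (intro divide_left_mono) auto
      moreover have "Re ?s - 1 = \<delta>" by simp
      ultimately show ?thesis unfolding h_def by (simp only:)
    qed
    have "Re s0 = 1" "\<bar>Im s0 - t\<bar> \<ge> 1" "Re s1 = 1" "\<bar>Im s1 - t\<bar> \<ge> 1"
      using t by (auto simp: s0_def s1_def)
    then have "h ?s s0 \<le> K * \<delta>" "h ?s s1 \<le> K * \<delta>" by (blast intro: h_le)+
    moreover note Fs
    moreover have "K * (Re ?s - 1) = K * \<delta>" by simp
    ultimately show ?thesis unfolding ReF by linarith
  qed
  show ?thesis
  proof (rule that[of "3 * K"])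
    fix M Y T \<delta> t :: real
    assume Y: "0 < Y" and M: "0 \<le> M"
      and bound: "\<And>u. u \<in> {Y..T} \<Longrightarrow> - Re (deriv zeta (1 + \<i> * of_real u) / zeta (1 + \<i> * of_real u)) \<le> M"
      and \<delta>: "0 < \<delta>" "\<delta> < 1" and t: "t \<in> {Y + 1..T - 1}"
    show "- Re (deriv zeta (1 + of_real \<delta> + \<i> * of_real t) / zeta (1 + of_real \<delta> + \<i> * of_real t)) \<le> M + 3 * K * \<delta>"
      by (rule field_le_epsilon) (rule main[unfolded Z_def, OF Y M bound \<delta> t])
  qed (use K in simp)
qed

section \<open>Functions with nonnegative Fejer-weighted cosine transform\<close>

text \<open>A substitute for "cosine series with nonnegative coefficients" that never names the
  coefficients. Asking for all frequencies \<open>u\<close>, and not only for \<open>u = 0\<close>,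
  makes the property stable under multiplication by cosines, hence by nonnegative cosine series; in
  the end only \<open>u = 0\<close> is evaluated.\<close>

definition fejer_positive :: "real \<Rightarrow> (real \<Rightarrow> real) \<Rightarrow> bool" where
  "fejer_positive T f \<longleftrightarrow> continuous_on {-T..T} f \<and>
     (\<forall>u. 0 \<le> integral {-T..T} (\<lambda>t. f t * cos (u * t) * (1 - \<bar>t\<bar> / T)))"

lemma fejer_integrable:
  fixes f :: "real \<Rightarrow> real"
  assumes "continuous_on {-T..T} f"
  shows "(\<lambda>t. f t * cos (u * t) * (1 - \<bar>t\<bar> / T)) integrable_on {-T..T}"
  using assms unfolding divide_inverse by (intro integrable_continuous_real continuous_intros)

text \<open>Half of the Fejer kernel, by parts. Its nonnegativity, as cosines are at most 1, is the
  source of all positivity below.\<close>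

lemma fejer_kernel_integral:
  fixes T u :: real
  assumes T: "T > 0" and u: "u \<noteq> 0"
  shows "((\<lambda>t. cos (u * t) * (1 - \<bar>t\<bar> / T)) has_integral (1 - cos (u * T)) / (u\<^sup>2 * T)) {0..T}"
proof -
  let ?F = "\<lambda>t. sin (u * t) / u * (1 - t / T) - cos (u * t) / (u\<^sup>2 * T)"
  have "((\<lambda>t. cos (u * t) * (1 - \<bar>t\<bar> / T)) has_integral (?F T - ?F 0)) {0..T}"
  proof (rule fundamental_theorem_of_calculus)
    fix t assume t: "t \<in> {0..T}"
    have "(?F has_real_derivative cos (u * t) * (1 - t / T)) (at t within {0..T})"
      using T u by (auto intro!: derivative_eq_intros simp: field_simps power2_eq_square)
    then show "(?F has_vector_derivative cos (u * t) * (1 - \<bar>t\<bar> / T)) (at t within {0..T})"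
      using t by (simp add: has_real_derivative_iff_has_vector_derivative)
  qed (use T in simp)
  then show ?thesis using T by (simp add: diff_divide_distrib)
qed

lemma integral_even:
  fixes f :: "real \<Rightarrow> real"
  assumes "\<And>t. f (- t) = f t" "(f has_integral I) {0..T}" "T \<ge> 0"
  shows "(f has_integral (2 * I)) {-T..T}"
proof -
  have "((\<lambda>t. f (- t)) has_integral I) {-T..-0}"
    using assms(2) has_integral_reflect_real[of f I T 0] by simp
  then have "(f has_integral I) {-T..0}" by (simp add: assms(1))
  from has_integral_combine[OF _ _ this assms(2)] assms(3) show ?thesis by simp
qed

lemma fejer_integral_1:
  fixes T :: real
  assumes T: "T > 0"
  shows "((\<lambda>t. 1 - \<bar>t\<bar> / T) has_integral T) {-T..T}"
proof -
  have "((\<lambda>t. 1 - \<bar>t\<bar> / T) has_integral ((T - T\<^sup>2 / (2 * T)) - (0 - 0\<^sup>2 / (2 * T)))) {0..T}"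
  proof (rule fundamental_theorem_of_calculus)
    fix t assume t: "t \<in> {0..T}"
    have "((\<lambda>t. t - t\<^sup>2 / (2 * T)) has_real_derivative 1 - t / T) (at t within {0..T})"
      using T by (auto intro!: derivative_eq_intros simp: field_simps)
    then show "((\<lambda>t. t - t\<^sup>2 / (2 * T)) has_vector_derivative 1 - \<bar>t\<bar> / T) (at t within {0..T})"
      using t by (simp add: has_real_derivative_iff_has_vector_derivative)
  qed (use T in simp)
  from integral_even[OF _ this] T show ?thesis by (simp add: power2_eq_square)
qed

lemma fejer_positive_1:
  assumes T: "T > 0" shows "fejer_positive T (\<lambda>_. 1)"
  unfolding fejer_positive_def
proof (intro conjI allI)
  fix u
  show "0 \<le> integral {- T..T} (\<lambda>t. 1 * cos (u * t) * (1 - \<bar>t\<bar> / T))"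
  proof (cases "u = 0")
    case True
    then show ?thesis using fejer_integral_1[OF T] T by (simp add: has_integral_integral integral_unique)
  next
    case False
    have "((\<lambda>t. cos (u * t) * (1 - \<bar>t\<bar> / T)) has_integral (2 * ((1 - cos (u * T)) / (u\<^sup>2 * T)))) {-T..T}"
      using T by (intro integral_even fejer_kernel_integral[OF T False]) auto
    then show ?thesis using T by (simp add: integral_unique)
  qed
qed simp

lemma fejer_positive_add:
  assumes "fejer_positive T f" "fejer_positive T g"
  shows "fejer_positive T (\<lambda>t. f t + g t)"
  unfolding fejer_positive_def
proof (intro conjI allI)
  fix u
  have "integral {-T..T} (\<lambda>t. (f t + g t) * cos (u * t) * (1 - \<bar>t\<bar> / T)) =
    integral {-T..T} (\<lambda>t. f t * cos (u * t) * (1 - \<bar>t\<bar> / T)) + integral {-T..T} (\<lambda>t. g t * cos (u * t) * (1 - \<bar>t\<bar> / T))"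
    unfolding distrib_right using assms
    by (intro integral_add) (auto simp: fejer_positive_def simp flip: distrib_right intro!: fejer_integrable)
  then show "0 \<le> integral {-T..T} (\<lambda>t. (f t + g t) * cos (u * t) * (1 - \<bar>t\<bar> / T))"
    using assms by (auto simp: fejer_positive_def)
qed (use assms in \<open>auto simp: fejer_positive_def intro!: continuous_intros\<close>)

lemma fejer_positive_cmult:
  assumes "fejer_positive T f" "c \<ge> 0"
  shows "fejer_positive T (\<lambda>t. c * f t)"
  using assms by (auto simp: fejer_positive_def mult.assoc intro!: continuous_intros)

text \<open>The product formula for cosines replaces the test frequency \<open>u\<close> by
  \<open>a - u\<close> and \<open>a + u\<close>, both covered by the definition.\<close>

lemma fejer_positive_cos:
  assumes "fejer_positive T f"
  shows "fejer_positive T (\<lambda>t. f t * cos (a * t))"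
  unfolding fejer_positive_def
proof (intro conjI allI)
  fix u
  have cont: "continuous_on {-T..T} f" using assms by (simp add: fejer_positive_def)
  have "f t * cos (a * t) * cos (u * t) * (1 - \<bar>t\<bar> / T) =
     1 / 2 * (f t * cos ((a - u) * t) * (1 - \<bar>t\<bar> / T)) + 1 / 2 * (f t * cos ((a + u) * t) * (1 - \<bar>t\<bar> / T))" for t
  proof -
    have "cos (a * t) * cos (u * t) = 1 / 2 * cos ((a - u) * t) + 1 / 2 * cos ((a + u) * t)"
      by (simp add: cos_times_cos algebra_simps add_divide_distrib)
    then have "f t * (cos (a * t) * cos (u * t)) * (1 - \<bar>t\<bar> / T) = f t * (1 / 2 * cos ((a - u) * t) + 1 / 2 * cos ((a + u) * t)) * (1 - \<bar>t\<bar> / T)"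
      by presburger
    then show ?thesis by (simp only: distrib_left distrib_right mult_ac)
  qed
  moreover have "integral {-T..T} (\<lambda>t. 1 / 2 * (f t * cos ((a - u) * t) * (1 - \<bar>t\<bar> / T)) + 1 / 2 * (f t * cos ((a + u) * t) * (1 - \<bar>t\<bar> / T)))
     = 1 / 2 * integral {-T..T} (\<lambda>t. f t * cos ((a - u) * t) * (1 - \<bar>t\<bar> / T)) +
       1 / 2 * integral {-T..T} (\<lambda>t. f t * cos ((a + u) * t) * (1 - \<bar>t\<bar> / T))"
    by (subst integral_add) (auto intro!: integrable_on_cmult_left fejer_integrable cont)
  moreover have "\<dots> \<ge> 0" using assms by (simp add: fejer_positive_def)
  ultimately show "0 \<le> integral {-T..T} (\<lambda>t. f t * cos (a * t) * cos (u * t) * (1 - \<bar>t\<bar> / T))" by simp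
qed (use assms in \<open>auto simp: fejer_positive_def intro!: continuous_intros\<close>)

lemma fejer_positive_0: "fejer_positive T (\<lambda>_. 0)"
  by (simp add: fejer_positive_def)

lemma fejer_positive_sum:
  assumes "\<And>n. n \<in> A \<Longrightarrow> fejer_positive T (h n)"
  shows "fejer_positive T (\<lambda>t. \<Sum>n\<in>A. h n t)"
  using assms by (induction A rule: infinite_finite_induct) (auto simp: fejer_positive_0 intro: fejer_positive_add)

lemma fejer_positive_sums:
  assumes h: "\<And>n. fejer_positive T (h n)"
    and bound: "\<And>n t. t \<in> {-T..T} \<Longrightarrow> \<bar>h n t\<bar> \<le> M n" and M: "summable M"
    and g: "\<And>t. t \<in> {-T..T} \<Longrightarrow> (\<lambda>n. h n t) sums g t"
  shows "fejer_positive T g"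
proof -
  have "uniform_limit {-T..T} (\<lambda>n t. \<Sum>i<n. h i t) (\<lambda>t. \<Sum>i. h i t) sequentially"
    by (rule Weierstrass_m_test[OF _ M]) (use bound in auto)
  then have lim: "uniform_limit {-T..T} (\<lambda>n t. \<Sum>i<n. h i t) g sequentially"
    by (rule uniform_limit_cong'[THEN iffD1, rotated -1]) (simp_all add: sums_unique[OF g])
  have S: "fejer_positive T (\<lambda>t. \<Sum>i<n. h i t)" for n by (rule fejer_positive_sum) (rule h)
  have cont: "continuous_on {-T..T} g"
    by (rule uniform_limit_theorem[OF _ lim]) (use S in \<open>auto simp: fejer_positive_def\<close>)
  show ?thesis unfolding fejer_positive_def
  proof (intro conjI allI cont)
    fix u
    let ?w = "\<lambda>t. cos (u * t) * (1 - \<bar>t\<bar> / T)"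
    have wcont: "continuous_on {-T..T} ?w"
      unfolding divide_inverse by (intro continuous_intros)
    have "uniform_limit {-T..T} (\<lambda>n t. (\<Sum>i<n. h i t) * ?w t) (\<lambda>t. g t * ?w t) sequentially"
      using lim cont wcont
      by (intro uniform_lim_mult uniform_limit_const)
         (auto intro!: compact_imp_bounded compact_continuous_image simp: image_comp)
    moreover have "continuous_on {-T..T} (\<lambda>t. (\<Sum>i<n. h i t) * ?w t)" for n
      using S[of n] wcont by (auto simp: fejer_positive_def intro!: continuous_on_mult)
    ultimately obtain I J where IJ:
      "\<And>n. ((\<lambda>t. (\<Sum>i<n. h i t) * ?w t) has_integral I n) {-T..T}"
      "((\<lambda>t. g t * ?w t) has_integral J) {-T..T}" "I \<longlonglongrightarrow> J"
      by (rule uniform_limit_integral) auto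
    have "(\<lambda>n. integral {-T..T} (\<lambda>t. (\<Sum>i<n. h i t) * ?w t)) \<longlonglongrightarrow> integral {-T..T} (\<lambda>t. g t * ?w t)"
      unfolding integral_unique[OF IJ(1)] integral_unique[OF IJ(2)] by (rule IJ(3))
    then show "0 \<le> integral {-T..T} (\<lambda>t. g t * cos (u * t) * (1 - \<bar>t\<bar> / T))"
      using S by (intro tendsto_lowerbound[where f = "\<lambda>n. integral {-T..T} (\<lambda>t. (\<Sum>i<n. h i t) * ?w t)"])
        (auto simp: fejer_positive_def mult.assoc)
  qed
qed

lemma fejer_positive_cos_series:
  assumes f: "fejer_positive T f" and a: "\<And>k. a k \<ge> 0" "summable a"
    and g: "\<And>t. (\<lambda>k. a k * cos (u k * t)) sums g t"
  shows "fejer_positive T (\<lambda>t. f t * g t)"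
proof -
  have "compact (f ` {-T..T})"
    using f by (intro compact_continuous_image) (auto simp: fejer_positive_def)
  then obtain C where "\<forall>t\<in>{-T..T}. norm (f t) \<le> C"
    by (auto dest!: compact_imp_bounded simp: bounded_iff)
  then have C: "\<bar>f t\<bar> \<le> C" if "t \<in> {-T..T}" for t using that by auto
  show ?thesis
  proof (rule fejer_positive_sums[of T "\<lambda>k t. a k * (f t * cos (u k * t))" "\<lambda>k. a k * C"])
    fix k t assume "t \<in> {-T..T}"
    then have "\<bar>f t\<bar> * \<bar>cos (u k * t)\<bar> \<le> C * 1"
      using C[of t] abs_ge_zero[of "f t"] by (intro mult_mono) (auto simp: abs_cos_le_one intro: order_trans)
    then show "\<bar>a k * (f t * cos (u k * t))\<bar> \<le> a k * C"
      using a(1)[of k] by (simp add: abs_mult mult_left_mono)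
  next
    fix t
    show "(\<lambda>k. a k * (f t * cos (u k * t))) sums (f t * g t)"
      using sums_mult[OF g, of "f t" t] by (simp add: mult_ac)
  qed (use a f in \<open>auto intro!: fejer_positive_cmult fejer_positive_cos summable_mult2\<close>)
qed

section \<open>Poisson kernels and the resonator built from them\<close>

lemma poisson_denominator:
  fixes r \<theta> :: real
  assumes "0 \<le> r" "r < 1"
  shows "1 - 2 * r * cos \<theta> + r\<^sup>2 > 0" "1 - 2 * r * cos \<theta> + r\<^sup>2 \<ge> (1 - r)\<^sup>2"
proof -
  have "r * cos \<theta> \<le> r * 1" using assms by (intro mult_left_mono) auto
  then show "1 - 2 * r * cos \<theta> + r\<^sup>2 \<ge> (1 - r)\<^sup>2" by (simp add: power2_eq_square algebra_simps)
  moreover have "(1 - r)\<^sup>2 > 0" using assms by simp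
  ultimately show "1 - 2 * r * cos \<theta> + r\<^sup>2 > 0" by linarith
qed

text \<open>Real part of the geometric series
  \<open>exp (\<i> * \<phi>) / (1 - r * exp (\<i> * \<theta>))\<close>; the denominator on the right
  is \<open>\<bar>1 - r * exp (\<i> * \<theta>)\<bar>\<^sup>2\<close>. The starting phase
  \<open>\<phi>\<close> is free so that series beginning at any multiple of \<open>\<theta>\<close>
  are available.\<close>

lemma cos_geometric_sums:
  fixes r \<theta> \<phi> :: real
  assumes r: "0 \<le> r" "r < 1"
  shows "(\<lambda>k. r ^ k * cos (\<phi> + real k * \<theta>)) sums ((cos \<phi> - r * cos (\<phi> - \<theta>)) / (1 - 2 * r * cos \<theta> + r\<^sup>2))"
proof -
  let ?z = "of_real r * cis \<theta>"
  have "(\<lambda>k. cis \<phi> * ?z ^ k) sums (cis \<phi> * (1 / (1 - ?z)))"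
    using r by (intro sums_mult geometric_sums) (simp add: norm_mult)
  then have "(\<lambda>k. Re (cis \<phi> * ?z ^ k)) sums Re (cis \<phi> / (1 - ?z))"
    by (intro sums_Re) simp
  moreover have "Re (cis \<phi> * ?z ^ k) = r ^ k * cos (\<phi> + real k * \<theta>)" for k
  proof -
    have "cis \<phi> * ?z ^ k = of_real (r ^ k) * cis (\<phi> + real k * \<theta>)"
      by (simp only: power_mult_distrib Complex.DeMoivre of_real_power mult.left_commute[of "cis \<phi>"] cis_mult)
    then show ?thesis by simp
  qed
  moreover have "Re (cis \<phi> / (1 - ?z)) = (cos \<phi> - r * cos (\<phi> - \<theta>)) / (1 - 2 * r * cos \<theta> + r\<^sup>2)"
  proof -
    have "(1 - r * c)\<^sup>2 + (r * s)\<^sup>2 = 1 - 2 * r * c + r\<^sup>2 * (s\<^sup>2 + c\<^sup>2)" for c s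
      by (simp add: power2_eq_square algebra_simps)
    from this[of "cos \<theta>" "sin \<theta>"] have "(1 - r * cos \<theta>)\<^sup>2 + (r * sin \<theta>)\<^sup>2 = 1 - 2 * r * cos \<theta> + r\<^sup>2" by simp
    then show ?thesis by (simp add: Re_divide cos_diff algebra_simps)
  qed
  ultimately show ?thesis by simp
qed

lemma fejer_positive_mult_geometric:
  assumes "fejer_positive T f" "0 \<le> r" "r < 1"
  shows "fejer_positive T (\<lambda>t. f t * ((cos (b * t) - r * cos (b * t - a * t)) / (1 - 2 * r * cos (a * t) + r\<^sup>2)))"
proof (rule fejer_positive_cos_series[OF assms(1)])
  show "(\<lambda>k. r ^ k * cos ((b + real k * a) * t)) sums
      ((cos (b * t) - r * cos (b * t - a * t)) / (1 - 2 * r * cos (a * t) + r\<^sup>2))" for t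
    using cos_geometric_sums[OF assms(2,3), of "b * t" "a * t"] by (simp add: algebra_simps)
qed (use assms in auto)

text \<open>With \<open>c = cos \<theta>\<close>, the quotients with numerators
  \<open>1 - r * c\<close> and \<open>c - r\<close> are the geometric cosine series starting at
  frequency 0 and at frequency 1. Both identities are thus combinations of nonnegative cosine series
  with nonnegative weights; the second one removes the constant coefficient
  \<open>1 / (1 - r\<^sup>2)\<close>.\<close>

lemma poisson_identities:
  fixes r c :: real
  assumes r: "0 \<le> r" "r < 1" and D: "1 - 2 * r * c + r\<^sup>2 > 0"
  shows "1 / (1 - 2 * r * c + r\<^sup>2) = 1 / (1 - r\<^sup>2) * ((1 - r * c) / (1 - 2 * r * c + r\<^sup>2) + r * ((c - r) / (1 - 2 * r * c + r\<^sup>2)))"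
    and "1 / (1 - 2 * r * c + r\<^sup>2) - 1 / (1 - r\<^sup>2) = 2 * r / (1 - r\<^sup>2) * ((c - r) / (1 - 2 * r * c + r\<^sup>2))"
proof -
  have r2: "1 - r\<^sup>2 \<noteq> 0" using r by (simp add: power2_eq_1_iff)
  define d where "d = 1 - 2 * r * c + r\<^sup>2"
  have d: "d \<noteq> 0" using D by (simp add: d_def)
  have "(1 - r * c) / d + r * ((c - r) / d) = (1 - r\<^sup>2) / d"
    by (simp add: power2_eq_square algebra_simps flip: add_divide_distrib)
  then show "1 / (1 - 2 * r * c + r\<^sup>2) = 1 / (1 - r\<^sup>2) * ((1 - r * c) / (1 - 2 * r * c + r\<^sup>2) + r * ((c - r) / (1 - 2 * r * c + r\<^sup>2)))"
    using r2 unfolding d_def[symmetric] by simp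
  have "1 / d - 1 / (1 - r\<^sup>2) = (1 - r\<^sup>2 - d) / ((1 - r\<^sup>2) * d)"
    using r2 d by (simp add: field_simps)
  also have "1 - r\<^sup>2 - d = 2 * r * (c - r)" by (simp add: d_def power2_eq_square algebra_simps)
  finally show "1 / (1 - 2 * r * c + r\<^sup>2) - 1 / (1 - r\<^sup>2) = 2 * r / (1 - r\<^sup>2) * ((c - r) / (1 - 2 * r * c + r\<^sup>2))"
    unfolding d_def[symmetric] by simp
qed

lemma one_minus_square_pos: "0 \<le> r \<Longrightarrow> r < 1 \<Longrightarrow> 1 - r\<^sup>2 > (0::real)"
  by (simp add: power_less_one_iff)

lemma fejer_positive_mult_P1:
  assumes "fejer_positive T f" "0 \<le> r" "r < 1"
  shows "fejer_positive T (\<lambda>t. f t * ((cos (a * t) - r) / (1 - 2 * r * cos (a * t) + r\<^sup>2)))"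
  using fejer_positive_mult_geometric[OF assms, of a a] by simp

lemma fejer_positive_mult_poisson:
  assumes "fejer_positive T f" "0 \<le> r" "r < 1"
  shows "fejer_positive T (\<lambda>t. f t * (1 / (1 - 2 * r * cos (a * t) + r\<^sup>2)))"
    and "fejer_positive T (\<lambda>t. f t * (1 / (1 - 2 * r * cos (a * t) + r\<^sup>2) - 1 / (1 - r\<^sup>2)))"
proof -
  note pos = one_minus_square_pos[OF assms(2,3)]
  note id = poisson_identities[OF assms(2,3) poisson_denominator(1)[OF assms(2,3)]]
  have P0: "fejer_positive T (\<lambda>t. f t * ((1 - r * cos (a * t)) / (1 - 2 * r * cos (a * t) + r\<^sup>2)))"
    using fejer_positive_mult_geometric[OF assms, of 0 a] by simp
  note P1 = fejer_positive_mult_P1[OF assms, of a]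
  have "fejer_positive T (\<lambda>t. 1 / (1 - r\<^sup>2) * (f t * ((1 - r * cos (a * t)) / (1 - 2 * r * cos (a * t) + r\<^sup>2)) +
      r * (f t * ((cos (a * t) - r) / (1 - 2 * r * cos (a * t) + r\<^sup>2)))))"
    by (intro fejer_positive_cmult fejer_positive_add P0 P1) (use assms pos in auto)
  then show "fejer_positive T (\<lambda>t. f t * (1 / (1 - 2 * r * cos (a * t) + r\<^sup>2)))"
    unfolding id(1)[of "a * t" for t] by (simp only: distrib_left mult_ac)
  have "fejer_positive T (\<lambda>t. 2 * r / (1 - r\<^sup>2) * (f t * ((cos (a * t) - r) / (1 - 2 * r * cos (a * t) + r\<^sup>2))))"
    by (intro fejer_positive_cmult P1) (use assms pos in auto)
  then show "fejer_positive T (\<lambda>t. f t * (1 / (1 - 2 * r * cos (a * t) + r\<^sup>2) - 1 / (1 - r\<^sup>2)))"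
    unfolding id(2)[of "a * t" for t] by (simp only: mult_ac)
qed

text \<open>Passing from \<open>k\<close> to \<open>Suc k\<close> multiplies the quotient by
  \<open>r\<close> and adds \<open>(cos (Suc k * \<theta>) - r * cos (k * \<theta>)) / d\<close>,
  which is the geometric cosine series starting at frequency \<open>Suc k\<close>.\<close>

lemma fejer_positive_mult_cos_diff:
  assumes "fejer_positive T f" "0 \<le> r" "r < 1"
  shows "fejer_positive T (\<lambda>t. f t * ((cos (real k * a * t) - r ^ k) / (1 - 2 * r * cos (a * t) + r\<^sup>2)))"
proof (induction k)
  case 0
  then show ?case by (simp add: fejer_positive_0)
next
  case (Suc k)
  have "f t * ((cos (real (Suc k) * a * t) - r ^ Suc k) / (1 - 2 * r * cos (a * t) + r\<^sup>2)) =
     r * (f t * ((cos (real k * a * t) - r ^ k) / (1 - 2 * r * cos (a * t) + r\<^sup>2))) +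
     f t * ((cos (real (Suc k) * a * t) - r * cos (real (Suc k) * a * t - a * t)) / (1 - 2 * r * cos (a * t) + r\<^sup>2))" for t
  proof -
    have "cos (real (Suc k) * a * t - a * t) = cos (real k * a * t)" by (simp add: algebra_simps)
    moreover have "f t * ((X - r ^ Suc k) / d) = r * (f t * ((Y - r ^ k) / d)) + f t * ((X - r * Y) / d)" for X Y d
      by (simp add: diff_divide_distrib right_diff_distrib mult_ac)
    ultimately show ?thesis by presburger
  qed
  then show ?case
    using fejer_positive_add[OF fejer_positive_cmult[OF Suc assms(2)] fejer_positive_mult_geometric[OF assms, of "real (Suc k) * a" a]]
    by presburger
qed

definition resonator :: "nat set \<Rightarrow> (nat \<Rightarrow> real) \<Rightarrow> real \<Rightarrow> real" where
  "resonator A r t = (\<Prod>p\<in>A. 1 / (1 - 2 * r p * cos (ln (real p) * t) + (r p)\<^sup>2))"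

context
  fixes A :: "nat set" and r :: "nat \<Rightarrow> real" and T :: real
  assumes A: "finite A" and r: "\<And>p. p \<in> A \<Longrightarrow> 0 \<le> r p" "\<And>p. p \<in> A \<Longrightarrow> r p < 1" and T: "T > 0"
begin

lemma fejer_positive_resonator:
  assumes "B \<subseteq> A"
  shows "fejer_positive T (resonator B r)"
proof -
  have "finite B" using assms A finite_subset by blast
  then show ?thesis using assms
  proof (induction B)
    case empty
    then show ?case using fejer_positive_1[OF T] by (simp add: resonator_def)
  next
    case (insert p B)
    have "resonator (insert p B) r = (\<lambda>t. resonator B r t * (1 / (1 - 2 * r p * cos (ln (real p) * t) + (r p)\<^sup>2)))"
      using insert(1,2) by (simp add: resonator_def fun_eq_iff)
    moreover have "fejer_positive T \<dots>"
      using insert r by (intro fejer_positive_mult_poisson(1)) auto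
    ultimately show ?case by simp
  qed
qed

text \<open>The subtracted product collects the constant coefficients of the factors. Splitting off
  one factor leaves the old difference times a Poisson kernel, plus a constant times a Poisson
  kernel freed of its constant term. This is what bounds the weighted mean of the resonator from
  below.\<close>

lemma fejer_positive_resonator_diff:
  assumes "B \<subseteq> A"
  shows "fejer_positive T (\<lambda>t. resonator B r t - (\<Prod>p\<in>B. 1 / (1 - (r p)\<^sup>2)))"
proof -
  have "finite B" using assms A finite_subset by blast
  then show ?thesis using assms
  proof (induction B)
    case empty
    then show ?case by (simp add: resonator_def fejer_positive_0)
  next
    case (insert p B)
    let ?D = "\<lambda>t. 1 / (1 - 2 * r p * cos (ln (real p) * t) + (r p)\<^sup>2)"
    let ?c = "\<Prod>p\<in>B. 1 / (1 - (r p)\<^sup>2)"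
    have c: "?c \<ge> 0"
      using insert r by (intro prod_nonneg ballI less_imp_le[OF divide_pos_pos] one_minus_square_pos) auto
    have p: "0 \<le> r p" "r p < 1" using insert r by auto
    have "(\<lambda>t. resonator (insert p B) r t - (\<Prod>p\<in>insert p B. 1 / (1 - (r p)\<^sup>2))) =
        (\<lambda>t. (resonator B r t - ?c) * ?D t + ?c * (1 * (?D t - 1 / (1 - (r p)\<^sup>2))))"
      using insert(1,2) by (simp add: resonator_def fun_eq_iff algebra_simps)
    moreover have "fejer_positive T \<dots>"
      using insert p c fejer_positive_1[OF T]
      by (intro fejer_positive_add fejer_positive_cmult fejer_positive_mult_poisson) auto
    ultimately show ?case by simp
  qed
qed

text \<open>
  Multiplying out the \<open>p\<close>-factor, this follows from
  \<open>(cos (k \<theta>) - r ^ k) / \<bar>1 - r * exp (\<i> \<theta>)\<bar>\<^sup>2\<close> having nonnegative cosine coefficients.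
\<close>

lemma fejer_positive_resonator_cos:
  assumes p: "p \<in> A" "p > 0" and \<rho>: "\<rho> \<le> r p ^ k"
  shows "fejer_positive T (\<lambda>t. resonator A r t * (cos (ln (real (p ^ k)) * t) - \<rho>))"
proof -
  let ?D = "\<lambda>t. 1 - 2 * r p * cos (ln (real p) * t) + (r p)\<^sup>2"
  have res: "resonator A r t = resonator (A - {p}) r t * (1 / ?D t)" for t
    using A p by (simp add: resonator_def prod.remove mult.commute)
  have "fejer_positive T (\<lambda>t. resonator (A - {p}) r t * ((cos (real k * ln (real p) * t) - r p ^ k) / ?D t) +
      (r p ^ k - \<rho>) * resonator A r t)"
    using p r \<rho> by (intro fejer_positive_add fejer_positive_mult_cos_diff fejer_positive_cmult fejer_positive_resonator) auto
  moreover have "resonator (A - {p}) r t * ((cos (real k * ln (real p) * t) - r p ^ k) / ?D t) +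
      (r p ^ k - \<rho>) * resonator A r t = resonator A r t * (cos (ln (real (p ^ k)) * t) - \<rho>)" for t
    using p(2) by (simp add: res ln_realpow algebra_simps add_divide_distrib diff_divide_distrib)
  ultimately show ?thesis by simp
qed

end

section \<open>The resonance inequality\<close>

lemma log_deriv_zeta_shift_sums:
  assumes "\<delta> > 0"
  shows "(\<lambda>n. mangoldt n / real n powr (1 + \<delta>) * cos (ln (real n) * t)) sums
           (- Re (deriv zeta (1 + of_real \<delta> + \<i> * of_real t) / zeta (1 + of_real \<delta> + \<i> * of_real t)))"
  using Re_neg_log_deriv_zeta_sums[of "1 + of_real \<delta> + \<i> * of_real t"] assms by (simp add: mult.commute)

lemma mangoldt_powr_nonneg: "mangoldt n / real n powr x \<ge> 0"
  by (simp add: mangoldt_nonneg)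

lemma primepow_cases:
  assumes "mangoldt n \<noteq> (0::real)"
  obtains p k where "prime p" "k > 0" "n = p ^ k"
  using assms by (auto simp: mangoldt_def primepow_def split: if_splits)

text \<open>At \<open>n = p ^ k\<close> the resonator yields the weight
  \<open>(1 - p/N) ^ k\<close>; since \<open>k * p \<le> p ^ k\<close>, Bernoulli's inequality shows
  that the simpler weight \<open>1 - n/N\<close> lies below it. Proper prime powers therefore keep
  their full share in the gain.\<close>

lemma Bernoulli_prime_power:
  fixes p k N :: nat
  assumes "p \<le> N" "p \<ge> 2" "k > 0"
  shows "1 - real (p ^ k) / real N \<le> (1 - real p / real N) ^ k"
proof -
  have "k \<le> p ^ (k - 1)"
  proof -
    have "k \<le> 2 ^ (k - 1)" using assms(3) less_exp[of "k - 1"] by linarith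
    also have "\<dots> \<le> p ^ (k - 1)" using assms(2) by (intro power_mono) auto
    finally show ?thesis .
  qed
  then have "k * p \<le> p ^ (k - 1) * p" by (rule mult_le_mono1)
  also have "\<dots> = p ^ k" using assms(3) by (metis power_minus_mult)
  finally have "real k * real p \<le> real (p ^ k)" by (metis of_nat_le_iff of_nat_mult)
  then have "1 - real (p ^ k) / real N \<le> 1 - real k * real p / real N"
    by (intro diff_left_mono divide_right_mono) auto
  also have "\<dots> = 1 + real k * (- real p / real N)" by simp
  also have "\<dots> \<le> (1 + (- real p / real N)) ^ k"
    using assms by (intro Bernoulli_inequality) (simp add: field_simps)
  finally show ?thesis by simp
qed

text \<open>The resonance argument in abstract form: the weighted mean of \<open>K * (f - G)\<close>
  is nonnegative, yet the integrand is at most \<open>- \<eta> * K\<close> where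
  \<open>\<bar>t\<bar> \<ge> Y\<close>. The excess must come from the interval of length
  \<open>2 * Y\<close>, where only the trivial bound \<open>f0 * K0\<close> is used;
  \<open>P\<close> bounds the mean of \<open>K\<close> from below.\<close>

lemma fejer_upper_bound:
  fixes f K :: "real \<Rightarrow> real"
  assumes T: "T > 0" and pos: "fejer_positive T (\<lambda>t. K t * (f t - G))" and K_pos: "fejer_positive T K"
    and K_diff: "fejer_positive T (\<lambda>t. K t - P)" and K_bounds: "\<And>t. 0 < K t" "\<And>t. K t \<le> K0"
    and f_even: "\<And>t. f (- t) = f t" and f_le: "\<And>t. f t \<le> f0" and f0: "f0 \<ge> 0"
    and Y: "0 < Y" "Y \<le> T" and \<eta>: "0 < \<eta>" "\<eta> \<le> G" and le: "\<And>t. t \<in> {Y..T} \<Longrightarrow> f t \<le> G - \<eta>"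
  shows "\<eta> * (T * P) \<le> 2 * Y * (f0 * K0)"
proof -
  let ?w = "\<lambda>t. 1 - \<bar>t\<bar> / T"
  have int: "(\<lambda>t. g t * ?w t) integrable_on {-T..T}" if "fejer_positive T g" for g
    using fejer_integrable[of T g 0] that by (simp add: fejer_positive_def)
  have int_pos: "0 \<le> integral {-T..T} (\<lambda>t. g t * ?w t)" if "fejer_positive T g" for g
    using that[unfolded fejer_positive_def, THEN conjunct2, rule_format, of 0] by simp
  have Y_int: "((\<lambda>t. if t \<in> {-Y..Y} then f0 * K0 else 0) has_integral (2 * Y * (f0 * K0))) {-T..T}"
    using has_integral_const_real[of "f0 * K0" "-Y" Y] Y
    by (subst has_integral_restrict) (auto simp: mult.commute)
  have "0 \<le> integral {-T..T} (\<lambda>t. K t * (f t - G) * ?w t)"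
    by (rule int_pos[OF pos])
  also have "\<dots> \<le> integral {-T..T} (\<lambda>t. - \<eta> * (K t * ?w t) + (if t \<in> {-Y..Y} then f0 * K0 else 0))"
  proof (rule integral_le)
    show "(\<lambda>t. - \<eta> * (K t * ?w t) + (if t \<in> {-Y..Y} then f0 * K0 else 0)) integrable_on {-T..T}"
      by (rule integrable_add[OF integrable_on_mult_right[OF int[OF K_pos]] has_integral_integrable[OF Y_int]])
    fix t assume t: "t \<in> {-T..T}"
    then have w: "0 \<le> ?w t" "?w t \<le> 1" using T by (auto simp: field_simps)
    note K = K_bounds[of t]
    have expand: "(x - G + \<eta>) * (k * v) = k * (x - G) * v + \<eta> * (k * v)" for x k v :: real
      by (simp add: algebra_simps)
    show "K t * (f t - G) * ?w t \<le> - \<eta> * (K t * ?w t) + (if t \<in> {-Y..Y} then f0 * K0 else 0)"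
    proof (cases "t \<in> {-Y..Y}")
      case True
      \<comment> \<open>Because \<open>\<eta> \<le> G\<close>, the shift by
        \<open>G - \<eta>\<close> only helps on the uncontrolled range.\<close>
      have "f t - G + \<eta> \<le> f0" using f_le[of t] \<eta> by linarith
      then have "(f t - G + \<eta>) * (K t * ?w t) \<le> f0 * (K t * ?w t)"
        using K w by (intro mult_right_mono) auto
      also have "\<dots> \<le> f0 * (K0 * 1)"
        using K w f0 by (intro mult_left_mono mult_mono) auto
      finally have "K t * (f t - G) * ?w t \<le> - \<eta> * (K t * ?w t) + f0 * K0"
        unfolding expand by simp
      then show ?thesis by (simp only: True if_True)
    next
      case False
      then have "\<bar>t\<bar> \<in> {Y..T}" using t by auto
      from le[OF this] have "f t \<le> G - \<eta>" using f_even[of t] by (cases "t \<ge> 0") auto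
      then have "(f t - G + \<eta>) * (K t * ?w t) \<le> 0 * (K t * ?w t)"
        using K w by (intro mult_right_mono) auto
      then have "K t * (f t - G) * ?w t \<le> - \<eta> * (K t * ?w t) + 0"
        unfolding expand by simp
      then show ?thesis by (simp only: False if_False)
    qed
  qed (rule int[OF pos])
  also have "\<dots> = - \<eta> * integral {-T..T} (\<lambda>t. K t * ?w t) + 2 * Y * (f0 * K0)"
    by (subst integral_add[OF integrable_on_mult_right[OF int[OF K_pos]] has_integral_integrable[OF Y_int]])
       (simp only: integral_mult_right integral_unique[OF Y_int])
  finally have *: "\<eta> * integral {-T..T} (\<lambda>t. K t * ?w t) \<le> 2 * Y * (f0 * K0)" by simp
  have "T * P \<le> integral {-T..T} (\<lambda>t. K t * ?w t)"
  proof -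
    have w_int: "((\<lambda>t. P * ?w t) has_integral P * T) {-T..T}"
      by (intro has_integral_mult_right fejer_integral_1 T)
    have "0 \<le> integral {-T..T} (\<lambda>t. (K t - P) * ?w t)" by (rule int_pos[OF K_diff])
    also have "(\<lambda>t. (K t - P) * ?w t) = (\<lambda>t. K t * ?w t - P * ?w t)"
      by (simp only: left_diff_distrib)
    also have "integral {-T..T} \<dots> = integral {-T..T} (\<lambda>t. K t * ?w t) - P * T"
      by (subst integral_diff[OF int[OF K_pos] has_integral_integrable[OF w_int]]) (simp only: integral_unique[OF w_int])
    finally show ?thesis by (simp add: mult.commute)
  qed
  then show ?thesis
    using * \<eta>(1) by (meson less_imp_le mult_left_mono order_trans)
qed

context
  fixes N :: nat and \<delta> T :: real
  assumes N: "N \<ge> 2" and \<delta>: "\<delta> > 0" and T: "T > 0"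
begin

private abbreviation "A \<equiv> {p. prime p \<and> p \<le> N}"
private abbreviation "r \<equiv> \<lambda>p. 1 - real p / real N"
private abbreviation "K \<equiv> resonator A r"
private abbreviation "f \<equiv> \<lambda>t. - Re (deriv zeta (1 + of_real \<delta> + \<i> * of_real t) / zeta (1 + of_real \<delta> + \<i> * of_real t))"
private abbreviation "G \<equiv> \<Sum>n=1..N. mangoldt n / real n powr (1 + \<delta>) * (1 - real n / real N)"

private lemma A: "finite A" and r: "\<And>p. p \<in> A \<Longrightarrow> 0 \<le> r p" "\<And>p. p \<in> A \<Longrightarrow> r p < 1"
  using N by (auto simp: prime_gt_0_nat)

private lemma resonator_bounds: "0 < K t" "K t \<le> (\<Prod>p\<in>A. 1 / (1 - r p)\<^sup>2)"
proof -
  note d = poisson_denominator[OF r]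
  show "0 < K t" unfolding resonator_def using d by (intro prod_pos) auto
  show "K t \<le> (\<Prod>p\<in>A. 1 / (1 - r p)\<^sup>2)"
    unfolding resonator_def
  proof (rule prod_mono, intro conjI)
    fix p assume p: "p \<in> A"
    then have "(1 - r p)\<^sup>2 > 0" using N by (auto simp: prime_gt_0_nat)
    then show "1 / (1 - 2 * r p * cos (ln (real p) * t) + (r p)\<^sup>2) \<le> 1 / (1 - r p)\<^sup>2"
      using d[OF p p] by (intro divide_left_mono mult_pos_pos) auto
    show "0 \<le> 1 / (1 - 2 * r p * cos (ln (real p) * t) + (r p)\<^sup>2)"
      using d(1)[OF p p] by (simp add: less_imp_le)
  qed
qed

text \<open>Both \<open>f\<close> and \<open>G\<close> are series with the same coefficients
  \<open>a n\<close>, the former weighted by \<open>cos (t * ln n)\<close>, the latter by the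
  truncated weight \<open>\<rho> n\<close>. Positivity is checked term by term, at prime powers
  only, and survives the absolutely convergent sum.\<close>

lemma resonance_positive:
  "fejer_positive T (\<lambda>t. K t * (f t - G))"
proof -
  define \<rho> where "\<rho> = (\<lambda>n :: nat. max 0 (1 - real n / real N))"
  define a where "a = (\<lambda>n. mangoldt n / real n powr (1 + \<delta>))"
  define C where "C = (\<Prod>p\<in>A. 1 / (1 - r p)\<^sup>2)"
  have a0: "a n \<ge> 0" for n by (simp add: a_def mangoldt_powr_nonneg)
  have suma: "summable a" unfolding a_def using \<delta> by (intro summable_mangoldt_div_powr) simp
  show ?thesis
  proof (rule fejer_positive_sums[of T "\<lambda>n t. a n * (K t * (cos (ln (real n) * t) - \<rho> n))" "\<lambda>n. a n * (C * 2)"])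
    fix n
    show "fejer_positive T (\<lambda>t. a n * (K t * (cos (ln (real n) * t) - \<rho> n)))"
    proof (cases "mangoldt n = (0 :: real)")
      case True
      then show ?thesis by (simp add: a_def fejer_positive_0)
    next
      case False
      then obtain p k where p: "prime p" "k > 0" "n = p ^ k" by (rule primepow_cases)
      show ?thesis
      proof (intro fejer_positive_cmult a0)
        show "fejer_positive T (\<lambda>t. K t * (cos (ln (real n) * t) - \<rho> n))"
        proof (cases "p \<le> N")
          case True
          have "\<rho> n \<le> r p ^ k"
            using Bernoulli_prime_power[OF True prime_ge_2_nat[OF p(1)] p(2)] p True N
            by (auto simp: \<rho>_def)
          then show ?thesis
            unfolding p(3) using p True prime_gt_0_nat[of p]
            by (intro fejer_positive_resonator_cos A r T) auto
        next
          case False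
          \<comment> \<open>The resonator has no factor at such a prime, but the weight
            \<open>\<rho> n\<close> is already 0, so multiplication by a plain cosine
            suffices.\<close>
          then have "N \<le> n" using p by (meson le_trans nat_le_linear self_le_power prime_ge_1_nat)
          then have "\<rho> n = 0" using N by (simp add: \<rho>_def)
          then show ?thesis
            by (simp only: diff_0_right) (intro fejer_positive_cos fejer_positive_resonator[OF A r T] subset_refl)
        qed
      qed
    qed
    fix t
    have "\<bar>cos (ln (real n) * t) - \<rho> n\<bar> \<le> 2"
    proof -
      have "0 \<le> \<rho> n" "\<rho> n \<le> 1" by (auto simp: \<rho>_def)
      then show ?thesis using cos_le_one[of "ln (real n) * t"] cos_ge_minus_one[of "ln (real n) * t"] by linarith
    qed
    then have "\<bar>K t\<bar> * \<bar>cos (ln (real n) * t) - \<rho> n\<bar> \<le> C * 2"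
      using resonator_bounds[of t] by (intro mult_mono) (auto simp: C_def)
    then show "\<bar>a n * (K t * (cos (ln (real n) * t) - \<rho> n))\<bar> \<le> a n * (C * 2)"
      using a0[of n] by (simp only: abs_mult abs_of_nonneg mult_left_mono)
  next
    fix t
    have "(\<lambda>n. a n * cos (ln (real n) * t)) sums f t"
      unfolding a_def by (rule log_deriv_zeta_shift_sums[OF \<delta>])
    moreover have "(\<lambda>n. a n * \<rho> n) sums (\<Sum>n=1..N. a n * \<rho> n)"
    proof (rule sums_finite)
      fix n assume "n \<notin> {1..N}"
      then have "n = 0 \<or> N < n" by auto
      then show "a n * \<rho> n = 0" using N by (auto simp: a_def \<rho>_def)
    qed simp
    ultimately have "(\<lambda>n. a n * cos (ln (real n) * t) - a n * \<rho> n) sums (f t - (\<Sum>n=1..N. a n * \<rho> n))"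
      by (rule sums_diff)
    also have "(\<Sum>n=1..N. a n * \<rho> n) = G"
      by (intro sum.cong) (auto simp: a_def \<rho>_def field_simps)
    finally have "(\<lambda>n. K t * (a n * cos (ln (real n) * t) - a n * \<rho> n)) sums (K t * (f t - G))"
      by (rule sums_mult)
    moreover have "K t * (x * y - x * z) = x * (K t * (y - z))" for x y z
      by (simp add: right_diff_distrib mult.left_commute)
    ultimately show "(\<lambda>n. a n * (K t * (cos (ln (real n) * t) - \<rho> n))) sums (K t * (f t - G))"
      by (simp only:)
  qed (use suma in \<open>auto intro: summable_mult2\<close>)
qed

text \<open>The final product is the peak of the resonator divided by the constant coefficient
  \<open>P\<close>: factor by factor,
  \<open>(1 - r\<^sup>2) / (1 - r)\<^sup>2 = (1 + r) / (1 - r)\<close> with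
  \<open>r = 1 - p/N\<close>.\<close>

lemma resonance_bound:
  assumes Y: "0 < Y" "Y \<le> T" and \<eta>: "0 < \<eta>" "\<eta> \<le> G" and le: "\<And>t. t \<in> {Y..T} \<Longrightarrow> f t \<le> G - \<eta>"
  shows "\<eta> * T \<le> 2 * Y * f 0 * (\<Prod>p\<in>A. (2 * real N - real p) / real p)"
proof -
  define K0 where "K0 = (\<Prod>p\<in>A. 1 / (1 - r p)\<^sup>2)"
  define P where "P = (\<Prod>p\<in>A. 1 / (1 - (r p)\<^sup>2))"
  have pos: "fejer_positive T (\<lambda>t. K t * (f t - G))" by (rule resonance_positive)
  have K_pos: "fejer_positive T K" by (rule fejer_positive_resonator[OF A r T subset_refl])
  have K_bounds: "0 < K t" "K t \<le> K0" for t using resonator_bounds unfolding K0_def by auto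
  have K_diff: "fejer_positive T (\<lambda>t. K t - P)"
    unfolding P_def by (rule fejer_positive_resonator_diff[OF A r T subset_refl])
  have a0: "mangoldt n / real n powr (1 + \<delta>) \<ge> 0" for n by (rule mangoldt_powr_nonneg)
  have f_even: "f (- t) = f t" for t
    using log_deriv_zeta_shift_sums[OF \<delta>, of t] log_deriv_zeta_shift_sums[OF \<delta>, of "- t"]
    by (simp add: sums_iff)
  have f_le: "f t \<le> f 0" for t
    using log_deriv_zeta_shift_sums[OF \<delta>, of t] log_deriv_zeta_shift_sums[OF \<delta>, of 0]
  proof (rule sums_le[rotated])
    fix n
    show "mangoldt n / real n powr (1 + \<delta>) * cos (ln (real n) * t) \<le> mangoldt n / real n powr (1 + \<delta>) * cos (ln (real n) * 0)"
      using mult_left_mono[OF cos_le_one[of "ln (real n) * t"] a0[of n]] by simp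
  qed
  have f0: "f 0 \<ge> 0"
    by (rule sums_le[OF _ sums_zero log_deriv_zeta_shift_sums[OF \<delta>, of 0]]) (use a0 in simp)
  have "\<eta> * (T * P) \<le> 2 * Y * (f 0 * K0)"
    using fejer_upper_bound[OF T pos K_pos K_diff K_bounds f_even f_le f0 Y \<eta> le] .
  moreover have P: "P > 0"
    unfolding P_def using r by (intro prod_pos ballI divide_pos_pos one_minus_square_pos) auto
  moreover have "K0 = P * (\<Prod>p\<in>A. (2 * real N - real p) / real p)"
    unfolding K0_def P_def prod.distrib[symmetric]
  proof (rule prod.cong)
    fix p assume p: "p \<in> A"
    have "1 - (r p)\<^sup>2 \<noteq> 0" using one_minus_square_pos[OF r(1)[OF p] r(2)[OF p]] by simp
    moreover have "1 - (r p)\<^sup>2 = (real p / real N) * ((2 * real N - real p) / real N)"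
      using N by (simp add: power2_eq_square field_simps)
    ultimately show "1 / (1 - r p)\<^sup>2 = 1 / (1 - (r p)\<^sup>2) * ((2 * real N - real p) / real p)"
      using N p by (auto simp: power2_eq_square field_simps)
  qed simp
  ultimately have "P * (\<eta> * T) \<le> P * (2 * Y * f 0 * (\<Prod>p\<in>A. (2 * real N - real p) / real p))"
    by (simp only: mult_ac)
  then show ?thesis using P by (simp only: mult_le_cancel_left_pos)
qed

end

section \<open>Chebyshev bounds and the cost and gain of the resonator\<close>

definition psi :: "nat \<Rightarrow> real" where
  "psi N = (\<Sum>n=1..N. mangoldt n)"

lemma psi_mono: "M \<le> N \<Longrightarrow> psi M \<le> psi N"
  unfolding psi_def by (rule sum_mono2) (auto simp: mangoldt_nonneg)

text \<open>Passing to \<open>Suc N\<close> raises \<open>N div d\<close> by one exactly at the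
  divisors of \<open>Suc N\<close>, whose von Mangoldt values add up to
  \<open>ln (Suc N)\<close>.\<close>

lemma ln_fact_mangoldt: "ln (fact N) = (\<Sum>d=1..N. mangoldt d * real (N div d))"
proof (induction N)
  case (Suc N)
  have "(\<Sum>d=1..Suc N. mangoldt d * real (Suc N div d)) =
        (\<Sum>d=1..Suc N. mangoldt d * real (N div d) + (if d dvd Suc N then mangoldt d else 0))"
    by (intro sum.cong refl) (auto simp: div_Suc dvd_eq_mod_eq_0 algebra_simps)
  also have "\<dots> = (\<Sum>d=1..N. mangoldt d * real (N div d)) + (\<Sum>d=1..Suc N. if d dvd Suc N then mangoldt d else 0)"
    by (subst sum.distrib) simp
  also have "(\<Sum>d=1..Suc N. if d dvd Suc N then mangoldt d else 0) = (\<Sum>d | d dvd Suc N. mangoldt d :: real)"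
    by (intro sum.mono_neutral_cong_right) (auto dest: dvd_imp_le intro!: Nat.gr0I simp: Suc_le_eq)
  also have "\<dots> = ln (real (Suc N))" by (subst mangoldt_sum) auto
  finally show ?case using Suc by (simp add: ln_mult)
qed simp

lemma ln_fact_mangoldt':
  assumes "N \<le> M" shows "ln (fact N) = (\<Sum>d=1..M. mangoldt d * real (N div d))"
  unfolding ln_fact_mangoldt
  by (rule sum.mono_neutral_left) (use assms in \<open>auto simp: not_le\<close>)

lemma ln_fact_Suc: "ln (fact (Suc n)) = ln (fact n) + ln (real (Suc n))"
  unfolding fact_Suc by (subst ln_mult) auto

lemma ln_fact_lower: "ln (fact n) \<ge> real n * ln (real n) - real n"
proof (induction n)
  case (Suc n)
  have "real n * (ln (real (Suc n)) - ln (real n)) \<le> 1"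
  proof (cases "n = 0")
    case False
    have "ln (real (Suc n)) - ln (real n) = ln (1 + 1 / real n)"
    proof -
      have "1 + 1 / real n = real (Suc n) / real n" using False by (simp add: field_simps)
      then show ?thesis using False by (simp add: ln_div)
    qed
    also have "\<dots> \<le> 1 / real n" by (intro ln_add_one_self_le_self) auto
    finally show ?thesis using False by (simp add: field_simps)
  qed simp
  then show ?case using Suc unfolding ln_fact_Suc by (simp add: algebra_simps)
qed simp

lemma ln_fact_upper: "n > 0 \<Longrightarrow> ln (fact n) \<le> real n * ln (real n) - real n + 1 + ln (real n)"
proof (induction n rule: nat_induct_non_zero)
  case (Suc n)
  have "(real n + 1) * (ln (real n) - ln (real (Suc n))) \<le> - 1"
  proof -
    have "ln (real n) - ln (real (Suc n)) = ln (real n / real (Suc n))"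
      using Suc(1) by (subst ln_div) auto
    also have "\<dots> \<le> real n / real (Suc n) - 1" using Suc(1) by (intro ln_le_minus_one) auto
    also have "\<dots> = - 1 / (real n + 1)" by (simp add: field_simps)
    finally show ?thesis by (simp add: field_simps)
  qed
  then show ?case using Suc unfolding ln_fact_Suc by (simp add: algebra_simps)
qed simp

lemma x_ln_x_mono:
  fixes x y :: real
  assumes "1 \<le> x" "x \<le> y" shows "x * ln x - x \<le> y * ln y - y"
proof -
  have "ln x - ln y = ln (x / y)" using assms by (subst ln_div) auto
  also have "\<dots> \<le> x / y - 1" using assms by (intro ln_le_minus_one) auto
  finally have "y * (ln x - ln y) \<le> y * (x / y - 1)" using assms by (intro mult_left_mono) auto
  then have 1: "y * ln x - y * ln y \<le> x - y" using assms by (simp add: algebra_simps)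
  have "x * ln x \<le> y * ln x" using assms by (intro mult_right_mono) auto
  with 1 show ?thesis by simp
qed

text \<open>The main term is taken at the unrounded quotient \<open>N / k\<close>, so that linear
  combinations over several \<open>k\<close> cancel exactly; the rounding costs only a
  logarithm.\<close>

lemma ln_fact_div_lower:
  assumes "k > 0" "N > 0"
  shows "ln (fact (N div k)) \<ge> real N / real k * ln (real N / real k) - real N / real k - ln (real N + 1)"
proof -
  define m x where "m = N div k" and "x = real N / real k"
  have "N < (m + 1) * k" using assms(1) by (simp add: m_def dividend_less_div_times add.commute)
  then have "real N < real ((m + 1) * k)" by (simp only: of_nat_less_iff)
  then have mx: "x < real m + 1" using assms by (simp add: x_def field_simps)
  have m_le: "m \<le> N" by (simp add: m_def)
  have x0: "x > 0" using assms by (simp add: x_def)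
  show ?thesis unfolding m_def[symmetric] x_def[symmetric]
  proof (cases "x \<ge> 1")
    case True
    have "x * ln x - x \<le> real (Suc m) * ln (real (Suc m)) - real (Suc m)"
      using True mx by (intro x_ln_x_mono) auto
    also have "\<dots> \<le> ln (fact (Suc m))" by (rule ln_fact_lower)
    also have "\<dots> = ln (fact m) + ln (real m + 1)" by (simp add: ln_mult add.commute)
    also have "ln (real m + 1) \<le> ln (real N + 1)" using m_le by simp
    finally show "ln (fact m) \<ge> x * ln x - x - ln (real N + 1)" by simp
  next
    case False
    have "x * ln x \<le> 0" using False x0 by (simp add: mult_nonneg_nonpos)
    moreover have "ln (fact m) \<ge> (0::real)" by simp
    moreover have "ln (real N + 1) \<ge> 0" by simp
    ultimately show "ln (fact m) \<ge> x * ln x - x - ln (real N + 1)" using x0 by linarith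
  qed
qed

lemma ln_fact_div_upper:
  assumes "k > 0" "N > 0"
  shows "ln (fact (N div k)) \<le> real N / real k * ln (real N / real k) - real N / real k + 2 + ln (real N + 1)"
proof -
  define m x where "m = N div k" and "x = real N / real k"
  have mx: "real m \<le> x" using assms(1) of_nat_div_le_of_nat[of N k, where ?'a = real] by (simp add: m_def x_def)
  have m_le: "m \<le> N" by (simp add: m_def)
  have x0: "x > 0" using assms by (simp add: x_def)
  show ?thesis unfolding m_def[symmetric] x_def[symmetric]
  proof (cases "m = 0")
    case False
    then have "ln (fact m) \<le> real m * ln (real m) - real m + 1 + ln (real m)" by (intro ln_fact_upper) simp
    also have "real m * ln (real m) - real m \<le> x * ln x - x" using False mx by (intro x_ln_x_mono) auto
    also have "ln (real m) \<le> ln (real N + 1)" using m_le False by simp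
    finally show "ln (fact m) \<le> x * ln x - x + 2 + ln (real N + 1)" by simp
  next
    case True
    have "ln (1 / x) \<le> 1 / x - 1" using x0 by (intro ln_le_minus_one) auto
    then have "- ln x \<le> 1 / x - 1" using x0 by (simp add: ln_div)
    then have "x * (- ln x) \<le> x * (1 / x - 1)" using x0 by (intro mult_left_mono) auto
    then have "- (x * ln x) \<le> 1 - x" using x0 by (simp add: algebra_simps)
    then show "ln (fact m) \<le> x * ln x - x + 2 + ln (real N + 1)" using True by simp
  qed
qed

text \<open>
  Chebyshev's combination: in the resulting estimate for \<open>psi N - psi (N div 6)\<close> the main terms of the
  factorials cancel, since \<open>1 - 1/2 - 1/3 - 1/5 + 1/30 = 0\<close>.
\<close>

lemma chebyshev_weight:
  fixes m :: nat
  shows "int m - int (m div 2) - int (m div 3) - int (m div 5) + int (m div 30) \<ge> 0"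
    and "1 \<le> m \<Longrightarrow> m \<le> 5 \<Longrightarrow> int m - int (m div 2) - int (m div 3) - int (m div 5) + int (m div 30) = 1"
proof -
  let ?w = "\<lambda>m :: nat. int m - int (m div 2) - int (m div 3) - int (m div 5) + int (m div 30)"
  define q r where "q = m div 30" and "r = m mod 30"
  have m: "m = 2 * (15 * q) + r" "m = 3 * (10 * q) + r" "m = 5 * (6 * q) + r" "m = 30 * q + r"
    by (simp_all add: q_def r_def)
  have "m div 2 = 15 * q + r div 2" by (subst m(1)) simp
  moreover have "m div 3 = 10 * q + r div 3" by (subst m(2)) simp
  moreover have "m div 5 = 6 * q + r div 5" by (subst m(3)) simp
  moreover have "m div 30 = q + r div 30" by (subst m(4)) simp
  ultimately have "?w m = ?w r" using m(4) by simp
  moreover have "\<forall>r\<in>set [0..<30]. ?w r \<ge> 0" by (simp add: upt_rec)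
  moreover have "r \<in> set [0..<30]" by (simp add: r_def)
  ultimately show "?w m \<ge> 0" by metis
  assume "1 \<le> m" "m \<le> 5"
  then have "m \<in> {1, 2, 3, 4, 5}" by auto
  then show "?w m = 1" by auto
qed

lemma ln_2_bounds: "693 / 1000 \<le> ln (2::real)" "ln (2::real) \<le> 6932 / 10000"
  using ln_approx_bounds[of 2 3, simplified, simplified eval_nat_numeral, simplified]
  by (simp_all add: power_divide)

lemma ln_numeral_le_ln_2:
  fixes x y k l :: nat
  assumes "x ^ k \<le> y ^ l" "k > 0" "x > 0" "y > 0"
  shows "ln (real x) \<le> real l / real k * ln (real y)"
proof -
  have "ln (real (x ^ k)) \<le> ln (real (y ^ l))" using assms
    by (intro ln_le_cancel_iff[THEN iffD2]) (auto simp only: of_nat_le_iff of_nat_0_less_iff zero_less_power)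
  then show ?thesis using assms by (simp add: ln_realpow field_simps)
qed

text \<open>Chebyshev's weight is nonnegative everywhere and equals 1 when \<open>N div d\<close> is
  between 1 and 5, that is for \<open>N div 6 < d \<le> N\<close>. The von Mangoldt sum over that
  range is therefore at most the combination of factorials.\<close>

lemma psi_diff_bound:
  assumes N: "N > 0"
  shows "psi N - psi (N div 6) \<le> 9235 / 10000 * real N + 5 * ln (real N + 1) + 4"
proof -
  define g where "g = (\<lambda>m. real_of_int (int m - int (m div 2) - int (m div 3) - int (m div 5) + int (m div 30)))"
  have g0: "g m \<ge> 0" for m using chebyshev_weight(1)[of m] unfolding g_def by (simp only: of_int_0_le_iff)
  have g1: "g m = 1" if "1 \<le> m" "m \<le> 5" for m using chebyshev_weight(2)[OF that] unfolding g_def by (simp only: of_int_1)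
  have split: "psi N = psi (N div 6) + (\<Sum>d\<in>{N div 6<..N}. mangoldt d)"
    unfolding psi_def by (subst sum.union_disjoint[symmetric]) (auto intro!: sum.cong)
  have "(\<Sum>d\<in>{N div 6<..N}. mangoldt d) = (\<Sum>d\<in>{N div 6<..N}. mangoldt d * g (N div d))"
  proof (intro sum.cong refl)
    fix d assume d: "d \<in> {N div 6<..N}"
    then have "d > 0" by (cases d) auto
    have "N div d \<ge> 1" using d \<open>d > 0\<close> by (simp add: div_greater_zero_iff Suc_le_eq)
    moreover have "N div d < 6"
    proof -
      have "N < d * 6" using d by (simp add: div_less_iff_less_mult)
      then show ?thesis using \<open>d > 0\<close> by (simp add: div_less_iff_less_mult mult.commute)
    qed
    ultimately have "g (N div d) = 1" by (intro g1) linarith+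
    then show "mangoldt d = mangoldt d * g (N div d)" by simp
  qed
  also have "\<dots> \<le> (\<Sum>d=1..N. mangoldt d * g (N div d))"
    by (intro sum_mono2) (auto simp: g0 mangoldt_nonneg intro!: mult_nonneg_nonneg)
  also have "\<dots> = ln (fact N) - ln (fact (N div 2)) - ln (fact (N div 3)) - ln (fact (N div 5)) + ln (fact (N div 30))"
  proof -
    have L: "ln (fact (N div k)) = (\<Sum>d=1..N. mangoldt d * real (N div d div k))" for k
      by (subst ln_fact_mangoldt'[of _ N]) (auto simp: div_mult2_eq[symmetric] mult.commute)
    have "ln (fact N) = (\<Sum>d=1..N. mangoldt d * real (N div d))" by (rule ln_fact_mangoldt)
    then show ?thesis
      unfolding L sum_subtractf[symmetric] sum.distrib[symmetric]
      by (simp only: sum_subtractf[symmetric] sum.distrib[symmetric]) (auto intro!: sum.cong simp: g_def algebra_simps)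
  qed
  also have "\<dots> \<le> real N * (ln 2 / 2 + ln 3 / 3 + ln 5 / 5 - ln 30 / 30) + 5 * ln (real N + 1) + 4"
  proof -
    have *: "ln (real N / k) = ln (real N) - ln k" if "k > 0" for k using that N by (simp add: ln_div)
    have "ln (fact N) \<le> real N * ln (real N) - real N + 2 + ln (real N + 1)"
      using ln_fact_div_upper[of 1 N] N by simp
    moreover have "ln (fact (N div 30)) \<le> real N / 30 * (ln (real N) - ln 30) - real N / 30 + 2 + ln (real N + 1)"
      using ln_fact_div_upper[of 30 N] N by (simp add: *)
    moreover have "ln (fact (N div 2)) \<ge> real N / 2 * (ln (real N) - ln 2) - real N / 2 - ln (real N + 1)"
      using ln_fact_div_lower[of 2 N] N by (simp add: *)
    moreover have "ln (fact (N div 3)) \<ge> real N / 3 * (ln (real N) - ln 3) - real N / 3 - ln (real N + 1)"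
      using ln_fact_div_lower[of 3 N] N by (simp add: *)
    moreover have "ln (fact (N div 5)) \<ge> real N / 5 * (ln (real N) - ln 5) - real N / 5 - ln (real N + 1)"
      using ln_fact_div_lower[of 5 N] N by (simp add: *)
    ultimately show ?thesis by (simp add: algebra_simps)
  qed
  \<comment> \<open>Chebyshev's constant, about 0.9213. The bounds come from
    \<open>3 ^ 17 \<le> 2 ^ 27\<close> and \<open>5 ^ 3 \<le> 2 ^ 7\<close>.\<close>
  also have "ln 2 / 2 + ln 3 / 3 + ln 5 / 5 - ln 30 / 30 \<le> (9235 / 10000 :: real)"
  proof -
    have "ln (30::real) = ln 2 + ln 3 + ln 5" using ln_mult[of 6 5] ln_mult[of 2 3] by simp
    moreover have "ln (3::real) \<le> 27 / 17 * ln 2" using ln_numeral_le_ln_2[of 3 17 2 27] by simp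
    moreover have "ln (5::real) \<le> 7 / 3 * ln 2" using ln_numeral_le_ln_2[of 5 3 2 7] by simp
    ultimately show ?thesis using ln_2_bounds by linarith
  qed
  finally show ?thesis using split by (simp add: mult.commute mult_right_mono)
qed

text \<open>Iteration of the previous estimate along \<open>N\<close>, \<open>N div 6\<close>, and
  so on. Beyond \<open>N0\<close> the logarithms cost at most 0.001, and the induction closes
  because \<open>0.9235 + 0.001 + 1.11 / 6 \<le> 1.11\<close>.\<close>

lemma psi_bound: "\<exists>C\<ge>0. \<forall>N. psi N \<le> 111 / 100 * real N + C"
proof -
  have "((\<lambda>x::real. (5 * ln (x + 1) + 4) / x) \<longlongrightarrow> 0) at_top" by real_asymp
  then have "\<forall>\<^sub>F x in at_top. (5 * ln (x + 1) + 4) / x < (1 / 1000 :: real)"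
    by (rule order_tendstoD) simp
  then have "\<forall>\<^sub>F N in sequentially. (5 * ln (real N + 1) + 4) / real N < 1 / 1000"
    by (rule eventually_compose_filterlim[OF _ filterlim_real_sequentially])
  then obtain N0 where N0: "\<And>N. N \<ge> N0 \<Longrightarrow> (5 * ln (real N + 1) + 4) / real N < 1 / 1000"
    by (auto simp: eventually_sequentially)
  have "psi N \<le> 111 / 100 * real N + psi (Suc N0)" for N
  proof (induction N rule: less_induct)
    case (less N)
    show ?case
    proof (cases "N \<le> N0")
      case True
      then show ?thesis using psi_mono[of N "Suc N0"] by simp
    next
      case False
      have "psi N \<le> psi (N div 6) + 9235 / 10000 * real N + 5 * ln (real N + 1) + 4"
        using psi_diff_bound[of N] False by simp
      also have "5 * ln (real N + 1) + 4 \<le> 1 / 1000 * real N"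
        using N0[of N] False by (simp add: field_simps)
      moreover have "psi (N div 6) \<le> 111 / 100 * real (N div 6) + psi (Suc N0)"
        using False by (intro less.IH) simp
      moreover have "real (N div 6) \<le> real N / 6" using of_nat_div_le_of_nat[of N 6, where ?'a = real] by simp
      ultimately show ?thesis by simp
    qed
  qed
  moreover have "psi (Suc N0) \<ge> 0" by (simp add: psi_def sum_nonneg mangoldt_nonneg)
  ultimately show ?thesis by blast
qed

text \<open>Follows from \<open>ln (fact N)\<close> by dropping the integer parts. Compared with the
  true size \<open>ln N - euler_mascheroni + o(1)\<close> it loses
  \<open>1 - euler_mascheroni\<close>, which the final margin affords.\<close>

lemma sum_mangoldt_over_n: "N > 0 \<Longrightarrow> (\<Sum>n=1..N. mangoldt n / real n) \<ge> ln (real N) - 1"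
proof -
  assume N: "N > 0"
  have "real N * (\<Sum>n=1..N. mangoldt n / real n) \<ge> ln (fact N)"
    unfolding ln_fact_mangoldt sum_distrib_left
  proof (rule sum_mono)
    fix d
    have "mangoldt d * real (N div d) \<le> mangoldt d * (real N / real d)"
      using of_nat_div_le_of_nat[of N d, where ?'a = real] by (intro mult_left_mono mangoldt_nonneg) simp
    then show "mangoldt d * real (N div d) \<le> real N * (mangoldt d / real d)" by (simp add: mult_ac)
  qed
  then have "real N * (\<Sum>n=1..N. mangoldt n / real n) \<ge> real N * (ln (real N) - 1)"
    using ln_fact_lower[of N] by (simp add: algebra_simps)
  then show ?thesis using N by simp
qed

section \<open>Cost and gain of the resonator\<close>

text \<open>Summation by parts from a one-sided bound on the partial sums: their excess
  \<open>E n\<close> over \<open>a * n + C\<close> is nonpositive, and it meets only decrements of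
  \<open>F\<close> and the last value \<open>F N\<close>. The induction therefore carries the term
  \<open>E n * F n\<close>.\<close>

lemma abel_summation_decreasing:
  fixes b F :: "nat \<Rightarrow> real"
  assumes B: "\<And>n. (\<Sum>i=1..n. b i) \<le> a * real n + C"
    and N: "N \<ge> 1" and dec: "\<And>n. 1 \<le> n \<Longrightarrow> n < N \<Longrightarrow> F (Suc n) \<le> F n" and F0: "F N \<ge> 0"
  shows "(\<Sum>n=1..N. b n * F n) \<le> a * (\<Sum>n=1..N. F n) + C * F 1"
proof -
  define E where "E = (\<lambda>n. (\<Sum>i=1..n. b i) - a * real n - C)"
  have E: "E n \<le> 0" for n using B[of n] by (simp add: E_def)
  have "n \<le> N \<Longrightarrow> (\<Sum>i=1..n. b i * F i) \<le> a * (\<Sum>i=1..n. F i) + C * F 1 + E n * F n" if "n \<ge> 1" for n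
    using that
  proof (induction n rule: nat_induct_at_least)
    case base
    then show ?case by (simp add: E_def algebra_simps)
  next
    case (Suc n)
    have "E n * F n \<le> E n * F (Suc n)"
      using dec[of n] E[of n] Suc by (intro mult_left_mono_neg) auto
    moreover have E_Suc: "E (Suc n) = E n + b (Suc n) - a" using Suc by (simp add: E_def algebra_simps)
    have "E (Suc n) * F (Suc n) = E n * F (Suc n) + b (Suc n) * F (Suc n) - a * F (Suc n)"
      unfolding E_Suc by (simp only: left_diff_distrib distrib_right)
    ultimately show ?case using Suc by (simp add: algebra_simps)
  qed
  from this[OF N] have "(\<Sum>n=1..N. b n * F n) \<le> a * (\<Sum>n=1..N. F n) + C * F 1 + E N * F N" by simp
  moreover have "E N * F N \<le> 0" using E[of N] F0 by (rule mult_nonpos_nonneg)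
  ultimately show ?thesis by linarith
qed

text \<open>The product of the ratios is the binomial coefficient
  \<open>(2 * N - 1) choose N\<close>. This is the origin of the \<open>ln 4\<close> in
  \<open>C1\<close>.\<close>

lemma sum_ln_ratio_le:
  assumes N: "N \<ge> 1"
  shows "(\<Sum>n=1..N. ln ((2 * real N - real n) / real n)) \<le> real N * ln 4"
proof -
  have "(\<Sum>n=1..N. ln ((2 * real N - real n) / real n)) = ln (\<Prod>n=1..N. (2 * real N - real n) / real n)"
    by (rule ln_prod[symmetric]) (auto intro!: divide_pos_pos)
  also have "(\<Prod>n=1..N. (2 * real N - real n) / real n) = real ((2 * N - 1) choose N)"
  proof -
    have "real ((2 * N - 1) choose N) = real (2 * N - 1) gchoose N" by (simp add: binomial_gbinomial)
    also have "\<dots> = (\<Prod>i = 0..<N. real (2 * N - 1) - real i) / fact N" by (rule gbinomial_prod_rev)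
    also have "(\<Prod>i = 0..<N. real (2 * N - 1) - real i) = (\<Prod>n=1..N. 2 * real N - real n)"
      by (rule prod.reindex_bij_witness[of _ "\<lambda>n. n - 1" Suc]) (use N in \<open>auto simp: of_nat_diff\<close>)
    also have "fact N = (\<Prod>n=1..N. real n)" by (simp add: fact_prod)
    finally show ?thesis by (simp add: prod_dividef)
  qed
  also have "ln (real ((2 * N - 1) choose N)) \<le> ln (4 ^ N)"
  proof (subst ln_le_cancel_iff)
    have "(2 * N - 1) choose N \<le> 2 ^ (2 * N - 1)" by (rule binomial_le_pow2)
    also have "\<dots> \<le> 2 ^ (2 * N)" by (rule power_increasing) auto
    also have "\<dots> = 4 ^ N" by (simp add: power_mult)
    finally show "real ((2 * N - 1) choose N) \<le> 4 ^ N" by (metis of_nat_le_iff of_nat_numeral of_nat_power)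
    show "real ((2 * N - 1) choose N) > 0" using N by (simp add: zero_less_binomial_iff)
  qed simp
  finally show ?thesis by (simp add: ln_realpow)
qed

lemma ln_ratio_bounds:
  fixes N n :: nat
  assumes "1 \<le> n" "n \<le> N"
  shows "0 \<le> ln ((2 * real N - real n) / real n)" "ln ((2 * real N - real n) / real n) \<le> ln (2 * real N)"
proof -
  have "1 \<le> (2 * real N - real n) / real n" using assms by (simp add: field_simps)
  then show "0 \<le> ln ((2 * real N - real n) / real n)" by simp
  have "(2 * real N - real n) / real n \<le> (2 * real N) / 1"
    using assms by (intro frac_le) auto
  then show "ln ((2 * real N - real n) / real n) \<le> ln (2 * real N)"
    using assms by (subst ln_le_cancel_iff) (auto intro!: divide_pos_pos)
qed

lemma sum_mangoldt_ln_ratio: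
  assumes C: "\<And>n. psi n \<le> a * real n + C" "C \<ge> 0" "a \<ge> 0" and N: "N \<ge> 1"
  shows "(\<Sum>n=1..N. mangoldt n * ln ((2 * real N - real n) / real n)) \<le> a * (real N * ln 4) + C * ln (2 * real N)"
proof -
  let ?F = "\<lambda>n. ln ((2 * real N - real n) / real n)"
  have "(\<Sum>n=1..N. mangoldt n * ?F n) \<le> a * (\<Sum>n=1..N. ?F n) + C * ?F 1"
  proof (rule abel_summation_decreasing[OF C(1)[unfolded psi_def] N])
    fix n :: nat assume n: "1 \<le> n" "n < N"
    have "(2 * real N - real (Suc n)) / real (Suc n) \<le> (2 * real N - real n) / real n"
      using n by (intro frac_le) auto
    then show "?F (Suc n) \<le> ?F n" using n by (subst ln_le_cancel_iff) (auto intro!: divide_pos_pos)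
  qed (use ln_ratio_bounds[of N N] N in auto)
  also have "\<dots> \<le> a * (real N * ln 4) + C * ln (2 * real N)"
    using ln_ratio_bounds(2)[of 1 N] N C by (intro add_mono mult_left_mono sum_ln_ratio_le) auto
  finally show ?thesis .
qed

text \<open>Primes up to \<open>y\<close> are merely counted; above \<open>y\<close> a factor
  \<open>ln p / ln y \<ge> 1\<close> is inserted, which turns the sum over primes into one over the
  von Mangoldt function.\<close>

lemma prime_sum_ln_ratio:
  assumes C: "\<And>n. psi n \<le> a * real n + C" "C \<ge> 0" "a \<ge> 0" and N: "N \<ge> 1" and y: "y > 1"
  shows "(\<Sum>p | prime p \<and> p \<le> N. ln ((2 * real N - real p) / real p))
      \<le> y * ln (2 * real N) + (a * (real N * ln 4) + C * ln (2 * real N)) / ln y"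
proof -
  let ?F = "\<lambda>n. ln ((2 * real N - real n) / real n)"
  let ?A = "{p. prime p \<and> p \<le> N}"
  have fin: "finite ?A" by simp
  have ge1: "1 \<le> p" if "p \<in> ?A" for p using that prime_ge_1_nat by auto
  have "(\<Sum>p\<in>?A. ?F p) = (\<Sum>p\<in>{p\<in>?A. real p \<le> y}. ?F p) + (\<Sum>p\<in>{p\<in>?A. \<not> real p \<le> y}. ?F p)"
    using fin by (subst sum.union_disjoint[symmetric]) (auto intro!: sum.cong)
  also have "(\<Sum>p\<in>{p\<in>?A. real p \<le> y}. ?F p) \<le> real (card {p\<in>?A. real p \<le> y}) * ln (2 * real N)"
  proof (rule sum_bounded_above)
    fix p assume "p \<in> {p\<in>?A. real p \<le> y}"
    then show "?F p \<le> ln (2 * real N)" using ge1 by (intro ln_ratio_bounds(2)) auto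
  qed
  also have "\<dots> \<le> y * ln (2 * real N)"
  proof (intro mult_right_mono)
    have "{p\<in>?A. real p \<le> y} \<subseteq> {1..nat \<lfloor>y\<rfloor>}" using ge1 by (auto simp: le_nat_floor)
    then have "card {p\<in>?A. real p \<le> y} \<le> card {1..nat \<lfloor>y\<rfloor>}" by (intro card_mono) auto
    also have "\<dots> = nat \<lfloor>y\<rfloor>" by simp
    finally have "real (card {p\<in>?A. real p \<le> y}) \<le> real (nat \<lfloor>y\<rfloor>)" by (simp only: of_nat_le_iff)
    also have "\<dots> \<le> y" using y by simp
    finally show "real (card {p\<in>?A. real p \<le> y}) \<le> y" .
  qed (use N in simp)
  also have "(\<Sum>p\<in>{p\<in>?A. \<not> real p \<le> y}. ?F p) \<le> (a * (real N * ln 4) + C * ln (2 * real N)) / ln y"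
  proof -
    have lny: "ln y > 0" using y by simp
    have "(\<Sum>p\<in>{p\<in>?A. \<not> real p \<le> y}. ?F p) * ln y \<le> (\<Sum>p\<in>{p\<in>?A. \<not> real p \<le> y}. mangoldt p * ?F p)"
      unfolding sum_distrib_right
    proof (rule sum_mono)
      fix p assume p: "p \<in> {p\<in>?A. \<not> real p \<le> y}"
      then have "ln y \<le> ln (real p)" using y by simp
      then have "?F p * ln y \<le> ?F p * ln (real p)"
        using p ge1 by (intro mult_left_mono ln_ratio_bounds) auto
      then show "?F p * ln y \<le> mangoldt p * ?F p" using p by (simp add: mult.commute)
    qed
    also have "\<dots> \<le> (\<Sum>n=1..N. mangoldt n * ?F n)"
      using ge1 by (intro sum_mono2) (auto intro!: mult_nonneg_nonneg mangoldt_nonneg ln_ratio_bounds)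
    also have "\<dots> \<le> a * (real N * ln 4) + C * ln (2 * real N)"
      by (rule sum_mangoldt_ln_ratio[OF C N])
    finally show ?thesis using lny by (simp add: pos_le_divide_eq)
  qed
  finally show ?thesis by simp
qed

lemma resonator_cost:
  "\<forall>\<^sub>F N in sequentially. (\<Sum>p | prime p \<and> p \<le> N. ln ((2 * real N - real p) / real p))
      \<le> 1115 / 1000 * ln 4 * real N / ln (real N)"
proof -
  obtain C where C: "C \<ge> 0" "\<And>N. psi N \<le> 111 / 100 * real N + C" using psi_bound by blast
  \<comment> \<open>The cut \<open>y = N powr 0.999\<close> makes the small primes negligible and
    raises 1.11 only to \<open>1.11 / 0.999\<close>, about 1.1111, which leaves room below
    1.115.\<close>
  have "((\<lambda>x::real. (x powr (999 / 1000) * ln (2 * x) + (111 / 100 * (x * ln 4) + C * ln (2 * x)) / ln (x powr (999 / 1000)))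
            / (ln 4 * x / ln x)) \<longlongrightarrow> 1110 / 999) at_top"
    by real_asymp
  then have "\<forall>\<^sub>F x in at_top. (x powr (999 / 1000) * ln (2 * x) + (111 / 100 * (x * ln 4) + C * ln (2 * x)) / ln (x powr (999 / 1000)))
            / (ln 4 * x / ln x) < 1115 / 1000"
    by (rule order_tendstoD) simp
  then have "\<forall>\<^sub>F N in sequentially. (real N powr (999 / 1000) * ln (2 * real N) + (111 / 100 * (real N * ln 4) + C * ln (2 * real N)) / ln (real N powr (999 / 1000)))
            / (ln 4 * real N / ln (real N)) < 1115 / 1000"
    by (rule eventually_compose_filterlim[OF _ filterlim_real_sequentially])
  with eventually_gt_at_top[of 1] show ?thesis
  proof eventually_elim
    case (elim N)
    have "ln (real N) > 0" using elim by simp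
    then have pos: "ln 4 * real N / ln (real N) > 0" using elim by (intro divide_pos_pos mult_pos_pos) auto
    have "(\<Sum>p | prime p \<and> p \<le> N. ln ((2 * real N - real p) / real p))
      \<le> real N powr (999 / 1000) * ln (2 * real N) + (111 / 100 * (real N * ln 4) + C * ln (2 * real N)) / ln (real N powr (999 / 1000))"
      using elim C by (intro prime_sum_ln_ratio) (auto intro!: gr_one_powr)
    also have "\<dots> \<le> 1115 / 1000 * (ln 4 * real N / ln (real N))"
      using elim(2) unfolding pos_divide_less_eq[OF pos] by (rule less_imp_le)
    finally show ?case by simp
  qed
qed

text \<open>For \<open>\<delta> = 0\<close> the sum is that of \<open>mangoldt n / n\<close> minus
  \<open>psi N / N\<close>, hence the separate losses 1 and \<open>a\<close>. The shift is paid
  uniformly by \<open>n powr (- \<delta>) \<ge> 1 - \<delta> * ln N\<close>.\<close>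

lemma resonator_gain:
  assumes C: "\<And>n. psi n \<le> a * real n + C" and N: "N \<ge> 1" and \<delta>: "0 \<le> \<delta>" "\<delta> * ln (real N) \<le> 1"
    and pos: "ln (real N) - 1 - a - C / real N \<ge> 0"
  shows "(\<Sum>n=1..N. mangoldt n / real n powr (1 + \<delta>) * (1 - real n / real N))
          \<ge> (1 - \<delta> * ln (real N)) * (ln (real N) - 1 - a - C / real N)"
proof -
  have "(\<Sum>n=1..N. mangoldt n / real n * (1 - real n / real N)) = (\<Sum>n=1..N. mangoldt n / real n) - psi N / real N"
    unfolding psi_def sum_divide_distrib sum_subtractf[symmetric]
    by (intro sum.cong refl) (auto simp: field_simps)
  moreover have "psi N / real N \<le> a + C / real N" using C[of N] N by (simp add: field_simps)
  ultimately have "ln (real N) - 1 - a - C / real N \<le> (\<Sum>n=1..N. mangoldt n / real n * (1 - real n / real N))"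
    using sum_mangoldt_over_n[of N] N by simp
  then have "(1 - \<delta> * ln (real N)) * (ln (real N) - 1 - a - C / real N)
      \<le> (1 - \<delta> * ln (real N)) * (\<Sum>n=1..N. mangoldt n / real n * (1 - real n / real N))"
    using \<delta> by (intro mult_left_mono) auto
  also have "\<dots> \<le> (\<Sum>n=1..N. mangoldt n / real n powr (1 + \<delta>) * (1 - real n / real N))"
    unfolding sum_distrib_left
  proof (rule sum_mono)
    fix n assume n: "n \<in> {1..N}"
    have "1 - \<delta> * ln (real N) \<le> 1 - \<delta> * ln (real n)" using n \<delta> by (intro diff_left_mono mult_left_mono) auto
    also have "\<dots> \<le> exp (- \<delta> * ln (real n))" using exp_ge_add_one_self[of "- \<delta> * ln (real n)"] by simp
    also have "\<dots> = 1 / real n powr \<delta>" using n by (simp add: powr_def exp_minus divide_inverse)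
    finally have "(1 - \<delta> * ln (real N)) * (mangoldt n / real n * (1 - real n / real N))
       \<le> 1 / real n powr \<delta> * (mangoldt n / real n * (1 - real n / real N))"
      using n by (intro mult_right_mono mult_nonneg_nonneg divide_nonneg_nonneg mangoldt_nonneg) auto
    also have "\<dots> = mangoldt n / real n powr (1 + \<delta>) * (1 - real n / real N)"
      using n by (simp add: powr_add)
    finally show "(1 - \<delta> * ln (real N)) * (mangoldt n / real n * (1 - real n / real N))
       \<le> mangoldt n / real n powr (1 + \<delta>) * (1 - real n / real N)" .
  qed
  finally show ?thesis .
qed

section \<open>Large values\<close>

text \<open>The primes up to 11 with exponents 2 to 9 already give 0.67 of a total of about 0.755.
  Since \<open>infsum\<close> is 0 on a family that is not summable, both summations have to be
  shown convergent first; the outer one is compared with a geometric series through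
  \<open>g_le\<close>.\<close>

lemma prime_power_log_sum_ge:
  "(\<Sum>\<^sub>\<infinity>k\<in>{2::nat..}. \<Sum>\<^sub>\<infinity>p\<in>{p::nat. prime p}. ln (real p) / real p ^ k) \<ge> 67 / 100"
proof -
  let ?P = "{p::nat. prime p}"
  define g where "g = (\<lambda>k. \<Sum>\<^sub>\<infinity>p\<in>?P. ln (real p) / real p ^ k)"
  have term0: "ln (real p) / real p ^ k \<ge> 0" if "p \<in> ?P" for p k
    using that prime_ge_1_nat by (intro divide_nonneg_nonneg) auto
  have le2: "ln (real p) / real p ^ k \<le> (1 / 2) ^ (k - 2) * (ln (real p) / real p ^ 2)" if "p \<in> ?P" "k \<ge> 2" for p k
  proof -
    have p2: "real p \<ge> 2" using that prime_ge_2_nat by force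
    have "real p ^ k = real p ^ (k - 2) * real p ^ 2" using that(2) by (metis le_add_diff_inverse2 power_add)
    then have "ln (real p) / real p ^ k = (1 / real p) ^ (k - 2) * (ln (real p) / real p ^ 2)"
      by (simp add: power_one_over)
    also have "\<dots> \<le> (1 / 2) ^ (k - 2) * (ln (real p) / real p ^ 2)"
      using p2 term0[OF that(1)] by (intro mult_right_mono power_mono) (auto intro!: divide_left_mono)
    finally show ?thesis .
  qed
  have "summable (\<lambda>n. ln (real n) / real n ^ 2)"
    using summable_ln_div_powr[of 2] by (rule summable_cong[THEN iffD1, rotated])
      (auto intro!: always_eventually simp: powr_numeral)
  then have "(\<lambda>n. ln (real n) / real n ^ 2) summable_on UNIV"
  proof (rule summable_nonneg_imp_summable_on)
    show "ln (real n) / (real n)\<^sup>2 \<ge> 0" for n by (cases "n = 0") auto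
  qed
  then have s2: "(\<lambda>p. ln (real p) / real p ^ 2) summable_on ?P"
    by (rule summable_on_subset_banach) simp
  have sk: "(\<lambda>p. ln (real p) / real p ^ k) summable_on ?P" if "k \<ge> 2" for k
    by (rule summable_on_comparison_test[OF summable_on_cmult_right[OF s2] le2 term0]) (use that in auto)
  have g0: "g k \<ge> 0" for k unfolding g_def by (intro infsum_nonneg term0)
  have g_le: "g k \<le> (1 / 2) ^ (k - 2) * g 2" if "k \<ge> 2" for k
    unfolding g_def infsum_cmult_right'[symmetric]
    by (intro infsum_mono sk summable_on_cmult_right s2 le2 that)
  have "summable (\<lambda>k. (1 / 2) ^ k * (4 * g 2))" by (intro summable_mult2 summable_geometric) simp
  then have "(\<lambda>k. (1 / 2) ^ k * (4 * g 2)) summable_on UNIV"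
    by (intro summable_nonneg_imp_summable_on) (auto simp: g0)
  then have "(\<lambda>k. (1 / 2) ^ k * (4 * g 2)) summable_on {2..}"
    by (rule summable_on_subset_banach) simp
  then have "g summable_on {2..}"
  proof (rule summable_on_comparison_test)
    fix k :: nat assume "k \<in> {2..}"
    then have k: "k \<ge> 2" by simp
    then have "(1 / 2 :: real) ^ k * 4 = (1 / 2) ^ (k - 2)" by (simp add: power_diff power2_eq_square)
    then show "g k \<le> (1 / 2) ^ k * (4 * g 2)" using g_le[OF k] by (simp add: mult.assoc[symmetric])
  qed (rule g0)
  then have le_inf: "(\<Sum>k\<in>{2,3,4,5,6,7,8,9}. g k) \<le> infsum g {2..}"
    by (rule finite_sum_le_infsum) (auto simp: g0)
  have g_ge: "g k \<ge> (\<Sum>p\<in>{2,3,5,7,11}. ln (real p) / real p ^ k)" if "k \<ge> 2" for k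
    unfolding g_def
  proof (rule finite_sum_le_infsum[OF sk[OF that]])
    have "prime (2::nat)" "prime (3::nat)" "prime (5::nat)" "prime (7::nat)" "prime (11::nat)"
      by (simp_all add: prime_nat_numeral_eq)
    then show "{2,3,5,7,11} \<subseteq> ?P" by simp
  qed (use term0 in auto)
  have "(\<Sum>k\<in>{2,3,4,5,6,7,8,9}. g k) \<ge> (\<Sum>k\<in>{2::nat,3,4,5,6,7,8,9}. \<Sum>p\<in>{2::nat,3,5,7,11}. ln (real p) / real p ^ k)"
  proof (rule sum_mono)
    fix k :: nat assume "k \<in> {2,3,4,5,6,7,8,9}"
    then have "k \<ge> 2" by auto
    then show "(\<Sum>p\<in>{2::nat,3,5,7,11}. ln (real p) / real p ^ k) \<le> g k" by (rule g_ge)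
  qed
  moreover have "(\<Sum>k\<in>{2::nat,3,4,5,6,7,8,9}. \<Sum>p\<in>{2::nat,3,5,7,11}. ln (real p) / real p ^ k) \<ge> 67 / 100"
  proof -
    have "ln (3::real) \<ge> 19 / 12 * ln 2" using ln_numeral_le_ln_2[of 2 19 3 12] by simp
    moreover have "ln (5::real) \<ge> 16 / 7 * ln 2" using ln_numeral_le_ln_2[of 2 16 5 7] by simp
    moreover have "ln (7::real) \<ge> 11 / 4 * ln 2" using ln_numeral_le_ln_2[of 2 11 7 4] by simp
    moreover have "ln (11::real) \<ge> 3 * ln 2" using ln_numeral_le_ln_2[of 2 3 11 1] by simp
    ultimately show ?thesis using ln_2_bounds(1) by simp
  qed
  ultimately have "infsum g {2..} \<ge> 67 / 100" using le_inf by linarith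
  then show ?thesis by (simp only: g_def)
qed

text \<open>
  The numerical margin: \<open>ln 1.12 + 1.11 + 0.001 < 19/33 + 0.67\<close>, where \<open>1.11\<close> is the Chebyshev constant, \<open>1.12\<close>
  the loss in the length of the resonator and \<open>19/33 < euler_mascheroni\<close>.
\<close>

lemma C1_less:
  assumes "\<beta> < 1" "\<epsilon> > 0"
  shows "C1 \<beta> - \<epsilon> < ln (1 / (112 / 100 * ln 4) * (1 - \<beta>)) - 211 / 100 - 1 / 1000"
proof -
  have "ln (112 / 100 :: real) \<le> 12 / 100" using ln_le_minus_one[of "112 / 100 :: real"] by simp
  moreover have "ln (1 / (a * l) * b) = ln b - ln a - ln l" if "a > 0" "l > 0" "b > 0" for a l b :: real
    using that by (simp add: ln_div ln_mult)
  from this[of "112 / 100" "ln 4" "1 - \<beta>"]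
  have "ln (1 / (112 / 100 * ln 4) * (1 - \<beta>)) = ln (1 - \<beta>) - ln (112 / 100) - ln (ln 4)"
    using assms by simp
  ultimately show ?thesis
    using prime_power_log_sum_ge euler_mascheroni_gt_19_over_33 assms unfolding C1_def by simp
qed

section \<open>Choice of the parameters and the final comparison\<close>

text \<open>Read \<open>w = ln T\<close> and \<open>N = \<lfloor>z w\<rfloor>\<close>, so that
  \<open>z w - 1\<close> bounds \<open>N\<close> from below. As
  \<open>z w = c * b * w * ln (b * w)\<close>, its logarithm is
  \<open>ln w + ln (ln w) + ln (c * b) + o(1)\<close>; the remaining quotients are error terms of
  the gain and of the shift.\<close>

lemma resonator_length_asymptotics:
  fixes b c C K V \<eta> :: real
  assumes b: "b > 0" and c: "c > 0" and V: "V < ln (c * b) - 211 / 100 - \<eta>"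
  defines "z \<equiv> \<lambda>w. c * (b * w * ln (b * w))"
  shows "\<forall>\<^sub>F w in at_top. ln w + ln (ln w) + V <
     ln (z w - 1) - 211 / 100 - C / (z w - 1) - 1 / ln (z w - 1) - K / ln (z w - 1) ^ 3 - \<eta>"
proof -
  have "((\<lambda>w. ln (z w - 1) - 211 / 100 - C / (z w - 1) - 1 / ln (z w - 1) - K / ln (z w - 1) ^ 3 - \<eta> - ln w - ln (ln w))
      \<longlongrightarrow> ln (c * b) - 211 / 100 - \<eta>) at_top"
    unfolding z_def using b c by (real_asymp simp: ln_mult)
  then have "\<forall>\<^sub>F w in at_top. V < ln (z w - 1) - 211 / 100 - C / (z w - 1) - 1 / ln (z w - 1) - K / ln (z w - 1) ^ 3 - \<eta> - ln w - ln (ln w)"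
    using V by (rule order_tendstoD(1))
  then show ?thesis by eventually_elim simp
qed

lemma resonator_length_large:
  fixes b c M :: real
  assumes b: "b > 0" and c: "c > 0"
  defines "z \<equiv> \<lambda>w. c * (b * w * ln (b * w))"
  shows "\<forall>\<^sub>F w in at_top. b * w \<le> z w - 1 \<and> M \<le> z w - 1 \<and> M \<le> ln (b * w) \<and> z w \<le> exp w \<and> M \<le> ln w + ln (ln w)"
proof (intro eventually_conj)
  show "\<forall>\<^sub>F w in at_top. b * w \<le> z w - 1" unfolding z_def using b c by real_asymp
  have "filterlim (\<lambda>w. z w - 1) at_top at_top" unfolding z_def using b c by real_asymp
  then show "\<forall>\<^sub>F w in at_top. M \<le> z w - 1" by (simp add: filterlim_at_top)
  have "filterlim (\<lambda>w. ln (b * w)) at_top at_top" using b by real_asymp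
  then show "\<forall>\<^sub>F w in at_top. M \<le> ln (b * w)" by (simp add: filterlim_at_top)
  show "\<forall>\<^sub>F w in at_top. z w \<le> exp w" unfolding z_def using b c by real_asymp
  have "filterlim (\<lambda>w::real. ln w + ln (ln w)) at_top at_top" by real_asymp
  then show "\<forall>\<^sub>F w in at_top. M \<le> ln w + ln (ln w)" by (simp add: filterlim_at_top)
qed

text \<open>The left side is of order \<open>T powr (1 - a)\<close> times a power of
  \<open>ln T\<close>, with \<open>a = (1 - \<beta>) * (1 - \<kappa>) > 0\<close>. The cube of the
  logarithm is the bound for the logarithmic derivative at \<open>1 + \<delta>\<close>, since
  \<open>1 / \<delta>\<close> is at most \<open>ln T ^ 3\<close>.\<close>

lemma power_saving:
  fixes \<beta> \<kappa> \<eta> K :: real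
  assumes "0 < \<beta>" "\<beta> < 1" "0 < \<kappa>" "\<kappa> < 1" "\<eta> > 0" "K > 0"
  shows "\<forall>\<^sub>F T in at_top. T powr \<beta> + 1 \<le> T - 1 \<and> 
      2 * (T powr \<beta> + 1) * (K * ln T ^ 3) * exp (\<kappa> * ((1 - \<beta>) * ln T)) < \<eta> * (T - 1)"
proof -
  define a where "a = (1 - \<beta>) * (1 - \<kappa>)"
  have a: "a > 0" using assms by (simp add: a_def)
  have b: "\<beta> - 1 < 0" using assms by simp
  have "((\<lambda>T::real. T powr (\<beta> - 1)) \<longlongrightarrow> 0) at_top" using b by real_asymp
  then have "\<forall>\<^sub>F T in at_top. T powr (\<beta> - 1) < 1 / 2" by (rule order_tendstoD) simp
  moreover have "((\<lambda>T::real. (8 * K / \<eta>) * (ln T ^ 3 * T powr (- a))) \<longlongrightarrow> 0) at_top" using a by real_asymp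
  then have "\<forall>\<^sub>F T in at_top. (8 * K / \<eta>) * (ln T ^ 3 * T powr (- a)) < 1" by (rule order_tendstoD) simp
  ultimately show ?thesis using eventually_gt_at_top[of 4]
  proof eventually_elim
    case (elim T)
    have "T powr (\<beta> - 1) = T powr \<beta> / T" using elim by (simp add: powr_diff)
    then have "T powr \<beta> / T < 1 / 2" using elim by simp
    then have "T powr \<beta> < T / 2" using elim by (simp add: pos_divide_less_eq)
    then have 1: "T powr \<beta> + 1 \<le> T - 1" using elim by simp
    have T_beta: "1 \<le> T powr \<beta>" using elim assms by (simp add: ge_one_powr_ge_zero)
    have "exp (\<kappa> * ((1 - \<beta>) * ln T)) = T powr (\<kappa> * (1 - \<beta>))" using elim by (simp add: powr_def mult.assoc)
    moreover have "T powr \<beta> * T powr (\<kappa> * (1 - \<beta>)) = T * T powr (- a)"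
    proof -
      have "\<beta> + \<kappa> * (1 - \<beta>) = 1 + - a" by (simp add: a_def algebra_simps)
      then show ?thesis using elim by (simp flip: powr_add add: powr_mult_base)
    qed
    moreover have "0 \<le> K * ln T ^ 3" using elim assms by simp
    then have "2 * (T powr \<beta> + 1) * (K * ln T ^ 3) * E \<le> 4 * T powr \<beta> * (K * ln T ^ 3) * E" if "E \<ge> 0" for E
      using T_beta that by (intro mult_right_mono) auto
    from this[of "T powr (\<kappa> * (1 - \<beta>))"]
    have "2 * (T powr \<beta> + 1) * (K * ln T ^ 3) * T powr (\<kappa> * (1 - \<beta>)) \<le> 4 * (K * ln T ^ 3) * (T powr \<beta> * T powr (\<kappa> * (1 - \<beta>)))"
      by (simp add: mult_ac)
    moreover have "4 * (K * ln T ^ 3) * (T * T powr (- a)) < \<eta> * (T / 2)"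
    proof -
      have "(8 * K / \<eta>) * (ln T ^ 3 * T powr (- a)) * (\<eta> * T / 2) < 1 * (\<eta> * T / 2)"
        using elim assms by (intro mult_strict_right_mono) auto
      then show ?thesis using assms by (simp add: mult_ac)
    qed
    moreover have "\<eta> * (T / 2) \<le> \<eta> * (T - 1)" using assms elim by (intro mult_left_mono) auto
    ultimately have "2 * (T powr \<beta> + 1) * (K * ln T ^ 3) * exp (\<kappa> * ((1 - \<beta>) * ln T)) < \<eta> * (T - 1)"
      by simp
    with 1 show ?case by simp
  qed
qed

lemma resonator_product:
  fixes N :: nat
  assumes "(\<Sum>p | prime p \<and> p \<le> N. ln ((2 * real N - real p) / real p)) \<le> c"
  shows "(\<Prod>p | prime p \<and> p \<le> N. (2 * real N - real p) / real p) \<le> exp c"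
proof -
  have "(\<Prod>p | prime p \<and> p \<le> N. (2 * real N - real p) / real p)
      = (\<Prod>p | prime p \<and> p \<le> N. exp (ln ((2 * real N - real p) / real p)))"
  proof (rule prod.cong)
    fix p assume "p \<in> {p. prime p \<and> p \<le> N}"
    then have "p > 0" "p \<le> N" by (auto simp: prime_gt_0_nat)
    then have "(2 * real N - real p) / real p > 0" by (intro divide_pos_pos) auto
    then show "(2 * real N - real p) / real p = exp (ln ((2 * real N - real p) / real p))" by simp
  qed simp
  also have "\<dots> = exp (\<Sum>p | prime p \<and> p \<le> N. ln ((2 * real N - real p) / real p))"
    by (subst exp_sum) auto
  finally show ?thesis using assms by simp
qed

lemma log_deriv_zeta_large_value:
  assumes \<beta>: "0 < \<beta>" "\<beta> < 1" and \<epsilon>: "\<epsilon> > 0"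
  shows "\<forall>\<^sub>F T in at_top. \<exists>u\<in>{T powr \<beta>..T}.
     - Re (deriv zeta (1 + \<i> * of_real u) / zeta (1 + \<i> * of_real u)) \<ge> ln (ln T) + ln (ln (ln T)) + C1 \<beta> - \<epsilon>"
proof -
  define \<eta> :: real where "\<eta> = 1 / 1000"
  define b where "b = 1 - \<beta>"
  \<comment> \<open>The asymptotically ideal constant \<open>1 / ln 4\<close> is shortened by 1.12,
    slightly more than the factor 1.115 by which the cost of the resonator may exceed its true
    size.\<close>
  define c :: real where "c = 1 / (112 / 100 * ln 4)"
  define z where "z = (\<lambda>w. c * (b * w * ln (b * w)))"
  \<comment> \<open>Ratio of the cost factor 1.115 to 1.12: the fraction of the exponent
    \<open>1 - \<beta>\<close> that the resonator consumes. Being below 1, it leaves a power of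
    \<open>T\<close> to spare.\<close>
  define \<kappa> :: real where "\<kappa> = 1115 / 1120"
  have b: "b > 0" using \<beta> by (simp add: b_def)
  have c: "c > 0" by (simp add: c_def)
  obtain K1 where K1: "K1 > 0"
    "\<And>M Y T \<delta> t. 0 < Y \<Longrightarrow> 0 \<le> M \<Longrightarrow>
      (\<And>u. u \<in> {Y..T} \<Longrightarrow> - Re (deriv zeta (1 + \<i> * of_real u) / zeta (1 + \<i> * of_real u)) \<le> M) \<Longrightarrow>
      0 < \<delta> \<Longrightarrow> \<delta> < 1 \<Longrightarrow> t \<in> {Y + 1..T - 1} \<Longrightarrow>
      - Re (deriv zeta (1 + of_real \<delta> + \<i> * of_real t) / zeta (1 + of_real \<delta> + \<i> * of_real t)) \<le> M + K1 * \<delta>"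
    by (rule Re_log_deriv_zeta_from_boundary) blast
  obtain K2 where K2: "K2 > 0" "\<And>x t. 0 < x \<Longrightarrow> x \<le> 1 \<Longrightarrow>
      norm (deriv zeta (1 + of_real x + \<i> * of_real t) / zeta (1 + of_real x + \<i> * of_real t)) \<le> K2 / x"
    using log_deriv_zeta_bound by blast
  obtain C where C: "C \<ge> 0" "\<And>N. psi N \<le> 111 / 100 * real N + C" using psi_bound by blast
  obtain N0 where N0: "\<And>N. N \<ge> N0 \<Longrightarrow> (\<Sum>p | prime p \<and> p \<le> N. ln ((2 * real N - real p) / real p))
      \<le> 1115 / 1000 * ln 4 * real N / ln (real N)"
    using resonator_cost by (auto simp: eventually_sequentially)
  \<comment> \<open>One threshold for all demands: the cost bound holds at \<open>N\<close>, the
    target value \<open>V\<close> is nonnegative, \<open>C / N \<le> 1\<close>, and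
    \<open>ln N \<ge> 8\<close> outweighs the constants of the gain.\<close>
  define M where "M = real N0 + \<bar>C1 \<beta> - \<epsilon>\<bar> + C + 8"
  have C1: "C1 \<beta> - \<epsilon> < ln (c * b) - 211 / 100 - \<eta>"
    using C1_less[OF \<beta>(2) \<epsilon>] by (simp add: c_def b_def \<eta>_def)
  have ln_top: "filterlim (ln :: real \<Rightarrow> real) at_top at_top" by (rule ln_at_top)
  have ev1: "\<forall>\<^sub>F w in at_top. ln w + ln (ln w) + (C1 \<beta> - \<epsilon>) <
       ln (z w - 1) - 211 / 100 - C / (z w - 1) - 1 / ln (z w - 1) - K1 / ln (z w - 1) ^ 3 - \<eta>"
    unfolding z_def by (rule resonator_length_asymptotics[OF b c C1])
  have ev2: "\<forall>\<^sub>F w in at_top. b * w \<le> z w - 1 \<and> M \<le> z w - 1 \<and> M \<le> ln (b * w) \<and> z w \<le> exp w \<and> M \<le> ln w + ln (ln w)"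
    unfolding z_def by (rule resonator_length_large[OF b c])
  have \<kappa>: "0 < \<kappa>" "\<kappa> < 1" by (simp_all add: \<kappa>_def)
  have \<eta>: "\<eta> > 0" by (simp add: \<eta>_def)
  from eventually_compose_filterlim[OF ev1 ln_top] eventually_compose_filterlim[OF ev2 ln_top] power_saving[OF \<beta> \<kappa> \<eta> K2(1)] eventually_gt_at_top[of 1]
  show ?thesis
  proof eventually_elim
    case (elim T)
    define w where "w = ln T"
    define B where "B = b * w"
    define N where "N = nat \<lfloor>z w\<rfloor>"
    define L where "L = ln (real N)"
    \<comment> \<open>Small enough that the gain, of size \<open>L\<close>, loses only
      \<open>\<delta> * L * L = 1 / L\<close>, and that the shift costs
      \<open>K1 * \<delta> = o(1)\<close>; large enough that the value at height 0, at most
      \<open>K2 / \<delta>\<close>, is a power of a logarithm.\<close>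
    define \<delta> where "\<delta> = 1 / L ^ 3"
    define V where "V = ln w + ln (ln w) + C1 \<beta> - \<epsilon>"
    have main: "ln w + ln (ln w) + (C1 \<beta> - \<epsilon>) <
       ln (z w - 1) - 211 / 100 - C / (z w - 1) - 1 / ln (z w - 1) - K1 / ln (z w - 1) ^ 3 - \<eta>"
      using elim(1) by (simp add: w_def)
    have large: "B \<le> z w - 1" "M \<le> z w - 1" "M \<le> ln B" "z w \<le> exp w" "M \<le> ln w + ln (ln w)"
      using elim(2) by (auto simp: w_def B_def)
    have M: "M \<ge> 8" "M \<ge> real N0" "M \<ge> \<bar>C1 \<beta> - \<epsilon>\<bar>" "M \<ge> C" using C by (auto simp: M_def)
    have T: "T > 1" by fact
    have w: "w > 0" using T by (simp add: w_def)
    have B: "B > 0" using b w by (simp add: B_def)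
    have z1: "z w - 1 \<ge> 8" using large M by linarith
    have N_bounds: "real N \<le> z w" "z w - 1 \<le> real N" unfolding N_def using z1 by linarith+
    have N_ge: "N \<ge> N0" "N \<ge> 2" "real N \<ge> 8" using N_bounds z1 large M by linarith+
    have ln_mono: "ln B \<le> ln (z w - 1)" "ln (z w - 1) \<le> L" "L \<le> w"
    proof -
      show "ln B \<le> ln (z w - 1)" using large(1) B by simp
      show "ln (z w - 1) \<le> L" unfolding L_def using N_bounds z1 by simp
      have "L \<le> ln (exp w)" unfolding L_def using N_bounds(1) large(4) N_ge by (subst ln_le_cancel_iff) auto
      then show "L \<le> w" by simp
    qed
    have lz: "ln (z w - 1) \<ge> 8" "L \<ge> 8" using ln_mono large M by linarith+
    have L3: "L ^ 3 > 1" "1 / L ^ 3 * L \<le> 1 / L" "1 / L ^ 3 * L * L \<le> 1 / L"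
    proof -
      show "L ^ 3 > 1" using lz by (intro one_less_power) auto
      have "1 / L ^ 3 * L = 1 / (L * L)" using lz by (simp add: power3_eq_cube)
      also have "\<dots> \<le> 1 / (L * 1)" using lz by (intro divide_left_mono mult_left_mono) auto
      finally show "1 / L ^ 3 * L \<le> 1 / L" by simp
      show "1 / L ^ 3 * L * L \<le> 1 / L" using lz by (simp add: power3_eq_cube)
    qed
    have \<delta>: "0 < \<delta>" "\<delta> < 1" using L3(1) lz unfolding \<delta>_def by (simp_all only: divide_less_eq_1_pos zero_less_divide_1_iff)
    have inv_mono: "1 / L \<le> 1 / ln (z w - 1)" "K1 * \<delta> \<le> K1 / ln (z w - 1) ^ 3" "C / real N \<le> C / (z w - 1)"
    proof -
      show "1 / L \<le> 1 / ln (z w - 1)" using lz ln_mono by (intro divide_left_mono) auto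
      have "1 / L ^ 3 \<le> 1 / ln (z w - 1) ^ 3" using lz ln_mono by (intro divide_left_mono power_mono) auto
      then show "K1 * \<delta> \<le> K1 / ln (z w - 1) ^ 3" using K1(1) unfolding \<delta>_def
        by (metis less_imp_le mult_left_mono mult.right_neutral times_divide_eq_right)
      show "C / real N \<le> C / (z w - 1)" using C(1) N_bounds z1 by (intro divide_left_mono) auto
    qed
    let ?G = "\<Sum>n=1..N. mangoldt n / real n powr (1 + \<delta>) * (1 - real n / real N)"
    have C_N: "0 \<le> C / real N" "C / real N \<le> 1"
      using C(1) N_bounds large M N_ge by simp_all
    define X where "X = L - 1 - 111 / 100 - C / real N"
    have X: "0 \<le> X" "X \<le> L" using lz C_N unfolding X_def by linarith+
    have "\<delta> * L \<le> 1 / L" using L3(2) by (simp only: \<delta>_def)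
    also have "\<dots> \<le> 1" using lz by simp
    finally have \<delta>L: "\<delta> * L \<le> 1" .
    have "(1 - \<delta> * L) * X \<le> ?G"
      unfolding X_def L_def
      by (rule resonator_gain[OF C(2)]) (use N_ge \<delta> \<delta>L X in \<open>auto simp: L_def X_def\<close>)
    moreover have "\<delta> * L * X \<le> 1 / L"
    proof -
      have "\<delta> * L * X \<le> \<delta> * L * L" using \<delta> lz X by (intro mult_left_mono) auto
      also have "\<dots> \<le> 1 / L" using L3(3) by (simp only: \<delta>_def)
      finally show ?thesis .
    qed
    ultimately have "X - 1 / L \<le> ?G" by (simp add: left_diff_distrib)
    \<comment> \<open>The target, even after paying for the passage to abscissa
      \<open>1 + \<delta>\<close>, lies below the gain by the fixed margin
      \<open>\<eta>\<close>.\<close>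
    then have G: "V + K1 * \<delta> \<le> ?G - \<eta>"
      using main inv_mono ln_mono unfolding V_def X_def by linarith
    have V0: "V \<ge> 0" using large M unfolding V_def by linarith
    have "\<eta> \<le> ?G"
    proof -
      have "0 \<le> K1 * \<delta>" using K1(1) \<delta> by simp
      then show ?thesis using G V0 by linarith
    qed
    show "\<exists>u\<in>{T powr \<beta>..T}. - Re (deriv zeta (1 + \<i> * of_real u) / zeta (1 + \<i> * of_real u))
        \<ge> ln (ln T) + ln (ln (ln T)) + C1 \<beta> - \<epsilon>"
    proof (rule ccontr)
      \<comment> \<open>All values on the line are then at most \<open>V\<close>; the transfer
        shrinks the interval by 1 at both ends, and the resonance bound, applied with
        \<open>T - 1\<close> and \<open>T powr \<beta> + 1\<close>, contradicts the power
        saving.\<close>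
      assume "\<not> ?thesis"
      then have small: "- Re (deriv zeta (1 + \<i> * of_real u) / zeta (1 + \<i> * of_real u)) \<le> V"
        if "u \<in> {T powr \<beta>..T}" for u using that unfolding V_def w_def by force
      have Y: "T powr \<beta> > 0" using T by simp
      have f_le: "- Re (deriv zeta (1 + of_real \<delta> + \<i> * of_real t) / zeta (1 + of_real \<delta> + \<i> * of_real t)) \<le> ?G - \<eta>"
        if "t \<in> {T powr \<beta> + 1..T - 1}" for t
        using K1(2)[OF Y V0 small \<delta> that] G by linarith
      have T_pos: "T - 1 > 0" and Y_pos: "T powr \<beta> + 1 > 0" and Y_le: "T powr \<beta> + 1 \<le> T - 1"
        using T Y elim(3) by linarith+
      have "\<eta> * (T - 1) \<le> 2 * (T powr \<beta> + 1) *
          (- Re (deriv zeta (1 + of_real \<delta> + \<i> * of_real 0) / zeta (1 + of_real \<delta> + \<i> * of_real 0))) *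
          (\<Prod>p | prime p \<and> p \<le> N. (2 * real N - real p) / real p)"
        by (rule resonance_bound[OF N_ge(2) \<delta>(1) T_pos Y_pos Y_le \<eta> \<open>\<eta> \<le> ?G\<close> f_le])
      also have "\<dots> \<le> 2 * (T powr \<beta> + 1) * (K2 * w ^ 3) * exp (\<kappa> * ((1 - \<beta>) * w))"
      proof (rule mult_mono[OF mult_left_mono])
        have "- Re (deriv zeta (1 + of_real \<delta> + \<i> * of_real 0) / zeta (1 + of_real \<delta> + \<i> * of_real 0)) \<le> K2 / \<delta>"
          using K2(2)[of \<delta> 0] \<delta> abs_Re_le_cmod[of "deriv zeta (1 + of_real \<delta> + \<i> * of_real 0) / zeta (1 + of_real \<delta> + \<i> * of_real 0)"]
          by linarith
        also have "\<dots> = K2 * L ^ 3" by (simp add: \<delta>_def)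
        also have "\<dots> \<le> K2 * w ^ 3" using K2(1) lz ln_mono by (intro mult_left_mono power_mono) auto
        finally show "- Re (deriv zeta (1 + of_real \<delta> + \<i> * of_real 0) / zeta (1 + of_real \<delta> + \<i> * of_real 0)) \<le> K2 * w ^ 3" .
        \<comment> \<open>Numerator and denominator are relaxed by \<open>N \<le> z w\<close> and
          \<open>ln B \<le> ln N\<close>. Since \<open>z w = c * B * ln B\<close>, the logarithms
          cancel and exactly \<open>\<kappa> * B\<close> remains.\<close>
        have "1115 / 1000 * ln 4 * real N / ln (real N) \<le> 1115 / 1000 * ln 4 * z w / ln B"
        proof (rule frac_le)
          show "ln B > 0" using large M by linarith
          show "ln B \<le> ln (real N)" using ln_mono unfolding L_def by linarith
          show "1115 / 1000 * ln 4 * real N \<le> 1115 / 1000 * ln 4 * z w"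
            using N_bounds by (intro mult_left_mono) auto
          show "0 \<le> 1115 / 1000 * ln 4 * z w" using z1 by (intro mult_nonneg_nonneg) auto
        qed
        also have "\<dots> = \<kappa> * ((1 - \<beta>) * w)"
          using large M unfolding z_def B_def c_def b_def \<kappa>_def by (simp add: field_simps)
        finally have "(\<Sum>p | prime p \<and> p \<le> N. ln ((2 * real N - real p) / real p)) \<le> \<kappa> * ((1 - \<beta>) * w)"
          using N0[OF N_ge(1)] by linarith
        then show "(\<Prod>p | prime p \<and> p \<le> N. (2 * real N - real p) / real p) \<le> exp (\<kappa> * ((1 - \<beta>) * w))"
          by (rule resonator_product)
        show "0 \<le> (\<Prod>p | prime p \<and> p \<le> N. (2 * real N - real p) / real p)"
          by (intro prod_nonneg ballI divide_nonneg_nonneg) auto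
      qed (use Y K2(1) w in auto)
      also have "\<dots> < \<eta> * (T - 1)" using elim(3) by (simp add: w_def)
      finally show False by simp
    qed
  qed
qed

lemma continuous_attains_arg_max:
  fixes g :: "real \<Rightarrow> real"
  assumes "continuous_on {a..b} g" "a \<le> b"
  obtains t where "is_arg_max g (\<lambda>t. t \<in> {a..b}) t" "\<And>u. u \<in> {a..b} \<Longrightarrow> g u \<le> g t"
proof -
  obtain t where "t \<in> {a..b}" "\<forall>u\<in>{a..b}. g u \<le> g t"
    using continuous_attains_sup[of "{a..b}" g] assms by auto
  then show ?thesis using that[of t] by (auto simp: is_arg_max_def not_less)
qed

theorem theorem1:
  fixes \<beta> \<epsilon> :: real
  assumes "\<beta> \<in> {0<..<1}" and "\<epsilon> \<in> {0<..<1}"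
  shows "(\<forall>\<^sub>F T :: real in at_top. \<exists>t.
            is_arg_max (\<lambda>t. - Re (deriv zeta (1 + \<i> * of_real t) / zeta (1 + \<i> * of_real t)))
              (\<lambda>t. t \<in> {T powr \<beta>..T}) t \<and>
            - Re (deriv zeta (1 + \<i> * of_real t) / zeta (1 + \<i> * of_real t))
              \<ge> ln (ln T) + ln (ln (ln T)) + C1 \<beta> - \<epsilon>) \<and>
         (\<forall>\<^sub>F T :: real in at_top. \<exists>t.
            is_arg_max (\<lambda>t. norm (deriv zeta (1 + \<i> * of_real t) / zeta (1 + \<i> * of_real t)))
              (\<lambda>t. t \<in> {T powr \<beta>..T}) t \<and>
            norm (deriv zeta (1 + \<i> * of_real t) / zeta (1 + \<i> * of_real t))
              \<ge> ln (ln T) + ln (ln (ln T)) + C1 \<beta> - \<epsilon>)"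
proof -
  let ?Z = "\<lambda>t::real. deriv zeta (1 + \<i> * of_real t) / zeta (1 + \<i> * of_real t)"
  \<comment> \<open>A positive left endpoint keeps the segment away from the pole at 1, so the
    quotient is continuous and the maxima are attained.\<close>
  have cont: "continuous_on {a..b} ?Z" if "a > 0" for a b :: real
  proof (rule continuous_at_imp_continuous_on, rule ballI)
    fix t assume "t \<in> {a..b}"
    then have "1 + \<i> * of_real t \<noteq> 1" using that by simp
    then show "isCont ?Z t"
      by (intro isCont_o2[OF _ isCont_log_deriv_zeta]) (auto intro!: continuous_intros)
  qed
  have large: "\<forall>\<^sub>F T in at_top. \<exists>u\<in>{T powr \<beta>..T}. - Re (?Z u) \<ge> ln (ln T) + ln (ln (ln T)) + C1 \<beta> - \<epsilon>"
    using assms by (intro log_deriv_zeta_large_value) auto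
  show ?thesis
  proof (rule conjI)
    from large eventually_gt_at_top[of 0]
    show "\<forall>\<^sub>F T :: real in at_top. \<exists>t. is_arg_max (\<lambda>t. - Re (?Z t)) (\<lambda>t. t \<in> {T powr \<beta>..T}) t \<and>
            - Re (?Z t) \<ge> ln (ln T) + ln (ln (ln T)) + C1 \<beta> - \<epsilon>"
    proof eventually_elim
      case (elim T)
      then obtain u where u: "u \<in> {T powr \<beta>..T}" "- Re (?Z u) \<ge> ln (ln T) + ln (ln (ln T)) + C1 \<beta> - \<epsilon>" by blast
      have "continuous_on {T powr \<beta>..T} (\<lambda>t. - Re (?Z t))"
        using elim by (intro continuous_intros cont) simp
      then obtain t where t: "is_arg_max (\<lambda>t. - Re (?Z t)) (\<lambda>t. t \<in> {T powr \<beta>..T}) t"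
        "\<And>u. u \<in> {T powr \<beta>..T} \<Longrightarrow> - Re (?Z u) \<le> - Re (?Z t)"
        by (rule continuous_attains_arg_max) (use u in auto)
      then show ?case using order_trans[OF u(2) t(2)[OF u(1)]] by blast
    qed
  next
    from large eventually_gt_at_top[of 0]
    show "\<forall>\<^sub>F T :: real in at_top. \<exists>t. is_arg_max (\<lambda>t. norm (?Z t)) (\<lambda>t. t \<in> {T powr \<beta>..T}) t \<and>
            norm (?Z t) \<ge> ln (ln T) + ln (ln (ln T)) + C1 \<beta> - \<epsilon>"
    proof eventually_elim
      case (elim T)
      then obtain u where u: "u \<in> {T powr \<beta>..T}" "- Re (?Z u) \<ge> ln (ln T) + ln (ln (ln T)) + C1 \<beta> - \<epsilon>" by blast
      have "continuous_on {T powr \<beta>..T} (\<lambda>t. norm (?Z t))"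
        using elim by (intro continuous_intros cont) simp
      then obtain t where t: "is_arg_max (\<lambda>t. norm (?Z t)) (\<lambda>t. t \<in> {T powr \<beta>..T}) t"
        "\<And>u. u \<in> {T powr \<beta>..T} \<Longrightarrow> norm (?Z u) \<le> norm (?Z t)"
        by (rule continuous_attains_arg_max) (use u in auto)
      have "- Re (?Z u) \<le> norm (?Z t)"
        using t(2)[OF u(1)] abs_Re_le_cmod[of "?Z u"] by linarith
      with u(2) have "norm (?Z t) \<ge> ln (ln T) + ln (ln (ln T)) + C1 \<beta> - \<epsilon>" by (rule order_trans)
      with t(1) show ?case by blast
    qed
  qed
qed

end
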